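(* Let $K>0$, $T>0$ and $r>0$ be constants, and let $N$ denote the cumulative distribution function of the standard normal law $\mathcal N(0,1)$. For $t\in[0,T)$ let $\phi(t)$ be the unique solution of the algebraic equation $$e^{\frac{\phi^2(t)}{2}}N(\phi(t))=\frac{e^{r(T-t)}}{2}.$$ Define the deterministic volatility function $$\sigma(t)=\sqrt{-2\phi(t)\phi'(t)},\qquad t\in[0,T),$$ assume that the asset price satisfies $dX_t=rX_t\,dt+\sigma(t)X_t\,dW_t$ under the risk-neutral measure $\mathsf Q$, and consider the American put option with strike $K$ and maturity $T$, with value function $$V(t,x)=\sup_{t\le\tau\le T}\mathsf E_{t,x}\left[e^{-r(\tau-t)}(K-X_\tau)^+\right],\qquad t\in[0,T),\ x>0.$$ Then the optimal exercise boundary of this option is $$b(t)=Ke^{-r(T-t)}e^{\int_t^T\frac{\sigma^2(s)}{2}\,ds}=\frac{K}{2N(\phi(t))},\qquad t\in[0,T);$$ that is, $\{(t,x)\in[0,T)\times(0,\infty): V(t,x)=K-x\}=\{(t,x)\in[0,T)\times(0,\infty): x\le b(t)\}$, and the two expressions for $b(t)$ agree.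
   Context: $W$ is a standard Brownian motion under the risk-neutral measure $\mathsf Q$; $\mathsf E_{t,x}$ is the expectation under $\mathsf Q$ given $X_t=x$; the supremum is over all stopping times $\tau$ of the filtration $\mathcal F^X$ generated by $X$ taking values in $[t,T]$. The dividend yield is zero. The exercise region is $\mathcal E=\{(t,x)\in[0,T)\times(0,\infty): V(t,x)=K-x\}$. The optimal exercise boundary is the function $b:[0,T)\to(0,\infty)$ such that $\mathcal E=\{(t,x)\in[0,T)\times(0,\infty): x\le b(t)\}$. *)

theory Defs
  imports "HOL-Probability.Probability"
begin

section \<open>Brownian motion, the Ito integral and stochastic differential equations\<close>

definition filtered_prob_space :: "'a measure \<Rightarrow> (real \<Rightarrow> 'a measure) \<Rightarrow> bool" where
  "filtered_prob_space M F \<longleftrightarrow>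
     prob_space M \<and> filtration (space M) F \<and> (\<forall>t. subalgebra M (F t))"

definition brownian_motion ::
  "'a measure \<Rightarrow> (real \<Rightarrow> 'a measure) \<Rightarrow> (real \<Rightarrow> 'a \<Rightarrow> real) \<Rightarrow> bool" where
  "brownian_motion M F W \<longleftrightarrow>
     filtered_prob_space M F \<and>
     (\<forall>t\<ge>0. W t \<in> borel_measurable (F t)) \<and>
     (\<forall>\<omega>\<in>space M. continuous_on {0..} (\<lambda>t. W t \<omega>)) \<and>
     (AE \<omega> in M. W 0 \<omega> = 0) \<and>
     (\<forall>s t. 0 \<le> s \<and> s < t \<longrightarrow>
        distributed M lborel (\<lambda>\<omega>. W t \<omega> - W s \<omega>) (normal_density 0 (sqrt (t - s))) \<and>
        prob_space.indep_set M (sets (F s))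
          {(\<lambda>\<omega>. W t \<omega> - W s \<omega>) -` B \<inter> space M | B. B \<in> sets borel})"

definition tendsto_in_prob0 :: "'a measure \<Rightarrow> (nat \<Rightarrow> 'a \<Rightarrow> ennreal) \<Rightarrow> bool" where
  "tendsto_in_prob0 M D \<longleftrightarrow>
     (\<forall>\<epsilon>>0::real. (\<lambda>k. measure M {\<omega> \<in> space M. D k \<omega> > ennreal \<epsilon>}) \<longlonglongrightarrow> 0)"

definition progressive ::
  "(real \<Rightarrow> 'a measure) \<Rightarrow> real \<Rightarrow> real \<Rightarrow> (real \<Rightarrow> 'a \<Rightarrow> real) \<Rightarrow> bool" where
  "progressive F a b H \<longleftrightarrow>
     (\<forall>u\<in>{a..b}. (\<lambda>(s, \<omega>). H s \<omega>) \<in> borel_measurable (restrict_space borel {a..u} \<Otimes>\<^sub>M F u))"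

text \<open>A simple integrand on \<open>[a, b]\<close> is given by grid points \<open>p 0 \<le> \<dots> \<le> p n\<close> in \<open>[a, b]\<close>
  and bounded weights \<open>\<xi> i\<close>, known at time \<open>p i\<close>, for the interval \<open>(p i, p (i + 1)]\<close>.\<close>

definition simple_integrand ::
  "'a measure \<Rightarrow> (real \<Rightarrow> 'a measure) \<Rightarrow> real \<Rightarrow> real \<Rightarrow>
   nat \<Rightarrow> (nat \<Rightarrow> real) \<Rightarrow> (nat \<Rightarrow> 'a \<Rightarrow> real) \<Rightarrow> bool" where
  "simple_integrand M F a b n p \<xi> \<longleftrightarrow>
     a \<le> p 0 \<and> p n \<le> b \<and> (\<forall>i<n. p i \<le> p (Suc i)) \<and>
     (\<forall>i<n. \<xi> i \<in> borel_measurable (F (p i)) \<and> (\<exists>C. \<forall>\<omega>\<in>space M. \<bar>\<xi> i \<omega>\<bar> \<le> C))"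

definition simple_process ::
  "nat \<Rightarrow> (nat \<Rightarrow> real) \<Rightarrow> (nat \<Rightarrow> 'a \<Rightarrow> real) \<Rightarrow> real \<Rightarrow> 'a \<Rightarrow> real" where
  "simple_process n p \<xi> s \<omega> = (\<Sum>i<n. \<xi> i \<omega> * indicator {p i<..p (Suc i)} s)"

definition simple_integral ::
  "(real \<Rightarrow> 'a \<Rightarrow> real) \<Rightarrow> nat \<Rightarrow> (nat \<Rightarrow> real) \<Rightarrow> (nat \<Rightarrow> 'a \<Rightarrow> real) \<Rightarrow> 'a \<Rightarrow> real" where
  "simple_integral W n p \<xi> \<omega> = (\<Sum>i<n. \<xi> i \<omega> * (W (p (Suc i)) \<omega> - W (p i) \<omega>))"

text \<open>\<open>has_ito_integral M F W a b H I\<close>: the random variable \<open>I\<close> is (a version of) the Ito integral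
  of \<open>H\<close> against \<open>W\<close> over \<open>[a, b]\<close>, for progressively measurable \<open>H\<close> whose square is almost surely
  integrable over \<open>[a, b]\<close>. Such \<open>H\<close> are limits of simple integrands in the mean-square distance
  over \<open>[a, b]\<close>, in probability, and the integral is the limit in probability of the corresponding
  elementary integrals. The nonnegative integral is used so that a non-integrable difference
  counts as infinite; square integrability of \<open>H\<close> is then implied by the convergence.\<close>

definition has_ito_integral ::
  "'a measure \<Rightarrow> (real \<Rightarrow> 'a measure) \<Rightarrow> (real \<Rightarrow> 'a \<Rightarrow> real) \<Rightarrow> real \<Rightarrow> real \<Rightarrow>
   (real \<Rightarrow> 'a \<Rightarrow> real) \<Rightarrow> ('a \<Rightarrow> real) \<Rightarrow> bool" where
  "has_ito_integral M F W a b H I \<longleftrightarrow>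
     progressive F a b H \<and> I \<in> borel_measurable M \<and>
     (\<exists>n p \<xi>. (\<forall>k. simple_integrand M F a b (n k) (p k) (\<xi> k)) \<and>
        tendsto_in_prob0 M (\<lambda>k \<omega>. \<integral>\<^sup>+s\<in>{a..b}.
          ennreal ((simple_process (n k) (p k) (\<xi> k) s \<omega> - H s \<omega>)\<^sup>2) \<partial>lborel) \<and>
        tendsto_in_prob0 M (\<lambda>k \<omega>. ennreal \<bar>simple_integral W (n k) (p k) (\<xi> k) \<omega> - I \<omega>\<bar>))"

text \<open>\<open>X\<close> is a continuous adapted solution on \<open>[t, T]\<close> of
  \<open>dX\<^sub>s = \<mu>(s, X\<^sub>s) ds + \<nu>(s, X\<^sub>s) dW\<^sub>s\<close> with \<open>X\<^sub>t = x\<close>.\<close>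

definition sde_solution ::
  "'a measure \<Rightarrow> (real \<Rightarrow> 'a measure) \<Rightarrow> (real \<Rightarrow> 'a \<Rightarrow> real) \<Rightarrow>
   (real \<Rightarrow> real \<Rightarrow> real) \<Rightarrow> (real \<Rightarrow> real \<Rightarrow> real) \<Rightarrow> real \<Rightarrow> real \<Rightarrow> real \<Rightarrow>
   (real \<Rightarrow> 'a \<Rightarrow> real) \<Rightarrow> bool" where
  "sde_solution M F W \<mu> \<nu> T t x X \<longleftrightarrow>
     (\<forall>u\<in>{t..T}. X u \<in> borel_measurable (F u)) \<and>
     (\<forall>\<omega>\<in>space M. continuous_on {t..T} (\<lambda>u. X u \<omega>)) \<and>
     (AE \<omega> in M. X t \<omega> = x) \<and>
     (\<forall>u\<in>{t..T}. \<exists>I. has_ito_integral M F W t u (\<lambda>s \<omega>. \<nu> s (X s \<omega>)) I \<and>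
        (AE \<omega> in M. set_integrable lborel {t..u} (\<lambda>s. \<mu> s (X s \<omega>)) \<and>
           X u \<omega> = x + (LINT s:{t..u}|lborel. \<mu> s (X s \<omega>)) + I \<omega>))"

section \<open>The American put\<close>

definition natural_filtration ::
  "'a set \<Rightarrow> real set \<Rightarrow> (real \<Rightarrow> 'a \<Rightarrow> real) \<Rightarrow> real \<Rightarrow> 'a measure" where
  "natural_filtration \<Omega> J X u =
     sigma \<Omega> {X s -` B \<inter> \<Omega> | s B. s \<in> J \<and> s \<le> u \<and> B \<in> sets borel}"

text \<open>\<open>X t x\<close> is the price process on \<open>[t, T]\<close> started from \<open>x\<close> at time \<open>t\<close>; the expectation
  given \<open>X\<^sub>t = x\<close> is the expectation of functionals of this process.\<close>

definition american_put_value ::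
  "'a measure \<Rightarrow> real \<Rightarrow> real \<Rightarrow> real \<Rightarrow> (real \<Rightarrow> real \<Rightarrow> real \<Rightarrow> 'a \<Rightarrow> real) \<Rightarrow>
   real \<Rightarrow> real \<Rightarrow> real" where
  "american_put_value M r K T X t x =
     (SUP \<tau>\<in>{\<tau>. stopping_time (natural_filtration (space M) {t..T} (X t x)) \<tau> \<and>
                (\<forall>\<omega>\<in>space M. \<tau> \<omega> \<in> {t..T})}.
        prob_space.expectation M
          (\<lambda>\<omega>. exp (- r * (\<tau> \<omega> - t)) * max 0 (K - X t x (\<tau> \<omega>) \<omega>)))"

definition exercise_region :: "(real \<Rightarrow> real \<Rightarrow> real) \<Rightarrow> real \<Rightarrow> real \<Rightarrow> (real \<times> real) set" where
  "exercise_region V K T = {(t, x). t \<in> {0..<T} \<and> 0 < x \<and> V t x = K - x}"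

definition optimal_exercise_boundary ::
  "(real \<Rightarrow> real \<Rightarrow> real) \<Rightarrow> real \<Rightarrow> real \<Rightarrow> (real \<Rightarrow> real) \<Rightarrow> bool" where
  "optimal_exercise_boundary V K T b \<longleftrightarrow>
     (\<forall>t\<in>{0..<T}. 0 < b t) \<and>
     exercise_region V K T = {(t, x). t \<in> {0..<T} \<and> 0 < x \<and> x \<le> b t}"

section \<open>The volatility function\<close>

definition std_normal_cdf :: "real \<Rightarrow> real" where
  "std_normal_cdf = cdf std_normal_distribution"

definition phi_equation :: "real \<Rightarrow> real \<Rightarrow> real \<Rightarrow> real \<Rightarrow> bool" where
  "phi_equation r T t y \<longleftrightarrow> exp (y\<^sup>2 / 2) * std_normal_cdf y = exp (r * (T - t)) / 2"

definition phi :: "real \<Rightarrow> real \<Rightarrow> real \<Rightarrow> real" where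
  "phi r T t = (THE y. phi_equation r T t y)"

text \<open>The equation for \<open>phi\<close> makes sense for every real \<open>t\<close>, so at the endpoint \<open>t = 0\<close> the
  two-sided derivative below is the one-sided derivative of \<open>phi\<close> restricted to \<open>[0, T)\<close>.\<close>

definition vol :: "real \<Rightarrow> real \<Rightarrow> real \<Rightarrow> real" where
  "vol r T t = sqrt (- 2 * phi r T t * deriv (phi r T) t)"

end

theory Submission
  imports Defs
begin

text \<open>
  Write \<open>N\<close> for the normal distribution function. The total variance left at time \<open>u\<close> is
  \<open>v u = (phi u)\<^sup>2\<close>, and the equation for \<open>phi\<close> says that the discount factor \<open>exp (r (T - u))\<close>
  equals \<open>2 exp (v u / 2) N (phi u) = A (v u) 0\<close>, where \<open>A v z\<close> is the mean of
  \<open>exp \<bar>z + sqrt v * G\<bar>\<close> for a standard normal \<open>G\<close>. Measured relative to the boundary, the log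
  price \<open>Z u = ln (X u / b u)\<close> has no drift, hence is a Brownian motion with clock \<open>v t - v u\<close>, and
  the discounted payoff is a constant times \<open>max (A (v u) 0) (exp (v u / 2 + Z u))\<close> minus the
  martingale \<open>exp (v u / 2 + Z u)\<close>. The envelope of the maximum is \<open>A v 0\<close> for \<open>z \<le> 0\<close> and \<open>A v z\<close>
  for \<open>z \<ge> 0\<close>: it is a martingale on \<open>z \<ge> 0\<close>, and on \<open>z \<le> 0\<close> the supermartingale inequality reduces
  by monotonicity to \<open>z = 0\<close>, where adding the values at \<open>y\<close> and \<open>- y\<close> turns it into
  \<open>(A w 0 + A v 0) / 2 \<le> A v 0\<close> with \<open>w \<le> v\<close>. So stopping is optimal exactly for \<open>z \<le> 0\<close>.

  The law of the price is read off the equation by comparing three schemes on a fine grid: the solution, its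
  Euler sums, and the explicit exponential of the Brownian increments, the last two by a
  mean-square Gronwall argument with the price cut off at a large level.
\<close>

section \<open>Gaussian averages\<close>

text \<open>The volatility is designed backwards. Above the boundary the envelope must be a
  martingale that ends as the stock; the even terminal value \<open>exp \<bar>z\<bar>\<close> gives
  one whose value at \<open>z = 0\<close> depends on the remaining variance alone. Matching it with
  the bond is the equation for \<open>phi\<close>. Two obstacles shape the rest. A solution comes
  without moment bounds, and its stochastic integrals are mere limits in probability; tail estimates
  replace mean squares until the price is cut off. And continuity of \<open>vol\<close> is available
  only before \<open>T\<close>; so the law of the price is found on closed subintervals of
  \<open>[t, T)\<close>, the grids for stopping use points before \<open>T\<close> only, and path
  continuity covers the last cell. Conditional expectations are avoided: Markov and supermartingale
  properties are integrated over events of \<open>F s\<close>. The transition law is tested on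
  bounded functions; the envelope of the put is bounded, the martingale above the boundary is not
  and gets truncated. Stopping at the boundary is done on grids, which yields stopping times of the
  natural filtration at the cost of an overshoot.\<close>

abbreviation stdn :: "real measure" where "stdn \<equiv> std_normal_distribution"

interpretation stdn: real_distribution stdn
  by (rule real_dist_normal_dist)

text \<open>The heat semigroup with the variance as its time. Transition laws and values are
  expressed through it, because the log price relative to the boundary is a Brownian motion in that
  clock.\<close>

definition gauss :: "real \<Rightarrow> (real \<Rightarrow> real) \<Rightarrow> real \<Rightarrow> real" where
  "gauss v k z = (LINT y|stdn. k (z + sqrt v * y))"

lemma borel_measurable_gauss[measurable]:
  assumes [measurable]: "k \<in> borel_measurable borel"
  shows "gauss v k \<in> borel_measurable borel"
  unfolding gauss_def[abs_def] by measurable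

lemma gauss_bound:
  assumes [measurable]: "k \<in> borel_measurable borel" and k: "\<And>z. \<bar>k z\<bar> \<le> C"
  shows "\<bar>gauss v k z\<bar> \<le> C"
proof -
  have "0 \<le> C" using k[of 0] by (rule order_trans[OF abs_ge_zero])
  have "\<bar>gauss v k z\<bar> \<le> (LINT y|stdn. \<bar>k (z + sqrt v * y)\<bar>)"
    unfolding gauss_def by (rule integral_abs_bound)
  also have "\<dots> \<le> (LINT y|stdn. C)"
    using k \<open>0 \<le> C\<close> by (intro integral_mono stdn.integrable_const_bound[of _ C]) auto
  finally show ?thesis by (simp add: stdn.prob_space[simplified])
qed

lemma stdn_scaled:
  assumes "0 < v"
  shows "distr stdn borel (\<lambda>y. sqrt v * y) = density lborel (normal_density 0 (sqrt v))"
proof -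
  have "distributed stdn lborel (\<lambda>y. y) std_normal_density"
    by (auto simp: distributed_def distr_id2)
  then have "distributed stdn lborel (\<lambda>y. sqrt v * y) (normal_density 0 (sqrt v))"
    using assms by (subst stdn.normal_standard_normal_convert) auto
  then show ?thesis
    by (auto simp: distributed_def cong: distr_cong)
qed

text \<open>Variances add up under convolution. A zero variance is allowed, since grid points may
  coincide; the law is then a point mass without density and is treated apart from the density
  computation.\<close>

lemma stdn_scaled_convolution:
  assumes "0 \<le> v" "0 \<le> w"
  shows "distr stdn borel (\<lambda>y. sqrt v * y) \<star> distr stdn borel (\<lambda>y. sqrt w * y)
    = distr stdn borel (\<lambda>y. sqrt (v + w) * y)"
proof -
  have z: "distr stdn borel (\<lambda>y. 0 * y) \<star> distr stdn borel f = distr stdn borel f"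
    if [measurable]: "f \<in> borel_measurable borel" for f :: "real \<Rightarrow> real"
  proof -
    interpret a: prob_space "distr stdn borel f" by (rule stdn.prob_space_distr) simp
    interpret b: prob_space "distr stdn borel (\<lambda>y::real. 0 * y)" by (rule stdn.prob_space_distr) simp
    show ?thesis
    proof (rule measure_eqI)
      fix A :: "real set" assume "A \<in> sets (distr stdn borel (\<lambda>y. 0 * y) \<star> distr stdn borel f)"
      then have [measurable]: "A \<in> sets borel" by simp
      have "emeasure (distr stdn borel (\<lambda>y::real. 0 * y) \<star> distr stdn borel f) A
          = (\<integral>\<^sup>+x. \<integral>\<^sup>+y. indicator A (x + y) \<partial>distr stdn borel f \<partial>distr stdn borel (\<lambda>y::real. 0 * y))"
        by (subst nn_integral_convolution[symmetric])
          (auto intro: a.finite_measure_axioms b.finite_measure_axioms)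
      also have "\<dots> = (\<integral>\<^sup>+x. emeasure (distr stdn borel f) A \<partial>stdn)"
        by (subst nn_integral_distr[of _ _ borel]) auto
      also have "\<dots> = emeasure (distr stdn borel f) A"
        by (simp add: stdn.emeasure_space_1[simplified])
      finally show "emeasure (distr stdn borel (\<lambda>y::real. 0 * y) \<star> distr stdn borel f) A
        = emeasure (distr stdn borel f) A" .
    qed simp
  qed
  show ?thesis
  proof (cases "v = 0 \<or> w = 0")
    case True
    interpret a: prob_space "distr stdn borel (\<lambda>y. sqrt v * y)" by (rule stdn.prob_space_distr) simp
    interpret b: prob_space "distr stdn borel (\<lambda>y. sqrt w * y)" by (rule stdn.prob_space_distr) simp
    have [simp]: "(*) (0::real) = (\<lambda>_. 0)" by auto
    show ?thesis using True z[of "\<lambda>y. sqrt w * y"] z[of "\<lambda>y. sqrt v * y"]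
        convolution_commutative[OF a.finite_measure_axioms b.finite_measure_axioms] by auto
  next
    case False
    then have vw: "0 < v" "0 < w" "0 < v + w" using assms by auto
    interpret a: prob_space "density lborel (normal_density 0 (sqrt v))"
      by (rule prob_space_normal_density) (use vw in auto)
    interpret b: prob_space "density lborel (normal_density 0 (sqrt w))"
      by (rule prob_space_normal_density) (use vw in auto)
    have "density lborel (normal_density 0 (sqrt v)) \<star> density lborel (normal_density 0 (sqrt w))
       = density lborel (\<lambda>x. \<integral>\<^sup>+y. ennreal (normal_density 0 (sqrt v) (x - y)) * ennreal (normal_density 0 (sqrt w) y) \<partial>lborel)"
      by (rule convolution_density) (auto simp: a.finite_measure_axioms b.finite_measure_axioms)
    also have "\<dots> = density lborel (normal_density 0 (sqrt ((sqrt v)\<^sup>2 + (sqrt w)\<^sup>2)))"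
      using vw by (subst conv_normal_density_zero_mean[symmetric]) (auto simp: ennreal_mult)
    finally show ?thesis using vw by (simp add: stdn_scaled)
  qed
qed

text \<open>Fubini on the product of the two scaled laws. Integrability for the total variance
  transfers to the product through the convolution, so unbounded \<open>k\<close> such as
  \<open>exp \<bar>y\<bar>\<close> are covered.\<close>

lemma gauss_semigroup:
  assumes "0 \<le> v" "0 \<le> w" and [measurable]: "k \<in> borel_measurable borel"
    and int: "integrable stdn (\<lambda>y. k (z + sqrt (v + w) * y))"
  shows "gauss v (gauss w k) z = gauss (v + w) k z"
    and "integrable stdn (\<lambda>y. gauss w k (z + sqrt v * y))"
proof -
  let ?a = "distr stdn borel (\<lambda>y. sqrt v * y)" and ?b = "distr stdn borel (\<lambda>y. sqrt w * y)"
  interpret a: prob_space ?a by (rule stdn.prob_space_distr) simp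
  interpret b: prob_space ?b by (rule stdn.prob_space_distr) simp
  interpret pair_prob_space ?a ?b ..
  have "integrable (?a \<star> ?b) (\<lambda>y. k (z + y))"
    using int by (simp add: stdn_scaled_convolution assms integrable_distr_eq)
  then have 1: "integrable (?a \<Otimes>\<^sub>M ?b) (\<lambda>(x, y). k (z + (x + y)))"
    by (simp add: convolution_def integrable_distr_eq split_beta')
  have "gauss (v + w) k z = (LINT y|(?a \<star> ?b). k (z + y))"
    by (simp add: stdn_scaled_convolution assms integral_distr gauss_def)
  also have "\<dots> = (LINT p|(?a \<Otimes>\<^sub>M ?b). (\<lambda>(x, y). k (z + (x + y))) p)"
    by (simp add: convolution_def integral_distr split_beta')
  also have "\<dots> = (LINT x|?a. LINT y|?b. k (z + (x + y)))"
    using integral_fst'[OF 1] by simp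
  also have "\<dots> = gauss v (gauss w k) z"
    by (simp add: integral_distr gauss_def add.assoc)
  finally show "gauss v (gauss w k) z = gauss (v + w) k z" ..
  show "integrable stdn (\<lambda>y. gauss w k (z + sqrt v * y))"
    using integrable_fst'[OF 1] by (simp add: integral_distr integrable_distr_eq gauss_def add.assoc)
qed

section \<open>Exponential moments of the normal law\<close>

text \<open>Completing the square: an exponential weight shifts the mean of the normal law. The
  exponential moments below thereby reduce to the total mass and the mean of a shifted normal
  density.\<close>

lemma normal_density_exp_tilt:
  "std_normal_density x * exp (c * x) = exp (c\<^sup>2 / 2) * normal_density c 1 x"
proof -
  have "- x\<^sup>2 / 2 + c * x = c\<^sup>2 / 2 + - (x - c)\<^sup>2 / 2" by (simp add: power2_eq_square field_simps)
  then show ?thesis by (simp add: normal_density_def exp_add[symmetric] field_simps)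
qed

lemma stdn_exp:
  "integrable stdn (\<lambda>x. exp (c * x))" "(LINT x|stdn. exp (c * x)) = exp (c\<^sup>2 / 2)"
  by (simp_all add: integrable_density integral_density normal_density_exp_tilt)

lemma stdn_exp_id:
  "integrable stdn (\<lambda>x. exp (c * x) * x)" "(LINT x|stdn. exp (c * x) * x) = exp (c\<^sup>2 / 2) * c"
  by (simp_all add: integrable_density integral_density normal_density_exp_tilt mult.assoc[symmetric]
      integrable_normal_moment_nz_1)
    (simp_all add: mult.assoc integral_normal_moment_nz_1 integrable_normal_moment_nz_1)

lemma stdn_moments:
  "integrable stdn (\<lambda>x. x)" "(LINT x|stdn. x) = 0"
  "integrable stdn (\<lambda>x. x\<^sup>2)" "(LINT x|stdn. x\<^sup>2) = 1"
  using integrable_std_normal_distribution_moment[of 1] integrable_std_normal_distribution_moment[of 2]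
    std_normal_distribution_even_moments[of 1]
    stdn_exp_id[of 0]
  by (auto simp: fact_2)

lemma stdn_exp_abs: "integrable stdn (\<lambda>x. exp \<bar>z + c * x\<bar>)"
proof (rule Bochner_Integration.integrable_bound)
  show "integrable stdn (\<lambda>x. exp z * exp (c * x) + exp (- z) * exp ((- c) * x))"
    by (intro Bochner_Integration.integrable_add integrable_mult_right stdn_exp)
  show "AE x in stdn. norm (exp \<bar>z + c * x\<bar>) \<le> norm (exp z * exp (c * x) + exp (- z) * exp ((- c) * x))"
  proof (intro AE_I2)
    fix x
    show "norm (exp \<bar>z + c * x\<bar>) \<le> norm (exp z * exp (c * x) + exp (- z) * exp ((- c) * x))"
      using exp_gt_zero[of "z + c * x"] exp_gt_zero[of "- z - c * x"]
      by (cases "0 \<le> z + c * x") (simp_all add: exp_add[symmetric])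
  qed
qed simp

lemma stdn_exp_abs_diff: "integrable stdn (\<lambda>x. exp \<bar>c * x - z\<bar>)"
  using stdn_exp_abs[of "- z" c] by simp

lemma stdn_uminus: "(LINT x|stdn. f (- x)) = (LINT x|stdn. f x :: real)"
  if [measurable]: "f \<in> borel_measurable borel"
proof -
  have "(LINT x|stdn. f (- x)) = (LINT x|lborel. std_normal_density x * f (- x))"
    by (simp add: integral_density)
  also have "\<dots> = (LINT x|lborel. std_normal_density x * f x)"
    by (subst lborel_integral_real_affine[where c="-1" and t=0])
      (auto simp: normal_density_def)
  finally show ?thesis by (simp add: integral_density)
qed

section \<open>Evenness, monotonicity and continuity of the function \<open>A\<close>\<close>

text \<open>This is \<open>A\<close> of the overview: the value, with variance \<open>v\<close> to
  go, of a claim to \<open>exp \<bar>z\<bar>\<close> on the driftless log price.\<close>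

definition expabs :: "real \<Rightarrow> real \<Rightarrow> real" where
  "expabs v = gauss v (\<lambda>y. exp \<bar>y\<bar>)"

lemma expabs_uminus: "expabs v (- z) = expabs v z"
  unfolding expabs_def gauss_def
  by (subst stdn_uminus[symmetric]) (auto intro!: Bochner_Integration.integral_cong)

lemma exp_abs_convex:
  fixes p q :: real
  assumes "0 \<le> l" "l \<le> 1"
  shows "exp \<bar>l * p + (1 - l) * q\<bar> \<le> l * exp \<bar>p\<bar> + (1 - l) * exp \<bar>q\<bar>"
proof -
  have "\<bar>l * p + (1 - l) * q\<bar> \<le> l * \<bar>p\<bar> + (1 - l) * \<bar>q\<bar>"
    using assms abs_triangle_ineq[of "l * p" "(1 - l) * q"] by (simp add: abs_mult)
  moreover have "exp (l * \<bar>p\<bar> + (1 - l) * \<bar>q\<bar>) \<le> l * exp \<bar>p\<bar> + (1 - l) * exp \<bar>q\<bar>"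
    using convex_onD[OF exp_convex, of "1 - l" "\<bar>p\<bar>" "\<bar>q\<bar>"] assms by simp
  ultimately show ?thesis
    by (meson exp_le_cancel_iff order_trans)
qed

text \<open>An even convex function grows with the distance from 0, and averaging over symmetric
  noise preserves evenness and convexity.\<close>

lemma expabs_mono:
  assumes "\<bar>z\<bar> \<le> \<bar>z'\<bar>"
  shows "expabs v z \<le> expabs v z'"
proof (cases "z' = 0")
  case False
  \<comment> \<open>\<open>l\<close> is the weight that writes \<open>z\<close> as a convex
    combination of \<open>z'\<close> and \<open>- z'\<close>.\<close>
  define l where "l = (z / z' + 1) / 2"
  have "\<bar>z / z'\<bar> \<le> 1" using assms False by (simp add: field_simps)
  then have "- 1 \<le> z / z'" "z / z' \<le> 1" by (simp_all only: abs_le_iff) auto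
  then have l: "0 \<le> l" "l \<le> 1" by (auto simp: l_def)
  have "z + s = l * (z' + s) + (1 - l) * (- z' + s)" for s using False by (simp add: l_def field_simps)
  then have "exp \<bar>z + s\<bar> \<le> l * exp \<bar>z' + s\<bar> + (1 - l) * exp \<bar>- z' + s\<bar>" for s
    using exp_abs_convex[OF l, of "z' + s" "- z' + s"] by simp
  then have "expabs v z \<le> (LINT x|stdn. l * exp \<bar>z' + sqrt v * x\<bar> + (1 - l) * exp \<bar>- z' + sqrt v * x\<bar>)"
    unfolding expabs_def gauss_def
    by (intro integral_mono stdn_exp_abs Bochner_Integration.integrable_add integrable_mult_right)
  also have "\<dots> = l * expabs v z' + (1 - l) * expabs v (- z')"
    unfolding expabs_def gauss_def
    by (subst Bochner_Integration.integral_add) (auto intro!: stdn_exp_abs stdn_exp_abs_diff)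
  finally show ?thesis by (simp add: expabs_uminus algebra_simps)
qed (use assms in simp)

text \<open>Strictness is what makes continuation strictly better above the boundary. It comes from
  pairing the shifts \<open>z\<close> and \<open>- z\<close> and from
  \<open>2 < exp \<bar>z\<bar> + exp (- \<bar>z\<bar>)\<close>.\<close>

lemma expabs_gt_0:
  assumes "z \<noteq> 0"
  shows "expabs v 0 < expabs v z"
proof -
  have pos: "exp \<bar>s\<bar> < (exp \<bar>z + s\<bar> + exp \<bar>- z + s\<bar>) / 2" for s
  proof -
    have "0 < (exp (\<bar>z\<bar> / 2) - exp (- \<bar>z\<bar> / 2))\<^sup>2" using assms by simp
    also have "\<dots> = exp \<bar>z\<bar> + exp (- \<bar>z\<bar>) - 2"
      by (simp add: power2_diff exp_double[symmetric] mult.assoc exp_add[symmetric])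
    finally have c: "2 < exp \<bar>z\<bar> + exp (- \<bar>z\<bar>)" by simp
    have "2 * exp \<bar>s\<bar> < (exp \<bar>z\<bar> + exp (- \<bar>z\<bar>)) * exp \<bar>s\<bar>"
      using c by (intro mult_strict_right_mono) auto
    also have "\<dots> = exp (\<bar>z\<bar> + \<bar>s\<bar>) + exp (- \<bar>z\<bar> + \<bar>s\<bar>)" by (simp only: exp_add distrib_right)
    \<comment> \<open>One of the two absolute values equals
      \<open>\<bar>z\<bar> + \<bar>s\<bar>\<close>, the other is at least
      \<open>\<bar>s\<bar> - \<bar>z\<bar>\<close>.\<close>
    also have "\<dots> \<le> exp \<bar>z + s\<bar> + exp \<bar>- z + s\<bar>"
      by (cases "0 \<le> s"; cases "0 \<le> z") (auto simp: abs_if algebra_simps)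
    finally show ?thesis by simp
  qed
  have "expabs v 0 < (LINT x|stdn. (exp \<bar>z + sqrt v * x\<bar> + exp \<bar>- z + sqrt v * x\<bar>) / 2)"
    unfolding expabs_def gauss_def
    using pos stdn_exp_abs[of 0]
    by (intro stdn.integral_less_AE_space)
      (auto intro!: stdn_exp_abs stdn_exp_abs_diff simp: stdn.emeasure_space_1[simplified])
  also have "\<dots> = (expabs v z + expabs v (- z)) / 2"
    unfolding expabs_def gauss_def
    by (simp, subst Bochner_Integration.integral_add) (auto intro!: stdn_exp_abs stdn_exp_abs_diff)
  finally show ?thesis by (simp add: expabs_uminus)
qed

text \<open>The logarithm of \<open>expabs v\<close> is Lipschitz with constant 1. This yields
  continuity, and later it bounds the loss caused by overshooting the boundary.\<close>

lemma expabs_le_exp_mult: "expabs v z' \<le> exp \<bar>z' - z\<bar> * expabs v z"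
proof -
  have "exp \<bar>z' + s\<bar> \<le> exp \<bar>z' - z\<bar> * exp \<bar>z + s\<bar>" for s
    by (simp add: exp_add[symmetric])
  then have "expabs v z' \<le> (LINT x|stdn. exp \<bar>z' - z\<bar> * exp \<bar>z + sqrt v * x\<bar>)"
    unfolding expabs_def gauss_def
    by (intro integral_mono stdn_exp_abs integrable_mult_right)
  then show ?thesis by (simp add: expabs_def gauss_def)
qed

lemma expabs_pos: "0 < expabs v z"
proof -
  have "expabs v z \<ge> (LINT x|stdn. 1)"
    unfolding expabs_def gauss_def by (intro integral_mono stdn_exp_abs) auto
  then show ?thesis by (simp add: stdn.prob_space[simplified])
qed

lemma isCont_expabs: "isCont (expabs v) z"
  unfolding isCont_def
proof (rule tendsto_sandwich)
  show "\<forall>\<^sub>F y in at z. exp (- \<bar>z - y\<bar>) * expabs v z \<le> expabs v y"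
  proof (rule always_eventually, rule allI)
    fix y
    have "exp (- \<bar>z - y\<bar>) * expabs v z \<le> exp (- \<bar>z - y\<bar>) * (exp \<bar>z - y\<bar> * expabs v y)"
      by (intro mult_left_mono expabs_le_exp_mult) auto
    then show "exp (- \<bar>z - y\<bar>) * expabs v z \<le> expabs v y"
      by (simp only: mult.assoc[symmetric] exp_add[symmetric]) simp
  qed
  show "\<forall>\<^sub>F y in at z. expabs v y \<le> exp \<bar>y - z\<bar> * expabs v z"
    by (intro always_eventually allI expabs_le_exp_mult)
  have "((\<lambda>y. exp (- \<bar>z - y\<bar>) * expabs v z) \<longlongrightarrow> exp (- \<bar>z - z\<bar>) * expabs v z) (at z)"
    by (intro tendsto_intros)
  then show "((\<lambda>y. exp (- \<bar>z - y\<bar>) * expabs v z) \<longlongrightarrow> expabs v z) (at z)" by simp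
  have "((\<lambda>y. exp \<bar>y - z\<bar> * expabs v z) \<longlongrightarrow> exp \<bar>z - z\<bar> * expabs v z) (at z)"
    by (intro tendsto_intros)
  then show "((\<lambda>y. exp \<bar>y - z\<bar> * expabs v z) \<longlongrightarrow> expabs v z) (at z)" by simp
qed

lemma borel_measurable_expabs[measurable]: "expabs v \<in> borel_measurable borel"
  by (intro borel_measurable_continuous_onI continuous_at_imp_continuous_on ballI isCont_expabs)

lemma gauss_expabs:
  assumes "0 \<le> v" "0 \<le> w"
  shows "gauss v (expabs w) z = expabs (v + w) z"
    "integrable stdn (\<lambda>y. expabs w (z + sqrt v * y))"
  unfolding expabs_def using assms by (auto intro!: gauss_semigroup stdn_exp_abs)

lemma gauss_exp: "0 \<le> v \<Longrightarrow> gauss v exp z = exp (v / 2 + z)"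
  by (simp add: gauss_def exp_add stdn_exp)

text \<open>The pointwise bound \<open>exp y \<le> exp \<bar>y\<bar>\<close> under the mean. At
  \<open>z = 0\<close> it later says that the boundary stays below the strike.\<close>

lemma expabs_ge_exp: "0 \<le> v \<Longrightarrow> exp (v / 2 + z) \<le> expabs v z"
  unfolding expabs_def gauss_exp[symmetric] unfolding gauss_def
  by (intro integral_mono stdn_exp_abs) (simp add: exp_add stdn_exp, simp)

text \<open>The envelope of the maximum of bond and stock, normalised by \<open>kap\<close> below.\<close>

definition snell_max :: "real \<Rightarrow> real \<Rightarrow> real" where
  "snell_max v z = (if z \<le> 0 then expabs v 0 else expabs v z)"

lemma snell_max_mono: "z \<le> z' \<Longrightarrow> snell_max v z \<le> snell_max v z'"
  by (auto simp: snell_max_def intro!: expabs_mono)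

lemma borel_measurable_snell_max[measurable]: "snell_max v \<in> borel_measurable borel"
  unfolding snell_max_def by measurable

lemma snell_max_le: "snell_max v z \<le> expabs v z"
  by (auto simp: snell_max_def intro!: expabs_mono)

lemma snell_max_pos: "0 < snell_max v z"
  by (simp add: snell_max_def expabs_pos)

lemma integrable_snell_max:
  assumes "0 \<le> v" "0 \<le> w"
  shows "integrable stdn (\<lambda>y. snell_max w (z + sqrt v * y))"
proof (rule Bochner_Integration.integrable_bound)
  show "integrable stdn (\<lambda>y. expabs w (z + sqrt v * y))" by (rule gauss_expabs[OF assms])
  show "AE x in stdn. norm (snell_max w (z + sqrt v * x)) \<le> norm (expabs w (z + sqrt v * x))"
    using snell_max_le snell_max_pos expabs_pos by (auto simp: abs_of_pos)
qed simp

lemma gauss_snell_max_le: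
  assumes "0 \<le> v" "0 \<le> w"
  shows "gauss v (snell_max w) z \<le> snell_max (v + w) z"
proof (cases "z \<le> 0")
  case False
  have "gauss v (snell_max w) z \<le> gauss v (expabs w) z"
    unfolding gauss_def by (intro integral_mono integrable_snell_max gauss_expabs assms snell_max_le)
  then show ?thesis using False by (simp add: gauss_expabs assms snell_max_def)
next
  case True
  let ?f = "\<lambda>y. snell_max w (sqrt v * y)"
  have int: "integrable stdn ?f"
    using integrable_snell_max[OF assms, of 0] by simp
  have int': "integrable stdn (\<lambda>y. snell_max w (- (sqrt v * y)))"
  proof (rule Bochner_Integration.integrable_bound)
    show "integrable stdn (\<lambda>y. expabs w (0 + sqrt v * y))" by (rule gauss_expabs[OF assms])
    show "AE x in stdn. norm (snell_max w (- (sqrt v * x))) \<le> norm (expabs w (0 + sqrt v * x))"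
      using snell_max_le[of w "- (sqrt v * x)" for x] snell_max_pos expabs_pos
      by (auto simp: abs_of_pos expabs_uminus)
  qed simp
  have "gauss v (snell_max w) z \<le> gauss v (snell_max w) 0"
    unfolding gauss_def using True
    by (intro integral_mono integrable_snell_max assms snell_max_mono) auto
  also have "\<dots> = (LINT y|stdn. ?f y)" by (simp add: gauss_def)
  also have "\<dots> = ((LINT y|stdn. ?f y) + (LINT y|stdn. ?f (- y))) / 2"
    by (subst stdn_uminus[where f = ?f]) auto
  also have "\<dots> = (LINT y|stdn. ?f y + ?f (- y)) / 2"
    using int int' by (subst Bochner_Integration.integral_add) auto
  \<comment> \<open>Of \<open>sqrt v * y\<close> and its negative, one lies on the flat side of
    \<open>snell_max\<close>; evenness of \<open>expabs\<close> brings the other one to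
    \<open>sqrt v * y\<close>.\<close>
  also have "\<dots> = (LINT y|stdn. expabs w 0 + expabs w (0 + sqrt v * y)) / 2"
    by (auto intro!: Bochner_Integration.integral_cong simp: snell_max_def expabs_uminus)
  also have "\<dots> = (expabs w 0 + expabs (v + w) 0) / 2"
    using gauss_expabs[OF assms, of 0]
    by (subst Bochner_Integration.integral_add) (auto simp: gauss_def stdn.prob_space[simplified])
  \<comment> \<open>\<open>expabs w\<close> is smallest at 0, so spreading its argument raises it:
    at 0, \<open>expabs\<close> grows with the variance.\<close>
  also have "expabs w 0 \<le> (LINT y|stdn. expabs w (0 + sqrt v * y))"
  proof -
    have "(LINT y|stdn. expabs w 0) \<le> (LINT y|stdn. expabs w (0 + sqrt v * y))"
      by (intro integral_mono gauss_expabs assms) (auto intro: expabs_mono)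
    then show ?thesis by (simp add: stdn.prob_space[simplified])
  qed
  also have "\<dots> = expabs (v + w) 0"
    using gauss_expabs[OF assms, of 0] by (simp add: gauss_def)
  finally have "gauss v (snell_max w) z \<le> expabs (v + w) 0" by simp
  then show ?thesis using True by (simp add: snell_max_def[of "v + w"])
qed

section \<open>The volatility\<close>

text \<open>Up to the factor \<open>sqrt (2 * pi)\<close>, this is the Mills ratio of the normal law
  at \<open>- y\<close>. It is the left side of \<open>phi_equation\<close> as a function of the
  unknown.\<close>

definition mills :: "real \<Rightarrow> real" where
  "mills y = exp (y\<^sup>2 / 2) * std_normal_cdf y"

lemma AE_stdn_neq: "AE x in stdn. x \<noteq> c"
  by (subst AE_density) (auto intro: AE_mp[OF AE_lborel_singleton])

lemma integrable_stdn_half_exp: "integrable stdn (\<lambda>s. indicator {0..} s * exp (y * s))"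
  by (rule Bochner_Integration.integrable_bound[OF stdn_exp(1)[of y]]) (auto split: split_indicator)

text \<open>Tilting turns the one-sided exponential moment into a normal probability. In this form
  monotonicity in \<open>y\<close> can be read off, and two copies of it make up
  \<open>expabs v 0\<close>.\<close>

lemma mills_eq: "mills y = (LINT s|stdn. indicator {0..} s * exp (y * s))"
proof -
  have "(LINT s|stdn. indicator {0..} s * exp (y * s))
      = (LINT s|lborel. exp (y\<^sup>2 / 2) * (normal_density y 1 s * indicator {0..} s))"
    by (auto simp: integral_density mult.assoc[symmetric] normal_density_exp_tilt[symmetric]
        intro!: Bochner_Integration.integral_cong)
  \<comment> \<open>Reflecting \<open>s\<close> to \<open>y - s\<close> maps the half line onto
    \<open>{..y}\<close> and the density with mean \<open>y\<close> onto the standard one.\<close>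
  also have "\<dots> = exp (y\<^sup>2 / 2) * (LINT s|lborel. normal_density y 1 (y + - 1 * s) * indicator {0..} (y + - 1 * s))"
    by (subst lborel_integral_real_affine[where c="-1" and t=y]) auto
  also have "(LINT s|lborel. normal_density y 1 (y + - 1 * s) * indicator {0..} (y + - 1 * s))
      = (LINT s|stdn. indicator {..y} s)"
    by (subst integral_density)
      (auto simp: normal_density_def intro!: Bochner_Integration.integral_cong split: split_indicator)
  also have "\<dots> = std_normal_cdf y"
    by (simp add: std_normal_cdf_def cdf_def)
  finally show ?thesis by (simp add: mills_def)
qed

text \<open>The bridge between the algebraic equation and the stopping problem: splitting
  \<open>exp \<bar>sqrt v * s\<bar>\<close> at \<open>s = 0\<close> gives two equal halves.\<close>

lemma expabs_0_eq_mills: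
  assumes "0 \<le> v"
  shows "expabs v 0 = 2 * mills (sqrt v)"
proof -
  let ?g = "\<lambda>s. indicator {0..} s * exp (sqrt v * s) :: real"
  have i: "integrable stdn (\<lambda>s. ?g (- s))"
    by (rule Bochner_Integration.integrable_bound[OF stdn_exp(1)[of "- sqrt v"]])
      (auto split: split_indicator)
  \<comment> \<open>At \<open>s = 0\<close> both half lines count, so the splitting is an identity
    almost everywhere only.\<close>
  have e: "exp \<bar>sqrt v * s\<bar> = ?g s + ?g (- s)" if "s \<noteq> 0" for s
    using that assms by (auto split: split_indicator simp: abs_mult)
  have "expabs v 0 = (LINT s|stdn. ?g s + ?g (- s))"
    unfolding expabs_def gauss_def using AE_stdn_neq[of 0]
    by (intro integral_cong_AE) (auto simp: e simp del: mult_minus_right)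
  also have "\<dots> = (LINT s|stdn. ?g s) + (LINT s|stdn. ?g (- s))"
    by (rule Bochner_Integration.integral_add[OF integrable_stdn_half_exp i])
  also have "(LINT s|stdn. ?g (- s)) = (LINT s|stdn. ?g s)"
    by (rule stdn_uminus) simp
  finally show ?thesis by (simp add: mills_eq)
qed

lemma mills_0: "mills 0 = 1 / 2"
  using expabs_0_eq_mills[of 0] by (simp add: expabs_def gauss_def stdn.prob_space[simplified])

text \<open>The integrand in \<open>mills_eq\<close> increases strictly with \<open>y\<close> at
  every \<open>s > 0\<close>, and the half line has mass 1 / 2.\<close>

lemma mills_strict_mono:
  assumes "y < y'"
  shows "mills y < mills y'"
proof -
  have "measure stdn {0..} = 1 / 2"
    using mills_0 mills_eq[of 0] by simp
  then have "emeasure stdn {0..} \<noteq> 0"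
    by (simp add: stdn.emeasure_eq_measure[simplified])
  moreover have "AE s in stdn. s \<in> {0..} \<longrightarrow>
      indicator {0..} s * exp (y * s) \<noteq> (indicator {0..} s * exp (y' * s) :: real)"
    using AE_stdn_neq[of 0] by eventually_elim (use assms in auto)
  ultimately show ?thesis
    unfolding mills_eq using assms
    by (intro stdn.integral_less_AE[where A="{0..}"] integrable_stdn_half_exp)
      (auto intro!: AE_I2 mult_right_mono split: split_indicator)
qed

lemma mills_inj: "mills y = mills y' \<longleftrightarrow> y = y'"
  using mills_strict_mono[of y y'] mills_strict_mono[of y' y] by (cases y y' rule: linorder_cases) auto

lemma DERIV_std_normal_cdf: "DERIV std_normal_cdf y :> std_normal_density y"
proof -
  \<comment> \<open>A base point below \<open>y\<close>: from it the distribution function is an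
    integral with variable upper end, on an interval with \<open>y\<close> in its interior.\<close>
  define a where "a = y - 1"
  have ay: "a \<le> y" by (simp add: a_def)
  have *: "std_normal_cdf z = std_normal_cdf a + integral {a..z} std_normal_density" if "a \<le> z" for z
  proof (cases "a = z")
    case False
    have "std_normal_cdf z - std_normal_cdf a = measure stdn {a<..z}"
      unfolding std_normal_cdf_def using that False stdn.cdf_diff_eq[of a z] by simp
    also have "\<dots> = (LINT x|stdn. indicator {a<..z} x)" by simp
    also have "\<dots> = (LINT x|stdn. indicator {a..z} x)"
      using AE_stdn_neq[of a] by (intro integral_cong_AE) (auto split: split_indicator)
    also have "\<dots> = (LINT x:{a..z}|lborel. std_normal_density x)"
      by (subst integral_density) (auto simp: set_lebesgue_integral_def mult.commute)
    also have "\<dots> = integral {a..z} std_normal_density"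
      using integrable_mult_indicator[of "{a..z}" lborel std_normal_density]
      by (intro set_borel_integral_eq_integral) (auto simp: set_integrable_def)
    finally show ?thesis by simp
  qed simp
  have "((\<lambda>z. std_normal_cdf a + integral {a..z} std_normal_density) has_real_derivative std_normal_density y)
     (at y within {a..y + 1})"
  proof -
    have "((\<lambda>z. integral {a..z} std_normal_density) has_real_derivative std_normal_density y) (at y within {a..y + 1})"
      by (rule integral_has_real_derivative)
        (auto intro!: continuous_intros simp: normal_density_def a_def)
    from DERIV_add[OF DERIV_const this] show ?thesis by simp
  qed
  then have "(std_normal_cdf has_real_derivative std_normal_density y) (at y within {a..y + 1})"
    by (rule has_field_derivative_transform_within[OF _ zero_less_one]) (use ay in \<open>auto intro!: *[symmetric]\<close>)
  moreover have "at y within {a..y + 1} = at y"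
    by (rule at_within_Icc_at) (auto simp: a_def)
  ultimately show ?thesis by simp
qed

definition mills' :: "real \<Rightarrow> real" where
  "mills' y = y * mills y + exp (y\<^sup>2 / 2) * std_normal_density y"

lemma DERIV_mills: "DERIV mills y :> mills' y"
  unfolding mills_def[abs_def] mills'_def
  by (auto intro!: derivative_eq_intros DERIV_std_normal_cdf simp: mills_def)

lemma mills_pos: "0 < mills y"
proof -
  have "0 \<le> mills (y - 1)"
    unfolding mills_eq by (intro Bochner_Integration.integral_nonneg) auto
  then show ?thesis using mills_strict_mono[of "y - 1" y] by simp
qed

lemma mills'_pos: "0 \<le> y \<Longrightarrow> 0 < mills' y"
  unfolding mills'_def using mills_pos[of y]
  by (intro add_nonneg_pos mult_nonneg_nonneg mult_pos_pos) (auto simp: normal_density_pos)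

lemma isCont_mills: "isCont mills y"
  using DERIV_mills by (rule DERIV_isCont)

lemma mills_ge: "0 \<le> y \<Longrightarrow> exp (y\<^sup>2 / 2) / 2 \<le> mills y"
proof -
  assume y: "0 \<le> y"
  have "std_normal_cdf 0 \<le> std_normal_cdf y"
    unfolding std_normal_cdf_def by (rule stdn.cdf_nondecreasing[OF y])
  moreover have "std_normal_cdf 0 = 1 / 2" using mills_0 by (simp add: mills_def)
  ultimately show ?thesis by (simp add: mills_def)
qed

lemma mills_surj:
  assumes "1 / 2 \<le> c"
  shows "\<exists>y\<ge>0. mills y = c"
proof -
  \<comment> \<open>\<open>M\<close> solves \<open>exp (M\<^sup>2 / 2) / 2 = c\<close>, so
    \<open>mills_ge\<close> makes it an upper end for the intermediate value theorem.\<close>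
  define M where "M = sqrt (2 * ln (2 * c))"
  have "0 \<le> ln (2 * c)" using assms by simp
  then have M: "0 \<le> M" "M\<^sup>2 / 2 = ln (2 * c)" by (simp_all add: M_def)
  then have "c \<le> mills M" using mills_ge[of M] assms by simp
  then show ?thesis
    using IVT[of mills 0 c M] mills_0 assms M(1) isCont_mills by auto
qed

section \<open>The solution of the equation and its total variance\<close>

context
  fixes r T :: real
  assumes r: "0 < r"
begin

lemma phi_equation_iff: "phi_equation r T t y \<longleftrightarrow> mills y = exp (r * (T - t)) / 2"
  by (simp add: phi_equation_def mills_def)

lemma phi_equation_ex1:
  assumes "t \<le> T"
  shows "\<exists>!y. phi_equation r T t y"
proof -
  have "0 \<le> r * (T - t)" using assms r by simp
  then obtain y where "mills y = exp (r * (T - t)) / 2"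
    using mills_surj[of "exp (r * (T - t)) / 2"] by auto
  then show ?thesis unfolding phi_equation_iff by (metis mills_inj)
qed

lemma mills_phi: "t \<le> T \<Longrightarrow> mills (phi r T t) = exp (r * (T - t)) / 2"
  using theI'[OF phi_equation_ex1] unfolding phi_def phi_equation_iff by blast

lemma phi_unique: "mills y = exp (r * (T - t)) / 2 \<Longrightarrow> phi r T t = y"
  unfolding phi_def phi_equation_iff by (metis (mono_tags, lifting) mills_inj the_equality)

lemma phi_nonneg:
  assumes "t \<le> T"
  shows "0 \<le> phi r T t"
proof (rule ccontr)
  assume "\<not> 0 \<le> phi r T t"
  then have "mills (phi r T t) < 1 / 2" using mills_strict_mono[of "phi r T t" 0] mills_0 by simp
  moreover have "0 \<le> r * (T - t)" using assms r by simp
  ultimately show False using mills_phi[OF assms] by simp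
qed

lemma phi_T: "phi r T T = 0"
  by (rule phi_unique) (simp add: mills_0)

lemma phi_antimono:
  assumes "s \<le> t" "t \<le> T"
  shows "phi r T t \<le> phi r T s"
proof (rule ccontr)
  assume "\<not> phi r T t \<le> phi r T s"
  then have "mills (phi r T s) < mills (phi r T t)" by (intro mills_strict_mono) simp
  then show False using assms r by (simp add: mills_phi)
qed

text \<open>The equation can be solved for the time. Thus \<open>phi\<close> is the inverse of an
  explicit smooth function and inherits its regularity.\<close>

private definition phi_inv :: "real \<Rightarrow> real" where
  "phi_inv y = T - ln (2 * mills y) / r"

private lemma phi_inv: "phi r T (phi_inv y) = y"
  using r mills_pos[of y] by (intro phi_unique) (simp add: phi_inv_def)

private lemma phi_inv_phi: "t \<le> T \<Longrightarrow> phi_inv (phi r T t) = t"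
  using r by (simp add: phi_inv_def mills_phi)

private lemma DERIV_phi_inv: "DERIV phi_inv y :> - mills' y / (r * mills y)"
  unfolding phi_inv_def[abs_def] using mills_pos[of y] r
  by (auto intro!: derivative_eq_intros DERIV_mills simp: field_simps)

text \<open>The end \<open>t = T\<close> is included: \<open>phi_inv\<close> also takes negative
  arguments, which stand for times after \<open>T\<close>, so the inverse is controlled on both
  sides of \<open>T\<close>.\<close>

lemma isCont_phi: "t \<le> T \<Longrightarrow> isCont (phi r T) t"
  using isCont_inverse_function2[of "phi r T t - 1" "phi r T t" "phi r T t + 1" "phi r T" phi_inv]
    DERIV_isCont[OF DERIV_phi_inv] by (simp add: phi_inv phi_inv_phi)

text \<open>Implicit differentiation of \<open>mills (phi r T t) = exp (r * (T - t)) / 2\<close>,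
  whose right side has the derivative \<open>- r\<close> times itself.\<close>

definition phi' :: "real \<Rightarrow> real" where
  "phi' t = - r * mills (phi r T t) / mills' (phi r T t)"

lemma DERIV_phi:
  assumes "t < T"
  shows "DERIV (phi r T) t :> phi' t"
proof -
  let ?D = "- mills' (phi r T t) / (r * mills (phi r T t))"
  have "DERIV (phi r T) t :> inverse ?D"
    by (rule DERIV_inverse_function[where f=phi_inv and a="t - 1" and b=T])
      (use assms r mills'_pos[of "phi r T t"] mills_pos[of "phi r T t"] phi_nonneg[of t] isCont_phi[of t]
        DERIV_phi_inv[of "phi r T t"] in \<open>auto simp: phi_inv_phi\<close>)
  then show ?thesis by (simp add: phi'_def field_simps)
qed

lemma vol_eq: "t < T \<Longrightarrow> vol r T t = sqrt (- 2 * phi r T t * phi' t)"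
  by (simp add: vol_def DERIV_imp_deriv[OF DERIV_phi])

lemma phi'_neg: "t < T \<Longrightarrow> phi' t < 0"
  unfolding phi'_def using r mills'_pos[of "phi r T t"] mills_pos[of "phi r T t"] phi_nonneg[of t]
  by (auto intro!: divide_neg_pos mult_neg_pos)

lemma vol_power2: "t < T \<Longrightarrow> (vol r T t)\<^sup>2 = - 2 * phi r T t * phi' t"
  using phi'_neg[of t] phi_nonneg[of t] by (simp add: vol_eq mult_nonneg_nonpos)

text \<open>\<open>vol\<close> is defined through \<open>deriv\<close>; its continuity comes from
  the explicit \<open>phi'\<close>, which describes it on the open half line before
  \<open>T\<close>.\<close>

lemma isCont_vol:
  assumes "t < T"
  shows "isCont (vol r T) t"
proof -
  have "isCont mills' y" for y
    unfolding mills'_def[abs_def] normal_density_def by (auto intro!: continuous_intros isCont_mills)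
  then have "isCont phi' t"
    unfolding phi'_def[abs_def] using mills'_pos[of "phi r T t"] phi_nonneg[of t] isCont_phi[of t] assms
    by (auto intro!: continuous_intros isCont_o2[of t "phi r T"] isCont_mills)
  then have "isCont (\<lambda>s. sqrt (- 2 * phi r T s * phi' s)) t"
    using isCont_phi[of t] assms by (intro continuous_intros) auto
  moreover have "\<forall>\<^sub>F s in nhds t. vol r T s = sqrt (- 2 * phi r T s * phi' s)"
    using eventually_nhds_in_open[of "{..<T}" t] assms
    by (auto elim!: eventually_mono simp: vol_eq)
  ultimately show ?thesis by (subst isCont_cong)
qed

definition tvar :: "real \<Rightarrow> real" where "tvar t = (phi r T t)\<^sup>2"

lemma tvar_nonneg: "0 \<le> tvar t" by (simp add: tvar_def)

lemma tvar_T: "tvar T = 0" by (simp add: tvar_def phi_T)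

lemma sqrt_tvar: "t \<le> T \<Longrightarrow> sqrt (tvar t) = phi r T t"
  by (simp add: tvar_def phi_nonneg)

lemma tvar_antimono: "s \<le> t \<Longrightarrow> t \<le> T \<Longrightarrow> tvar t \<le> tvar s"
  unfolding tvar_def by (intro power_mono phi_antimono phi_nonneg) auto

lemma isCont_tvar: "t \<le> T \<Longrightarrow> isCont tvar t"
  unfolding tvar_def[abs_def] by (intro continuous_intros isCont_phi)

text \<open>The form in which the equation for \<open>phi\<close> enters the stopping problem: on
  the boundary, the claim to \<open>exp \<bar>z\<bar>\<close> is worth as much as the bond.\<close>

lemma expabs_tvar: "t \<le> T \<Longrightarrow> expabs (tvar t) 0 = exp (r * (T - t))"
  by (simp add: expabs_0_eq_mills tvar_nonneg sqrt_tvar mills_phi)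

lemma DERIV_tvar: "t < T \<Longrightarrow> DERIV tvar t :> - (vol r T t)\<^sup>2"
  unfolding tvar_def[abs_def]
  by (auto intro!: derivative_eq_intros DERIV_phi simp: vol_power2)

text \<open>The derivative of \<open>tvar\<close> is at hand before \<open>T\<close> only. The
  fundamental theorem is therefore used in the version that asks for the derivative in the interior
  and for continuity up to the ends.\<close>

lemma has_integral_vol:
  assumes "s \<le> u" "u \<le> T"
  shows "((\<lambda>t. (vol r T t)\<^sup>2) has_integral (tvar s - tvar u)) {s..u}"
proof -
  have "((\<lambda>t. (vol r T t)\<^sup>2) has_integral (- tvar u - - tvar s)) {s..u}"
  proof (rule fundamental_theorem_of_calculus_interior)
    show "continuous_on {s..u} (\<lambda>t. - tvar t)"
      using assms by (intro continuous_at_imp_continuous_on ballI continuous_intros isCont_tvar) auto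
    show "((\<lambda>t. - tvar t) has_vector_derivative (vol r T x)\<^sup>2) (at x)" if "x \<in> {s<..<u}" for x
      using DERIV_minus[OF DERIV_tvar[of x]] that assms
      by (simp add: has_real_derivative_iff_has_vector_derivative)
  qed (use assms in auto)
  then show ?thesis by simp
qed

text \<open>Leaving out the point \<open>T\<close> keeps the integrand where \<open>vol\<close> is
  continuous, hence Borel; nonnegativity then turns the gauge integral into a Lebesgue
  integral.\<close>

lemma LINT_vol: 
  assumes "t \<le> T"
  shows "(LINT s:{t..<T}|lborel. (vol r T s)\<^sup>2 / 2) = tvar t / 2"
proof -
  have m: "set_borel_measurable borel {t..<T} (\<lambda>s. (vol r T s)\<^sup>2 / 2)"
    unfolding set_borel_measurable_def
    by (subst borel_measurable_restrict_space_iff[symmetric])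
      (auto intro!: borel_measurable_continuous_on_restrict continuous_at_imp_continuous_on continuous_intros isCont_vol)
  have "((\<lambda>t. (vol r T t)\<^sup>2) has_integral (tvar t - tvar T)) {t..<T}"
    by (subst has_integral_spike_set_eq[of _ "{t..T}"])
      (use has_integral_vol[OF assms order_refl] in \<open>auto intro: negligible_subset[of "{T}"]\<close>)
  then have h: "((\<lambda>s. (vol r T s)\<^sup>2 / 2) has_integral (tvar t / 2)) {t..<T}"
    by (auto simp: tvar_T intro!: has_integral_divide)
  then have "(\<lambda>s. (vol r T s)\<^sup>2 / 2) absolutely_integrable_on {t..<T}"
    by (intro nonnegative_absolutely_integrable_1) (auto simp: has_integral_iff)
  then have "set_integrable lborel {t..<T} (\<lambda>s. (vol r T s)\<^sup>2 / 2)"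
    using m unfolding set_integrable_def set_borel_measurable_def
    by (subst (asm) integrable_completion) auto
  then show ?thesis using h by (simp add: set_borel_integral_eq_integral has_integral_iff)
qed

end

section \<open>Simple integrals\<close>

lemma steps_mono:
  fixes p :: "nat \<Rightarrow> real"
  assumes "\<And>i. i < n \<Longrightarrow> p i \<le> p (Suc i)" "i \<le> j" "j \<le> n"
  shows "p i \<le> p j"
  using assms(2,3)
proof (induction j rule: dec_induct)
  case (step j) then show ?case using assms(1)[of j] by simp
qed simp

lemma sum_indicator_steps:
  fixes p :: "nat \<Rightarrow> real"
  assumes "\<And>i. i < n \<Longrightarrow> p i \<le> p (Suc i)"
  shows "(\<Sum>i<n. indicator {p i<..p (Suc i)} s) = (indicator {p 0<..p n} s :: ennreal)"
  using assms
proof (induction n)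
  case (Suc n)
  have "p 0 \<le> p n" "p n \<le> p (Suc n)" using steps_mono[of n p 0 n] Suc.prems by auto
  moreover have "(\<Sum>i<n. indicator {p i<..p (Suc i)} s) = (indicator {p 0<..p n} s :: ennreal)"
    using Suc by auto
  ultimately show ?case by (auto split: split_indicator)
qed simp

lemma simple_process_eq:
  assumes "\<And>i. i < n \<Longrightarrow> p i \<le> p (Suc i)" "i < n" "p i < s" "s \<le> p (Suc i)"
  shows "simple_process n p \<xi> s \<omega> = \<xi> i \<omega>"
proof -
  have "\<xi> j \<omega> * indicator {p j<..p (Suc j)} s = (if j = i then \<xi> i \<omega> else 0)" if "j < n" for j
  proof (cases j i rule: linorder_cases)
    case less
    then have "p (Suc j) \<le> p i" using assms(2) less by (intro steps_mono[of n p "Suc j" i] assms(1)) auto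
    then show ?thesis using less assms(3) by simp
  next
    case greater
    then have "p (Suc i) \<le> p j" using that greater by (intro steps_mono[of n p "Suc i" j] assms(1)) auto
    then show ?thesis using greater assms(4) by simp
  qed (use assms(3,4) in simp)
  then show ?thesis using assms(2) by (simp add: simple_process_def)
qed

text \<open>Cells before \<open>y\<close> contribute their full increment, the cell around
  \<open>y\<close> the part up to \<open>y\<close>, later cells nothing. It lets one grid be summed
  up to a point of another.\<close>

lemma sum_clamp:
  fixes p :: "nat \<Rightarrow> real" and f :: "real \<Rightarrow> real"
  assumes "\<And>i. i < n \<Longrightarrow> p i \<le> p (Suc i)" "p 0 \<le> y"
  shows "(\<Sum>i<n. f (max (p i) (min (p (Suc i)) y)) - f (p i)) = f (min y (p n)) - f (p 0)"
  using assms
proof (induction n)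
  case (Suc n)
  have "p n \<le> p (Suc n)" using Suc.prems by auto
  moreover have "(\<Sum>i<n. f (max (p i) (min (p (Suc i)) y)) - f (p i)) = f (min y (p n)) - f (p 0)"
    using Suc by auto
  ultimately show ?case by (cases "y \<le> p n") (auto simp: max_absorb1 max_absorb2 min_absorb1 min_absorb2 min.commute)
qed (simp add: min_def)

text \<open>Pairs \<open>(i, j)\<close> are numbered lexicographically by
  \<open>k = i * m + j\<close>; this is how two grids become one.\<close>

lemma sum_div_mod:
  fixes g :: "nat \<Rightarrow> nat \<Rightarrow> 'b::comm_monoid_add"
  assumes "0 < m"
  shows "(\<Sum>k<n * m. g (k div m) (k mod m)) = (\<Sum>i<n. \<Sum>j<m. g i j)"
proof (induction n)
  case (Suc n)
  have "(\<Sum>k<Suc n * m. g (k div m) (k mod m))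
      = (\<Sum>k<n * m. g (k div m) (k mod m)) + (\<Sum>k\<in>{n * m..<n * m + m}. g (k div m) (k mod m))"
    using sum.atLeastLessThan_concat[of 0 "n * m" "n * m + m" "\<lambda>k. g (k div m) (k mod m)"]
    by (simp add: atLeast0LessThan add.commute)
  also have "(\<Sum>k\<in>{n * m..<n * m + m}. g (k div m) (k mod m)) = (\<Sum>j<m. g n j)"
    using sum.shift_bounds_nat_ivl[of "\<lambda>k. g (k div m) (k mod m)" 0 "n * m" m] assms
    by (simp add: atLeast0LessThan add.commute)
  finally show ?case using Suc by simp
qed simp

lemma sum_diff_mult:
  fixes x y :: "nat \<Rightarrow> real"
  shows "(\<Sum>i<n. \<Sum>j<m. (x i - y j) * D i j) = (\<Sum>i<n. x i * (\<Sum>j<m. D i j)) - (\<Sum>i<n. \<Sum>j<m. y j * D i j)"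
  by (simp add: sum_subtractf left_diff_distrib sum_distrib_left)

section \<open>Brownian increments and the Ito isometry\<close>

locale bm =
  fixes M :: "'a measure" and F :: "real \<Rightarrow> 'a measure" and W :: "real \<Rightarrow> 'a \<Rightarrow> real"
  assumes bm: "brownian_motion M F W"
begin

sublocale prob_space M
  using bm by (auto simp: brownian_motion_def filtered_prob_space_def)

lemma space_F[simp]: "space (F t) = space M"
  using bm by (auto simp: brownian_motion_def filtered_prob_space_def filtration_def)

lemma sets_F_mono: "s \<le> t \<Longrightarrow> sets (F s) \<subseteq> sets (F t)"
  using bm by (auto simp: brownian_motion_def filtered_prob_space_def filtration_def)

lemma sets_F_M: "A \<in> sets (F s) \<Longrightarrow> A \<in> sets M"
  using bm by (auto simp: brownian_motion_def filtered_prob_space_def subalgebra_def)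

lemma measurable_F_mono: "f \<in> measurable (F s) N \<Longrightarrow> s \<le> t \<Longrightarrow> f \<in> measurable (F t) N"
  using sets_F_mono[of s t] by (auto simp: measurable_def)

lemma measurable_F_M: "f \<in> measurable (F s) N \<Longrightarrow> f \<in> measurable M N"
  using bm by (auto simp: brownian_motion_def filtered_prob_space_def intro: measurable_from_subalg)

lemma W_measurable: "0 \<le> s \<Longrightarrow> s \<le> t \<Longrightarrow> W s \<in> borel_measurable (F t)"
  using bm by (auto simp: brownian_motion_def intro: measurable_F_mono)

lemma W_measurable_M: "0 \<le> s \<Longrightarrow> W s \<in> borel_measurable M"
  using W_measurable[of s s] by (auto intro: measurable_F_M)

lemma distr_increment:
  assumes "0 \<le> s" "s \<le> u"
  shows "distr M borel (\<lambda>\<omega>. W u \<omega> - W s \<omega>) = distr stdn borel (\<lambda>y. sqrt (u - s) * y)"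
proof (cases "s = u")
  case True
  then have "distr M borel (\<lambda>\<omega>. W u \<omega> - W s \<omega>) = distr M borel (\<lambda>\<omega>. 0 :: real)" by simp
  also have "\<dots> = return borel 0" by (rule distr_const) simp
  also have "\<dots> = distr stdn borel (\<lambda>y. sqrt (u - s) * y)" using True by simp
  finally show ?thesis .
next
  case False
  then have "distributed M lborel (\<lambda>\<omega>. W u \<omega> - W s \<omega>) (normal_density 0 (sqrt (u - s)))"
    using bm assms by (auto simp: brownian_motion_def)
  then show ?thesis using assms False
    by (subst stdn_scaled) (auto simp: distributed_def cong: distr_cong)
qed

text \<open>\<open>brownian_motion\<close> speaks of \<open>s < t\<close> only; for
  \<open>s = u\<close> the increment vanishes and generates just the trivial events.\<close>

lemma indep_increment:
  assumes "0 \<le> s" "s \<le> u" "Y \<in> measurable (F s) N"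
  shows "indep_var N Y borel (\<lambda>\<omega>. W u \<omega> - W s \<omega>)"
proof -
  let ?D = "\<lambda>\<omega>. W u \<omega> - W s \<omega>"
  have Y: "Y \<in> measurable M N" using assms(3) by (rule measurable_F_M)
  have mW: "?D \<in> borel_measurable M"
    using assms W_measurable_M by (intro borel_measurable_diff) auto
  have ind: "indep_set (sets (F s)) {?D -` B \<inter> space M | B. B \<in> sets borel}"
  proof (cases "s = u")
    case True
    have B: "b = {} \<or> b = space M" if "b \<in> {?D -` B \<inter> space M | B. B \<in> sets borel}" for b
      using that True by (cases "b = {}") (auto split: if_splits)
    have "prob (a \<inter> b) = prob a * prob b"
      if "a \<in> sets (F s)" "b \<in> {?D -` B \<inter> space M | B. B \<in> sets borel}" for a b
      using B[OF that(2)] sets.sets_into_space[OF that(1)] by (auto simp: prob_space Int_absorb2)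
    then show ?thesis
      unfolding indep_sets2_eq 
    proof (intro conjI subsetI ballI)
      fix b assume "b \<in> {?D -` B \<inter> space M | B. B \<in> sets borel}"
      from B[OF this] show "b \<in> events" by auto
    qed (auto intro: sets_F_M)
  next
    case False
    then show ?thesis using bm assms by (auto simp: brownian_motion_def)
  qed
  have 1: "sigma_sets (space M) {Y -` A \<inter> space M |A. A \<in> sets N} \<subseteq> sets (F s)"
    using measurable_sets[OF assms(3)]
    by (intro sets.sigma_sets_subset[of _ "F s", simplified]) auto
  have 2: "sigma_sets (space M) {?D -` B \<inter> space M |B. B \<in> sets borel} = {?D -` B \<inter> space M | B. B \<in> sets borel}"
    using sets_vimage_algebra[of "space M" ?D borel] sets_vimage_algebra2[of ?D "space M" borel] by simp
  show ?thesis
    unfolding indep_var_eq 2 using 1 ind Y mW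
    unfolding indep_sets2_eq by blast
qed

lemma increment_integral:
  assumes "0 \<le> s" "s \<le> u" and [measurable]: "\<xi> \<in> borel_measurable (F s)" "g \<in> borel_measurable borel"
    and "integrable M \<xi>" "integrable stdn (\<lambda>y. g (sqrt (u - s) * y))"
  shows "integrable M (\<lambda>\<omega>. \<xi> \<omega> * g (W u \<omega> - W s \<omega>) :: real)"
    "expectation (\<lambda>\<omega>. \<xi> \<omega> * g (W u \<omega> - W s \<omega>)) = expectation \<xi> * (LINT y|stdn. g (sqrt (u - s) * y))"
proof -
  have [measurable]: "W u \<in> borel_measurable M" "W s \<in> borel_measurable M" "\<xi> \<in> borel_measurable M"
    using assms W_measurable_M measurable_F_M by auto
  have ind: "indep_var borel \<xi> borel (\<lambda>\<omega>. g (W u \<omega> - W s \<omega>))"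
    using indep_var_compose[OF indep_increment[OF assms(1-3)], of "\<lambda>x. x" borel g borel]
    by (simp add: comp_def)
  have d: "integrable (distr M borel (\<lambda>\<omega>. W u \<omega> - W s \<omega>)) g"
    using assms by (simp add: distr_increment integrable_distr_eq)
  have i: "integrable M (\<lambda>\<omega>. g (W u \<omega> - W s \<omega>))"
    using d by (simp add: integrable_distr_eq)
  have "(LINT y|stdn. g (sqrt (u - s) * y)) = (LINT y|distr M borel (\<lambda>\<omega>. W u \<omega> - W s \<omega>). g y)"
    using assms by (simp add: distr_increment integral_distr)
  then have e: "(LINT y|stdn. g (sqrt (u - s) * y)) = expectation (\<lambda>\<omega>. g (W u \<omega> - W s \<omega>))"
    by (simp add: integral_distr)
  show "integrable M (\<lambda>\<omega>. \<xi> \<omega> * g (W u \<omega> - W s \<omega>))"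
    by (rule indep_var_integrable[OF ind assms(5) i])
  show "expectation (\<lambda>\<omega>. \<xi> \<omega> * g (W u \<omega> - W s \<omega>)) = expectation \<xi> * (LINT y|stdn. g (sqrt (u - s) * y))"
    unfolding e by (rule indep_var_lebesgue_integral[OF ind assms(5) i])
qed

text \<open>The Markov step in integrated form: on events of the past, the new noise acts as the
  heat semigroup.\<close>

lemma gauss_increment:
  assumes "0 \<le> s" "s \<le> u" "0 \<le> c" and A: "A \<in> sets (F s)" and Y: "Y \<in> borel_measurable (F s)"
    and [measurable]: "k \<in> borel_measurable borel" and bound: "\<And>x. \<bar>k x\<bar> \<le> C"
  shows "expectation (\<lambda>\<omega>. indicator A \<omega> * k (Y \<omega> + c * (W u \<omega> - W s \<omega>)))
    = expectation (\<lambda>\<omega>. indicator A \<omega> * gauss (c\<^sup>2 * (u - s)) k (Y \<omega>))"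
proof -
  have C0: "0 \<le> C" using bound[of 0] by (rule order_trans[OF abs_ge_zero])
  let ?D = "\<lambda>\<omega>. W u \<omega> - W s \<omega>" and ?v = "c\<^sup>2 * (u - s)"
  \<comment> \<open>The event is folded into the variable: \<open>Y'\<close> is known at time
    \<open>s\<close>, so independence of \<open>Y'\<close> and the increment is enough. The part off
    \<open>A\<close>, where \<open>Y'\<close> is 0, is computed separately and cancels.\<close>
  define Y' where "Y' \<omega> = (if \<omega> \<in> A then Y \<omega> else 0)" for \<omega>
  have Y': "Y' \<in> borel_measurable (F s)" unfolding Y'_def[abs_def] using A Y by measurable
  have [measurable]: "Y' \<in> borel_measurable M" "Y \<in> borel_measurable M" "A \<in> sets M"
    using Y Y' A measurable_F_M sets_F_M by blast+
  have [measurable]: "?D \<in> borel_measurable M" using assms W_measurable_M by auto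
  interpret d: prob_space "distr M borel ?D" by (rule prob_space_distr) simp
  interpret z: prob_space "distr M borel Y'" by (rule prob_space_distr) simp
  interpret zd: pair_prob_space "distr M borel Y'" "distr M borel ?D" ..
  have e: "distr M borel Y' \<Otimes>\<^sub>M distr M borel ?D = distr M (borel \<Otimes>\<^sub>M borel) (\<lambda>\<omega>. (Y' \<omega>, ?D \<omega>))"
    using indep_increment[OF assms(1,2) Y'] unfolding indep_var_distribution_eq by simp
  define h where "h = (\<lambda>(z, x). k (z + c * x))"
  have [measurable]: "h \<in> borel_measurable (borel \<Otimes>\<^sub>M borel)" unfolding h_def by measurable
  have i: "integrable (distr M borel Y' \<Otimes>\<^sub>M distr M borel ?D) h"
    by (rule zd.integrable_const_bound[of _ C]) (auto simp: h_def bound)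
  have sq: "sqrt ?v * y = c * (sqrt (u - s) * y)" for y
    using assms(1-3) by (simp add: real_sqrt_mult)
  have kint: "integrable M (\<lambda>\<omega>. indicator B \<omega> * k (f \<omega>))" if [measurable]: "f \<in> borel_measurable M" "B \<in> sets M" for f B
    using bound C0 by (intro integrable_const_bound[of _ C] AE_I2) (auto split: split_indicator)
  have gb: "\<bar>gauss ?v k z\<bar> \<le> C" for z using bound by (intro gauss_bound) auto
  have gint: "integrable M (\<lambda>\<omega>. indicator B \<omega> * gauss ?v k (f \<omega>))" if [measurable]: "f \<in> borel_measurable M" "B \<in> sets M" for f B
    using gb C0 by (intro integrable_const_bound[of _ C] AE_I2) (auto split: split_indicator)
  have "expectation (\<lambda>\<omega>. k (Y' \<omega> + c * ?D \<omega>)) = (LINT x|distr M (borel \<Otimes>\<^sub>M borel) (\<lambda>\<omega>. (Y' \<omega>, ?D \<omega>)). h x)"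
    by (subst integral_distr) (auto simp: h_def)
  also have "\<dots> = (LINT z|distr M borel Y'. LINT x|distr M borel ?D. h (z, x))"
    using zd.integral_fst'[OF i] by (simp add: e)
  also have "\<dots> = (LINT z|distr M borel Y'. gauss ?v k z)"
    using assms by (simp add: distr_increment integral_distr h_def gauss_def sq)
  also have "\<dots> = expectation (\<lambda>\<omega>. gauss ?v k (Y' \<omega>))"
    by (subst integral_distr) auto
  also have "\<dots> = expectation (\<lambda>\<omega>. indicator A \<omega> * gauss ?v k (Y \<omega>) + indicator (space M - A) \<omega> * gauss ?v k 0)"
    by (intro Bochner_Integration.integral_cong) (auto simp: Y'_def split: split_indicator)
  also have "\<dots> = expectation (\<lambda>\<omega>. indicator A \<omega> * gauss ?v k (Y \<omega>)) + prob (space M - A) * gauss ?v k 0"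
    using gint[of Y A] gint[of "\<lambda>_. 0" "space M - A"] by simp
  finally have 1: "expectation (\<lambda>\<omega>. k (Y' \<omega> + c * ?D \<omega>))
    = expectation (\<lambda>\<omega>. indicator A \<omega> * gauss ?v k (Y \<omega>)) + prob (space M - A) * gauss ?v k 0" .
  have "expectation (\<lambda>\<omega>. k (Y' \<omega> + c * ?D \<omega>))
    = expectation (\<lambda>\<omega>. indicator A \<omega> * k (Y \<omega> + c * ?D \<omega>) + indicator (space M - A) \<omega> * k (c * ?D \<omega>))"
    by (intro Bochner_Integration.integral_cong) (auto simp: Y'_def split: split_indicator)
  also have "\<dots> = expectation (\<lambda>\<omega>. indicator A \<omega> * k (Y \<omega> + c * ?D \<omega>))
      + expectation (\<lambda>\<omega>. indicator (space M - A) \<omega> * k (c * ?D \<omega>))"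
    by (rule Bochner_Integration.integral_add) (auto intro!: kint)
  also have "expectation (\<lambda>\<omega>. indicator (space M - A) \<omega> * k (c * ?D \<omega>)) = prob (space M - A) * gauss ?v k 0"
  proof -
    have "space M - A \<in> sets (F s)" using A sets.compl_sets[of A "F s"] by simp
    then have "indicator (space M - A) \<in> borel_measurable (F s)" by (rule borel_measurable_indicator)
    moreover have "integrable M (indicator (space M - A) :: _ \<Rightarrow> real)"
      by (intro integrable_const_bound[of _ 1]) auto
    moreover have "integrable stdn (\<lambda>y. k (c * (sqrt (u - s) * y)))"
      using bound by (intro stdn.integrable_const_bound[of _ C]) auto
    ultimately show ?thesis
      using increment_integral(2)[OF assms(1,2), of "indicator (space M - A)" "\<lambda>x. k (c * x)"]
      by (simp add: gauss_def sq)
  qed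
  finally show ?thesis using 1 by simp
qed

text \<open>Ito isometry by induction on the cells: the cross term vanishes because the last
  increment is centred and independent of the past. Measurability of the integral at time
  \<open>p n\<close> is carried along for that step.\<close>

lemma simple_integral_isometry:
  assumes "0 \<le> p 0" "\<And>i. i < n \<Longrightarrow> p i \<le> p (Suc i)"
    and "\<And>i. i < n \<Longrightarrow> \<zeta> i \<in> borel_measurable (F (p i))"
    and "\<And>i. i < n \<Longrightarrow> \<exists>C. \<forall>\<omega>\<in>space M. \<bar>\<zeta> i \<omega>\<bar> \<le> C"
  shows "simple_integral W n p \<zeta> \<in> borel_measurable (F (p n)) \<and>
    integrable M (\<lambda>\<omega>. (simple_integral W n p \<zeta> \<omega>)\<^sup>2) \<and>
    expectation (\<lambda>\<omega>. (simple_integral W n p \<zeta> \<omega>)\<^sup>2)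
      = expectation (\<lambda>\<omega>. \<Sum>i<n. (\<zeta> i \<omega>)\<^sup>2 * (p (Suc i) - p i))"
  using assms
proof (induction n)
  case 0
  then show ?case by (simp add: simple_integral_def[abs_def])
next
  case (Suc n)
  let ?I = "simple_integral W n p \<zeta>" and ?D = "\<lambda>\<omega>. W (p (Suc n)) \<omega> - W (p n) \<omega>"
  have pn: "0 \<le> p n" "p n \<le> p (Suc n)" using steps_mono[of n p 0 n] Suc.prems by auto
  have IH: "?I \<in> borel_measurable (F (p n))" "integrable M (\<lambda>\<omega>. (?I \<omega>)\<^sup>2)"
    "expectation (\<lambda>\<omega>. (?I \<omega>)\<^sup>2) = expectation (\<lambda>\<omega>. \<Sum>i<n. (\<zeta> i \<omega>)\<^sup>2 * (p (Suc i) - p i))"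
    using Suc by auto
  have z: "\<zeta> n \<in> borel_measurable (F (p n))" using Suc.prems by auto
  obtain C where C: "\<And>\<omega>. \<omega> \<in> space M \<Longrightarrow> \<bar>\<zeta> n \<omega>\<bar> \<le> C" using Suc.prems(4)[of n] by auto
  have [measurable]: "\<And>i. i < Suc n \<Longrightarrow> \<zeta> i \<in> borel_measurable M" "?I \<in> borel_measurable M"
    using Suc.prems(3) IH(1) measurable_F_M by blast+
  have zb: "integrable M (\<lambda>\<omega>. (\<zeta> i \<omega>)\<^sup>2)" if i: "i < Suc n" for i
  proof -
    obtain B where B: "\<And>\<omega>. \<omega> \<in> space M \<Longrightarrow> \<bar>\<zeta> i \<omega>\<bar> \<le> B" using Suc.prems(4)[OF i] by auto
    show ?thesis
      using B i by (intro integrable_const_bound[of _ "B\<^sup>2"] AE_I2)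
        (auto simp: abs_le_square_iff[symmetric] intro: order_trans[OF _ abs_ge_self])
  qed
  have iI: "integrable M ?I"
    using IH(2) by (rule square_integrable_imp_integrable[rotated]) simp
  have iIz: "integrable M (\<lambda>\<omega>. ?I \<omega> * \<zeta> n \<omega>)"
  proof (rule Bochner_Integration.integrable_bound[of _ "\<lambda>\<omega>. C * \<bar>?I \<omega>\<bar>"])
    show "AE \<omega> in M. norm (?I \<omega> * \<zeta> n \<omega>) \<le> norm (C * \<bar>?I \<omega>\<bar>)"
      using C by (intro AE_I2) (auto simp: abs_mult mult.commute[of C] intro!: mult_left_mono intro: order_trans[OF _ abs_ge_self])
  qed (use iI in auto)
  have s: "(LINT y|stdn. (sqrt c * y)\<^sup>2) = c" "integrable stdn (\<lambda>y. (sqrt c * y)\<^sup>2)"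
    "(LINT y|stdn. sqrt c * y) = 0" "integrable stdn (\<lambda>y. sqrt c * y)" if "0 \<le> c" for c
    using that by (simp_all add: power_mult_distrib stdn_moments)
  have sq: "(simple_integral W (Suc n) p \<zeta> \<omega>)\<^sup>2
      = (?I \<omega>)\<^sup>2 + (2 * ((?I \<omega> * \<zeta> n \<omega>) * ?D \<omega>) + (\<zeta> n \<omega>)\<^sup>2 * (?D \<omega>)\<^sup>2)" for \<omega>
    by (simp add: simple_integral_def power2_eq_square algebra_simps)
  have m1: "(\<lambda>\<omega>. ?I \<omega> * \<zeta> n \<omega>) \<in> borel_measurable (F (p n))"
    "(\<lambda>\<omega>. (\<zeta> n \<omega>)\<^sup>2) \<in> borel_measurable (F (p n))" using IH(1) z by auto
  note a = increment_integral[where g = "\<lambda>x. x", OF pn m1(1) _ iIz]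
    and b = increment_integral[where g = "\<lambda>x. x\<^sup>2", OF pn m1(2) _ zb[of n]]
  have a': "integrable M (\<lambda>\<omega>. (?I \<omega> * \<zeta> n \<omega>) * ?D \<omega>)" "expectation (\<lambda>\<omega>. (?I \<omega> * \<zeta> n \<omega>) * ?D \<omega>) = 0"
    and b': "integrable M (\<lambda>\<omega>. (\<zeta> n \<omega>)\<^sup>2 * (?D \<omega>)\<^sup>2)"
      "expectation (\<lambda>\<omega>. (\<zeta> n \<omega>)\<^sup>2 * (?D \<omega>)\<^sup>2) = expectation (\<lambda>\<omega>. (\<zeta> n \<omega>)\<^sup>2) * (p (Suc n) - p n)"
    using a b s[of "p (Suc n) - p n"] pn by auto
  have "simple_integral W (Suc n) p \<zeta> \<in> borel_measurable (F (p (Suc n)))"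
  proof -
    have "(\<lambda>\<omega>. ?I \<omega> + \<zeta> n \<omega> * ?D \<omega>) \<in> borel_measurable (F (p (Suc n)))"
      using measurable_F_mono[OF IH(1) pn(2)] measurable_F_mono[OF z pn(2)]
        W_measurable[OF pn] W_measurable[of "p (Suc n)" "p (Suc n)"] pn by auto
    then show ?thesis by (simp add: simple_integral_def[abs_def])
  qed
  moreover have "integrable M (\<lambda>\<omega>. (simple_integral W (Suc n) p \<zeta> \<omega>)\<^sup>2)"
    unfolding sq using IH(2) a' b' by auto
  moreover have "expectation (\<lambda>\<omega>. (simple_integral W (Suc n) p \<zeta> \<omega>)\<^sup>2)
      = expectation (\<lambda>\<omega>. \<Sum>i<Suc n. (\<zeta> i \<omega>)\<^sup>2 * (p (Suc i) - p i))"
  proof -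
    have "integrable M (\<lambda>\<omega>. \<Sum>i<n. (\<zeta> i \<omega>)\<^sup>2 * (p (Suc i) - p i))"
      using zb by (intro Bochner_Integration.integrable_sum) auto
    then show ?thesis
      unfolding sq using IH(2,3) a' b' zb[of n] by (simp add: Bochner_Integration.integral_add)
  qed
  ultimately show ?case by blast
qed

text \<open>Stopping the integrand as soon as its energy would exceed \<open>\<delta>\<close> makes it square integrable,
  and changes nothing on the event that the total energy is at most \<open>\<delta>\<close>.\<close>

lemma simple_integral_tail:
  assumes "0 \<le> p 0" and mono: "\<And>i. i < n \<Longrightarrow> p i \<le> p (Suc i)"
    and meas: "\<And>i. i < n \<Longrightarrow> \<zeta> i \<in> borel_measurable (F (p i))"
    and "0 < \<epsilon>" "0 < \<delta>"
  shows "prob {\<omega> \<in> space M. \<bar>simple_integral W n p \<zeta> \<omega>\<bar> > \<epsilon>}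
    \<le> prob {\<omega> \<in> space M. (\<Sum>i<n. (\<zeta> i \<omega>)\<^sup>2 * (p (Suc i) - p i)) > \<delta>} + \<delta> / \<epsilon>\<^sup>2"
proof -
  define e where "e i \<omega> = (\<Sum>j<i. (\<zeta> j \<omega>)\<^sup>2 * (p (Suc j) - p j))" for i \<omega>
  \<comment> \<open>The energy \<open>e (Suc i)\<close> includes the coming cell but involves only
    weights known at \<open>p i\<close>, so the rule does not look ahead. Cells of length 0 are
    dropped, since the energy does not bound their weights.\<close>
  define \<zeta>' where "\<zeta>' i \<omega> = (if p i < p (Suc i) \<and> e (Suc i) \<omega> \<le> \<delta> then \<zeta> i \<omega> else 0)" for i \<omega>
  have e_mono: "e i \<omega> \<le> e j \<omega>" if "i \<le> j" "j \<le> n" for i j \<omega>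
    by (rule steps_mono[OF _ that]) (use mono in \<open>auto simp: e_def\<close>)
  have m: "\<zeta>' i \<in> borel_measurable (F (p i))" if "i < n" for i
  proof -
    have [measurable]: "\<zeta> j \<in> borel_measurable (F (p i))" if "j < Suc i" for j
      using that \<open>i < n\<close> by (intro measurable_F_mono[OF meas[of j]] steps_mono[of n p j i] mono) auto
    show ?thesis unfolding \<zeta>'_def[abs_def] e_def using that by measurable
  qed
  have mM: "\<zeta> i \<in> borel_measurable M" "\<zeta>' i \<in> borel_measurable M" if "i < n" for i
    using meas m that measurable_F_M by blast+
  have bdd: "\<exists>C. \<forall>\<omega>\<in>space M. \<bar>\<zeta>' i \<omega>\<bar> \<le> C" if "i < n" for i
  proof (cases "p i < p (Suc i)")
    case True
    \<comment> \<open>While the rule lets the weight pass, the energy of this single cell is at most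
      \<open>\<delta>\<close>, which bounds the weight.\<close>
    have "\<bar>\<zeta>' i \<omega>\<bar> \<le> sqrt (\<delta> / (p (Suc i) - p i))" for \<omega>
    proof (cases "e (Suc i) \<omega> \<le> \<delta>")
      case e: True
      have "0 \<le> e i \<omega>" using e_mono[of 0 i \<omega>] that by (simp add: e_def)
      then have "(\<zeta> i \<omega>)\<^sup>2 * (p (Suc i) - p i) \<le> \<delta>" using e by (simp add: e_def)
      then have "(\<zeta> i \<omega>)\<^sup>2 \<le> \<delta> / (p (Suc i) - p i)" using True by (simp add: field_simps)
      then have "\<bar>\<zeta> i \<omega>\<bar> \<le> sqrt (\<delta> / (p (Suc i) - p i))" by (rule real_le_rsqrt[of "\<bar>\<zeta> i \<omega>\<bar>", simplified])
      then show ?thesis using True \<open>0 < \<delta>\<close> by (auto simp: \<zeta>'_def)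
    qed (use True \<open>0 < \<delta>\<close> in \<open>auto simp: \<zeta>'_def\<close>)
    then show ?thesis by blast
  qed (auto simp: \<zeta>'_def)
  have energy: "(\<Sum>i<j. (\<zeta>' i \<omega>)\<^sup>2 * (p (Suc i) - p i)) \<le> min \<delta> (e j \<omega>)" if "j \<le> n" for j \<omega>
    using that
  proof (induction j)
    case 0 then show ?case using \<open>0 < \<delta>\<close> by (simp add: e_def)
  next
    case (Suc j)
    have "e j \<omega> \<le> e (Suc j) \<omega>" using Suc.prems by (intro e_mono) auto
    moreover have "e (Suc j) \<omega> = e j \<omega> + (\<zeta> j \<omega>)\<^sup>2 * (p (Suc j) - p j)" by (simp add: e_def)
    moreover have "p j \<le> p (Suc j)" using mono Suc.prems by auto
    ultimately show ?case using Suc by (auto simp: \<zeta>'_def)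
  qed
  note iso = simple_integral_isometry[of p n \<zeta>', OF assms(1) mono m bdd, simplified]
  have mI': "simple_integral W n p \<zeta>' \<in> borel_measurable M"
    using iso measurable_F_M by blast
  have "expectation (\<lambda>\<omega>. (simple_integral W n p \<zeta>' \<omega>)\<^sup>2) \<le> expectation (\<lambda>\<omega>. \<delta>)"
    using iso
  proof (simp only:, intro integral_mono)
    have "\<bar>\<Sum>i<n. (\<zeta>' i \<omega>)\<^sup>2 * (p (Suc i) - p i)\<bar> \<le> \<delta>" for \<omega>
      using energy[of n \<omega>] mono by (subst abs_of_nonneg) (auto intro!: sum_nonneg)
    then show "integrable M (\<lambda>\<omega>. \<Sum>i<n. (\<zeta>' i \<omega>)\<^sup>2 * (p (Suc i) - p i))"
      using mM by (intro integrable_const_bound[of _ \<delta>]) auto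
  qed (use energy[of n] in auto)
  then have E: "expectation (\<lambda>\<omega>. (simple_integral W n p \<zeta>' \<omega>)\<^sup>2) \<le> \<delta>" by (simp add: prob_space)
  have "prob {\<omega> \<in> space M. \<bar>simple_integral W n p \<zeta>' \<omega>\<bar> > \<epsilon>}
      \<le> prob {\<omega> \<in> space M. (simple_integral W n p \<zeta>' \<omega>)\<^sup>2 \<ge> \<epsilon>\<^sup>2}"
    using mI' \<open>0 < \<epsilon>\<close> by (intro finite_measure_mono)
      (auto simp: abs_le_square_iff[symmetric] power2_abs)
  also have "\<dots> \<le> expectation (\<lambda>\<omega>. (simple_integral W n p \<zeta>' \<omega>)\<^sup>2) / \<epsilon>\<^sup>2"
    using iso \<open>0 < \<epsilon>\<close> by (intro integral_Markov_inequality_measure[where A="{}"]) auto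
  also have "\<dots> \<le> \<delta> / \<epsilon>\<^sup>2" using E \<open>0 < \<epsilon>\<close> by (simp add: divide_right_mono)
  finally have P': "prob {\<omega> \<in> space M. \<bar>simple_integral W n p \<zeta>' \<omega>\<bar> > \<epsilon>} \<le> \<delta> / \<epsilon>\<^sup>2" .
  have eq: "simple_integral W n p \<zeta> \<omega> = simple_integral W n p \<zeta>' \<omega>" if "e n \<omega> \<le> \<delta>" for \<omega>
    unfolding simple_integral_def
  proof (intro sum.cong refl)
    fix i assume "i \<in> {..<n}"
    then show "\<zeta> i \<omega> * (W (p (Suc i)) \<omega> - W (p i) \<omega>) = \<zeta>' i \<omega> * (W (p (Suc i)) \<omega> - W (p i) \<omega>)"
      using mono[of i] e_mono[of "Suc i" n \<omega>] that by (cases "p i = p (Suc i)") (auto simp: \<zeta>'_def)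
  qed
  have [measurable]: "e n \<in> borel_measurable M" unfolding e_def[abs_def] using mM by auto
  have "prob {\<omega> \<in> space M. \<bar>simple_integral W n p \<zeta> \<omega>\<bar> > \<epsilon>}
      \<le> prob ({\<omega> \<in> space M. e n \<omega> > \<delta>} \<union> {\<omega> \<in> space M. \<bar>simple_integral W n p \<zeta>' \<omega>\<bar> > \<epsilon>})"
    using mI' by (intro finite_measure_mono) (auto, metis eq linorder_not_less)
  also have "\<dots> \<le> prob {\<omega> \<in> space M. e n \<omega> > \<delta>} + prob {\<omega> \<in> space M. \<bar>simple_integral W n p \<zeta>' \<omega>\<bar> > \<epsilon>}"
    using mI' by (intro measure_Un_le) auto
  finally show ?thesis using P' by (simp add: e_def)
qed

text \<open>The difference of two simple integrals is a simple integral over the common refinement,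
  whose energy is at most the squared distance of the integrands over \<open>[a, b]\<close>.\<close>

lemma simple_integral_diff_tail:
  assumes "0 \<le> a"
    and p: "p 0 = a" "p n = b" "\<And>i. i < n \<Longrightarrow> p i \<le> p (Suc i)"
    and q: "q 0 = a" "q m = b" "\<And>j. j < m \<Longrightarrow> q j \<le> q (Suc j)"
    and \<xi>: "\<And>i. i < n \<Longrightarrow> \<xi> i \<in> borel_measurable (F (p i))"
    and \<eta>: "\<And>j. j < m \<Longrightarrow> \<eta> j \<in> borel_measurable (F (q j))"
    and "0 < \<epsilon>" "0 < \<delta>"
  shows "prob {\<omega> \<in> space M. \<bar>simple_integral W n p \<xi> \<omega> - simple_integral W m q \<eta> \<omega>\<bar> > \<epsilon>}
    \<le> prob {\<omega> \<in> space M. (\<integral>\<^sup>+s\<in>{a..b}. ennreal ((simple_process n p \<xi> s \<omega> - simple_process m q \<eta> s \<omega>)\<^sup>2) \<partial>lborel) > ennreal \<delta>}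
      + \<delta> / \<epsilon>\<^sup>2"
proof (cases "m = 0")
  \<comment> \<open>A grid without cells forces \<open>a = b\<close>, so all increments
    vanish.\<close>
  case True
  then have "p i = a" if "i \<le> n" for i
    using steps_mono[of n p 0 i] steps_mono[of n p i n] p q that by auto
  then have "simple_integral W n p \<xi> \<omega> = 0" for \<omega> by (simp add: simple_integral_def)
  then show ?thesis using True assms(10,11) by (simp add: simple_integral_def)
next
  case False
  then have m: "0 < m" by simp
  \<comment> \<open>\<open>c i j\<close> is the point \<open>q j\<close> moved into the
    \<open>i\<close>-th cell of \<open>p\<close>. Running through \<open>j\<close> for each
    \<open>i\<close> lists the refinement, with many cells of length 0.\<close>
  define c where "c i j = max (p i) (min (p (Suc i)) (q j))" for i j
  define cc where "cc k = c (k div m) (k mod m)" for k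
  \<comment> \<open>On a cell of positive length both weights are known at its left end. On an empty
    cell this can fail, so the weight is set to 0 there, which does not change the integral.\<close>
  define \<zeta> where "\<zeta> k \<omega> = (if cc k < cc (Suc k) then \<xi> (k div m) \<omega> - \<eta> (k mod m) \<omega> else 0)" for k \<omega>
  have pa: "a \<le> p i" "p i \<le> b" if "i \<le> n" for i
    using steps_mono[of n p 0 i] steps_mono[of n p i n] p that by auto
  have qa: "a \<le> q j" "q j \<le> b" if "j \<le> m" for j
    using steps_mono[of m q 0 j] steps_mono[of m q j m] q that by auto
  have c0: "c i 0 = p i" if "i < n" for i
    using that pa[of i] pa[of "Suc i"] q by (auto simp: c_def)
  have cm: "c i m = p (Suc i)" if "i < n" for i
    using that pa[of i] pa[of "Suc i"] p(3)[of i] q by (auto simp: c_def)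
  have dm: "k div m < n" "k mod m < m" if "k < n * m" for k
    using that m by (auto simp: less_mult_imp_div_less)
  have ccS: "cc (Suc k) = c (k div m) (Suc (k mod m))" if "k < n * m" for k
  proof (cases "Suc (k mod m) = m")
    case True
    then have "Suc k div m = Suc (k div m)" "Suc k mod m = 0" by (auto simp: div_Suc mod_Suc)
    moreover have "c (Suc (k div m)) 0 = p (Suc (k div m))"
      using pa[of "Suc (k div m)"] dm[OF that] q by (auto simp: c_def)
    ultimately show ?thesis using True cm[of "k div m"] dm[OF that] by (simp add: cc_def)
  next
    case False
    then have "Suc k div m = k div m" "Suc k mod m = Suc (k mod m)" by (auto simp: div_Suc mod_Suc)
    then show ?thesis by (simp add: cc_def)
  qed
  have cmono: "c i j \<le> c i (Suc j)" if "j < m" for i j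
    using q(3)[OF that] by (auto simp: c_def)
  have ccmono: "cc k \<le> cc (Suc k)" if "k < n * m" for k
    using ccS[OF that] cmono[of "k mod m"] m by (simp add: cc_def)
  have cc0: "0 \<le> cc 0"
    using pa[of 0] \<open>0 \<le> a\<close> by (auto simp: cc_def c_def)
  have cle: "p i \<le> c i j" "q j \<le> c i j" "c i (Suc j) \<le> p (Suc i)" "c i (Suc j) \<le> q (Suc j)"
    if "c i j < c i (Suc j)" "i < n" "j < m" for i j
    using that p(3)[of i] q(3)[of j] by (auto simp: c_def max_def min_def split: if_splits)
  have \<zeta>: "\<zeta> k \<in> borel_measurable (F (cc k))" if "k < n * m" for k
  proof (cases "cc k < cc (Suc k)")
    case True
    note cl = cle[of "k div m" "k mod m"]
    have "\<xi> (k div m) \<in> borel_measurable (F (cc k))" "\<eta> (k mod m) \<in> borel_measurable (F (cc k))"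
      using True ccS[OF that] dm[OF that] cl
      by (auto intro!: measurable_F_mono[OF \<xi>] measurable_F_mono[OF \<eta>] simp: cc_def)
    then show ?thesis using True by (auto simp: \<zeta>_def[abs_def])
  qed (simp add: \<zeta>_def[abs_def])
  have "simple_integral W (n * m) cc \<zeta> \<omega> = simple_integral W n p \<xi> \<omega> - simple_integral W m q \<eta> \<omega>" for \<omega>
  proof -
    let ?w = "\<lambda>s. W s \<omega>"
    have "simple_integral W (n * m) cc \<zeta> \<omega>
      = (\<Sum>k<n * m. (\<xi> (k div m) \<omega> - \<eta> (k mod m) \<omega>) * (?w (c (k div m) (Suc (k mod m))) - ?w (c (k div m) (k mod m))))"
      unfolding simple_integral_def
    proof (intro sum.cong refl)
      fix k assume "k \<in> {..<n * m}"
      then show "\<zeta> k \<omega> * (?w (cc (Suc k)) - ?w (cc k))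
        = (\<xi> (k div m) \<omega> - \<eta> (k mod m) \<omega>) * (?w (c (k div m) (Suc (k mod m))) - ?w (c (k div m) (k mod m)))"
        using ccmono[of k] ccS[of k] by (cases "cc k < cc (Suc k)") (auto simp: \<zeta>_def cc_def)
    qed
    also have "\<dots> = (\<Sum>i<n. \<Sum>j<m. (\<xi> i \<omega> - \<eta> j \<omega>) * (?w (c i (Suc j)) - ?w (c i j)))"
      by (rule sum_div_mod[OF m])
    also have "\<dots> = (\<Sum>i<n. \<xi> i \<omega> * (\<Sum>j<m. ?w (c i (Suc j)) - ?w (c i j)))
        - (\<Sum>i<n. \<Sum>j<m. \<eta> j \<omega> * (?w (c i (Suc j)) - ?w (c i j)))"
      by (rule sum_diff_mult)
    also have "(\<Sum>i<n. \<xi> i \<omega> * (\<Sum>j<m. ?w (c i (Suc j)) - ?w (c i j))) = simple_integral W n p \<xi> \<omega>"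
      unfolding simple_integral_def
      by (intro sum.cong refl) (simp add: c0 cm sum_lessThan_telescope[where f = "\<lambda>j. ?w (c _ j)"])
    also have "(\<Sum>i<n. \<Sum>j<m. \<eta> j \<omega> * (?w (c i (Suc j)) - ?w (c i j)))
      = (\<Sum>j<m. \<eta> j \<omega> * (\<Sum>i<n. ?w (c i (Suc j)) - ?w (c i j)))"
      by (subst sum.swap) (simp add: sum_distrib_left)
    also have "\<dots> = simple_integral W m q \<eta> \<omega>"
      unfolding simple_integral_def
    proof (intro sum.cong refl)
      fix j assume j: "j \<in> {..<m}"
      \<comment> \<open>Since \<open>p\<close> covers \<open>[a, b]\<close>, the pieces of one cell
        of \<open>q\<close> inside the cells of \<open>p\<close> add up to its whole
        increment.\<close>
      have "(\<Sum>i<n. ?w (c i (Suc j)) - ?w (c i j)) =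
        (\<Sum>i<n. ?w (c i (Suc j)) - ?w (p i)) - (\<Sum>i<n. ?w (c i j) - ?w (p i))"
        by (simp add: sum_subtractf[symmetric])
      also have "\<dots> = (?w (min (q (Suc j)) (p n)) - ?w (p 0)) - (?w (min (q j) (p n)) - ?w (p 0))"
        unfolding c_def using qa[of j] qa[of "Suc j"] j p
        by (intro arg_cong2[where f="(-)"] sum_clamp[where f = ?w]) auto
      also have "\<dots> = ?w (q (Suc j)) - ?w (q j)"
        using qa[of j] qa[of "Suc j"] j p by (simp add: min_def)
      finally show "\<eta> j \<omega> * (\<Sum>i<n. ?w (c i (Suc j)) - ?w (c i j)) = \<eta> j \<omega> * (?w (q (Suc j)) - ?w (q j))"
        by simp
    qed
    finally show ?thesis .
  qed
  then have "prob {\<omega> \<in> space M. \<bar>simple_integral W n p \<xi> \<omega> - simple_integral W m q \<eta> \<omega>\<bar> > \<epsilon>}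
    \<le> prob {\<omega> \<in> space M. (\<Sum>k<n * m. (\<zeta> k \<omega>)\<^sup>2 * (cc (Suc k) - cc k)) > \<delta>} + \<delta> / \<epsilon>\<^sup>2"
    using simple_integral_tail[of cc "n * m" \<zeta>, OF cc0 ccmono \<zeta> assms(10,11)] by simp
  also have "prob {\<omega> \<in> space M. (\<Sum>k<n * m. (\<zeta> k \<omega>)\<^sup>2 * (cc (Suc k) - cc k)) > \<delta>}
    \<le> prob {\<omega> \<in> space M. (\<integral>\<^sup>+s\<in>{a..b}. ennreal ((simple_process n p \<xi> s \<omega> - simple_process m q \<eta> s \<omega>)\<^sup>2) \<partial>lborel) > ennreal \<delta>}"
  proof (rule finite_measure_mono)
    show "{\<omega> \<in> space M. (\<Sum>k<n * m. (\<zeta> k \<omega>)\<^sup>2 * (cc (Suc k) - cc k)) > \<delta>}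
      \<subseteq> {\<omega> \<in> space M. (\<integral>\<^sup>+s\<in>{a..b}. ennreal ((simple_process n p \<xi> s \<omega> - simple_process m q \<eta> s \<omega>)\<^sup>2) \<partial>lborel) > ennreal \<delta>}"
    proof (safe)
      fix \<omega>
      let ?d = "\<lambda>s. ennreal ((simple_process n p \<xi> s \<omega> - simple_process m q \<eta> s \<omega>)\<^sup>2)"
      assume "(\<Sum>k<n * m. (\<zeta> k \<omega>)\<^sup>2 * (cc (Suc k) - cc k)) > \<delta>"
      then have "ennreal \<delta> < ennreal (\<Sum>k<n * m. (\<zeta> k \<omega>)\<^sup>2 * (cc (Suc k) - cc k))"
        using \<open>0 < \<delta>\<close> by (simp add: ennreal_less_iff)
      also have "\<dots> = (\<Sum>k<n * m. ennreal ((\<zeta> k \<omega>)\<^sup>2) * ennreal (cc (Suc k) - cc k))"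
        using ccmono by (subst sum_ennreal[symmetric]) (auto simp: ennreal_mult intro!: sum.cong)
      also have "\<dots> = (\<Sum>k<n * m. \<integral>\<^sup>+s. ennreal ((\<zeta> k \<omega>)\<^sup>2) * indicator {cc k<..cc (Suc k)} s \<partial>lborel)"
        using ccmono by (intro sum.cong refl) (simp add: nn_integral_cmult_indicator)
      also have "\<dots> = (\<Sum>k<n * m. \<integral>\<^sup>+s. ?d s * indicator {cc k<..cc (Suc k)} s \<partial>lborel)"
      proof (intro sum.cong refl nn_integral_cong)
        fix k s assume "k \<in> {..<n * m}"
        then have k: "k < n * m" by simp
        have "\<zeta> k \<omega> = simple_process n p \<xi> s \<omega> - simple_process m q \<eta> s \<omega>" if "cc k < s" "s \<le> cc (Suc k)"
        proof -
          note cl = cle[of "k div m" "k mod m"]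
          have "simple_process n p \<xi> s \<omega> = \<xi> (k div m) \<omega>"
            using that dm[OF k] cl ccS[OF k] by (intro simple_process_eq p) (auto simp: cc_def)
          moreover have "simple_process m q \<eta> s \<omega> = \<eta> (k mod m) \<omega>"
            using that dm[OF k] cl ccS[OF k] by (intro simple_process_eq q) (auto simp: cc_def)
          ultimately show ?thesis using that by (simp add: \<zeta>_def)
        qed
        then show "ennreal ((\<zeta> k \<omega>)\<^sup>2) * indicator {cc k<..cc (Suc k)} s = ?d s * indicator {cc k<..cc (Suc k)} s"
          by (auto split: split_indicator)
      qed
      also have "\<dots> = (\<integral>\<^sup>+s. (\<Sum>k<n * m. ?d s * indicator {cc k<..cc (Suc k)} s) \<partial>lborel)"
        unfolding simple_process_def by (rule nn_integral_sum[symmetric]) measurable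
      also have "\<dots> = (\<integral>\<^sup>+s. ?d s * indicator {cc 0<..cc (n * m)} s \<partial>lborel)"
        by (simp only: sum_distrib_left[symmetric] sum_indicator_steps[of "n * m" cc, OF ccmono])
      also have "\<dots> \<le> (\<integral>\<^sup>+s. ?d s * indicator {a..b} s \<partial>lborel)"
      proof (intro nn_integral_mono mult_left_mono)
        have "cc (n * m) \<le> b" using p q pa[of n] m by (auto simp: cc_def c_def)
        moreover have "a \<le> cc 0" using pa[of 0] by (auto simp: cc_def c_def)
        ultimately show "indicator {cc 0<..cc (n * m)} s \<le> (indicator {a..b} s :: ennreal)" for s
          by (auto split: split_indicator)
      qed simp
      finally show "ennreal \<delta> < (\<integral>\<^sup>+s. ?d s * indicator {a..b} s \<partial>lborel)" .
    qed
    have [measurable]: "\<And>i. i < n \<Longrightarrow> \<xi> i \<in> borel_measurable M" "\<And>i. i < m \<Longrightarrow> \<eta> i \<in> borel_measurable M"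
      using \<xi> \<eta> measurable_F_M by blast+
    have "(\<lambda>\<omega>. \<integral>\<^sup>+s\<in>{a..b}. ennreal ((simple_process n p \<xi> s \<omega> - simple_process m q \<eta> s \<omega>)\<^sup>2) \<partial>lborel) \<in> borel_measurable M"
      unfolding simple_process_def by measurable
    then show "{\<omega> \<in> space M. (\<integral>\<^sup>+s\<in>{a..b}. ennreal ((simple_process n p \<xi> s \<omega> - simple_process m q \<eta> s \<omega>)\<^sup>2) \<partial>lborel) > ennreal \<delta>} \<in> events"
      by measurable
  qed
  finally show ?thesis by simp
qed

end

section \<open>Ito integrals as limits of Riemann sums\<close>

text \<open>Time is rounded down to multiples of \<open>1 / Suc n\<close>: only countably many time
  sections are then involved, and continuity gives the limit.\<close>

lemma continuous_process_jointly_measurable: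
  fixes f :: "real \<Rightarrow> 'a \<Rightarrow> real"
  assumes "\<And>s. f s \<in> borel_measurable M" "\<And>\<omega>. \<omega> \<in> space M \<Longrightarrow> continuous_on UNIV (\<lambda>s. f s \<omega>)"
  shows "(\<lambda>(\<omega>, s). f s \<omega>) \<in> borel_measurable (M \<Otimes>\<^sub>M borel)"
proof (rule borel_measurable_LIMSEQ_real)
  show "(\<lambda>z. (case z of (\<omega>, s) \<Rightarrow> f (real_of_int \<lfloor>real (Suc n) * s\<rfloor> / real (Suc n)) \<omega>)) \<in> borel_measurable (M \<Otimes>\<^sub>M borel)" for n
  proof -
    have m: "(\<lambda>z. f (real_of_int i / real (Suc n)) (fst z)) \<in> borel_measurable (M \<Otimes>\<^sub>M (borel :: real measure))" for i
      by (rule measurable_compose[OF measurable_fst assms(1)])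
    have g: "(\<lambda>z. \<lfloor>real (Suc n) * snd z\<rfloor>) \<in> measurable (M \<Otimes>\<^sub>M borel) (count_space UNIV)"
      by measurable
    from measurable_compose_countable[of "\<lambda>i z. f (real_of_int i / real (Suc n)) (fst z)", OF m g]
    show ?thesis by (simp add: split_beta')
  qed
  fix z assume z: "z \<in> space (M \<Otimes>\<^sub>M (borel :: real measure))"
  obtain \<omega> s where [simp]: "z = (\<omega>, s)" by (cases z)
  have \<omega>: "\<omega> \<in> space M" using z by (simp add: space_pair_measure)
  have "(\<lambda>n. real_of_int \<lfloor>real (Suc n) * s\<rfloor> / real (Suc n)) \<longlonglongrightarrow> s"
  proof (rule real_tendsto_sandwich)
    show "\<forall>\<^sub>F n in sequentially. s - 1 / real (Suc n) \<le> real_of_int \<lfloor>real (Suc n) * s\<rfloor> / real (Suc n)"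
    proof (rule always_eventually, rule allI)
      fix n
      have "(real (Suc n) * s - 1) / real (Suc n) \<le> real_of_int \<lfloor>real (Suc n) * s\<rfloor> / real (Suc n)"
        by (intro divide_right_mono) linarith+
      then show "s - 1 / real (Suc n) \<le> real_of_int \<lfloor>real (Suc n) * s\<rfloor> / real (Suc n)"
        by (simp add: diff_divide_distrib del: of_nat_Suc)
    qed
    show "\<forall>\<^sub>F n in sequentially. real_of_int \<lfloor>real (Suc n) * s\<rfloor> / real (Suc n) \<le> s"
    proof (rule always_eventually, rule allI)
      fix n
      have "real_of_int \<lfloor>real (Suc n) * s\<rfloor> / real (Suc n) \<le> (real (Suc n) * s) / real (Suc n)"
        by (intro divide_right_mono) linarith+
      then show "real_of_int \<lfloor>real (Suc n) * s\<rfloor> / real (Suc n) \<le> s"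
        by (simp del: of_nat_Suc)
    qed
    have "(\<lambda>n. s - 1 / real (Suc n)) \<longlonglongrightarrow> s - 0"
      by (intro tendsto_intros) (use LIMSEQ_inverse_real_of_nat in \<open>simp add: inverse_eq_divide\<close>)
    then show "(\<lambda>n. s - 1 / real (Suc n)) \<longlonglongrightarrow> s" by simp
  qed auto
  then show "(\<lambda>n. case z of (\<omega>, s) \<Rightarrow> f (real_of_int \<lfloor>real (Suc n) * s\<rfloor> / real (Suc n)) \<omega>)
      \<longlonglongrightarrow> (case z of (\<omega>, s) \<Rightarrow> f s \<omega>)"
    using assms(2)[OF \<omega>] by (auto intro: continuous_on_tendsto_compose)
qed

lemma (in prob_space) nn_tail_tendsto_0:
  fixes D :: "nat \<Rightarrow> 'a \<Rightarrow> ennreal"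
  assumes [measurable]: "\<And>n. D n \<in> borel_measurable M"
    and lim: "\<And>\<omega>. \<omega> \<in> space M \<Longrightarrow> (\<lambda>n. D n \<omega>) \<longlonglongrightarrow> 0" and "0 < \<delta>"
  shows "(\<lambda>n. prob {\<omega> \<in> space M. D n \<omega> > ennreal \<delta>}) \<longlonglongrightarrow> 0"
proof -
  have "(\<lambda>n. expectation (indicator {\<omega> \<in> space M. D n \<omega> > ennreal \<delta>})) \<longlonglongrightarrow> expectation (\<lambda>_. 0 :: real)"
  proof (rule integral_dominated_convergence[where w="\<lambda>_. 1"])
    show "AE \<omega> in M. (\<lambda>n. indicator {\<omega> \<in> space M. D n \<omega> > ennreal \<delta>} \<omega>) \<longlonglongrightarrow> (0 :: real)"
    proof (rule AE_I2)
      fix \<omega> assume \<omega>: "\<omega> \<in> space M"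
      have "\<forall>\<^sub>F n in sequentially. D n \<omega> < ennreal \<delta>"
        using lim[OF \<omega>] \<open>0 < \<delta>\<close> by (intro order_tendstoD) auto
      then show "(\<lambda>n. indicator {\<omega> \<in> space M. D n \<omega> > ennreal \<delta>} \<omega>) \<longlonglongrightarrow> (0 :: real)"
        by (intro tendsto_eventually) (auto elim!: eventually_mono simp: indicator_def not_less)
    qed
  qed auto
  then show ?thesis by simp
qed

context bm
begin

text \<open>A cell of weight 0 is added at each end, so that the grid runs exactly from
  \<open>a\<close> to \<open>b\<close>, as the common refinement requires.\<close>

lemma simple_integrand_cover:
  assumes "simple_integrand M F a b n p \<xi>" "0 \<le> a" "a \<le> b"
  obtains n' p' \<xi>' where "p' 0 = a" "p' n' = b" "\<And>i. i < n' \<Longrightarrow> p' i \<le> p' (Suc i)"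
    "\<And>i. i < n' \<Longrightarrow> \<xi>' i \<in> borel_measurable (F (p' i))"
    "simple_process n' p' \<xi>' = simple_process n p \<xi>"
    "simple_integral W n' p' \<xi>' = simple_integral W n p \<xi>"
proof
  define p' where "p' i = (case i of 0 \<Rightarrow> a | Suc j \<Rightarrow> if j \<le> n then p j else b)" for i
  define \<xi>' where "\<xi>' i \<omega> = (case i of 0 \<Rightarrow> 0 | Suc j \<Rightarrow> if j < n then \<xi> j \<omega> else 0)" for i \<omega>
  show "p' 0 = a" "p' (Suc (Suc n)) = b" by (auto simp: p'_def)
  show "p' i \<le> p' (Suc i)" if "i < Suc (Suc n)" for i
    using assms(1) that by (cases i) (auto simp: p'_def simple_integrand_def less_Suc_eq)
  show "\<xi>' i \<in> borel_measurable (F (p' i))" if "i < Suc (Suc n)" for i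
  proof (cases i)
    case (Suc j)
    then show ?thesis using assms(1) that
      by (cases "j < n") (auto simp: p'_def \<xi>'_def[abs_def] simple_integrand_def)
  qed (simp add: \<xi>'_def[abs_def])
  have s: "(\<Sum>i<Suc (Suc n). f i) = f 0 + (\<Sum>i<n. f (Suc i)) + f (Suc n)" for f :: "nat \<Rightarrow> real"
    by (subst sum.lessThan_Suc, subst sum.lessThan_Suc_shift) simp
  show "simple_process (Suc (Suc n)) p' \<xi>' = simple_process n p \<xi>"
    unfolding simple_process_def s by (intro ext) (simp add: p'_def \<xi>'_def)
  show "simple_integral W (Suc (Suc n)) p' \<xi>' = simple_integral W n p \<xi>"
    unfolding simple_integral_def s by (intro ext) (simp add: p'_def \<xi>'_def)
qed

text \<open>The Ito integral is given only through some approximating sequence. The simple integral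
  is compared with the \<open>k\<close>-th approximation, and then \<open>k\<close> tends to
  infinity; what remains is the distance of the simple process from \<open>H\<close>.\<close>

lemma ito_simple_tail:
  assumes ito: "has_ito_integral M F W a b H I" and "0 \<le> a" "a \<le> b"
    and q: "q 0 = a" "q m = b" "\<And>j. j < m \<Longrightarrow> q j \<le> q (Suc j)"
    and \<eta>: "\<And>j. j < m \<Longrightarrow> \<eta> j \<in> borel_measurable (F (q j))"
    and H: "(\<lambda>(\<omega>, s). H s \<omega> * indicator {a..b} s) \<in> borel_measurable (M \<Otimes>\<^sub>M borel)"
    and "0 < \<epsilon>" "0 < \<delta>"
  shows "prob {\<omega> \<in> space M. \<bar>simple_integral W m q \<eta> \<omega> - I \<omega>\<bar> > 2 * \<epsilon>}
    \<le> prob {\<omega> \<in> space M. (\<integral>\<^sup>+s\<in>{a..b}. ennreal ((simple_process m q \<eta> s \<omega> - H s \<omega>)\<^sup>2) \<partial>lborel) > ennreal \<delta>}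
      + 4 * \<delta> / \<epsilon>\<^sup>2"
proof -
  obtain n p \<xi> where S: "\<And>k. simple_integrand M F a b (n k) (p k) (\<xi> k)"
    and E: "tendsto_in_prob0 M (\<lambda>k \<omega>. \<integral>\<^sup>+s\<in>{a..b}.
          ennreal ((simple_process (n k) (p k) (\<xi> k) s \<omega> - H s \<omega>)\<^sup>2) \<partial>lborel)"
    and L: "tendsto_in_prob0 M (\<lambda>k \<omega>. ennreal \<bar>simple_integral W (n k) (p k) (\<xi> k) \<omega> - I \<omega>\<bar>)"
    using ito unfolding has_ito_integral_def by blast
  let ?S = "\<lambda>k. simple_process (n k) (p k) (\<xi> k)" and ?R = "simple_process m q \<eta>"
  let ?A = "\<lambda>k. prob {\<omega> \<in> space M. (\<integral>\<^sup>+s\<in>{a..b}. ennreal ((?S k s \<omega> - H s \<omega>)\<^sup>2) \<partial>lborel) > ennreal \<delta>}"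
  let ?B = "\<lambda>k. prob {\<omega> \<in> space M. ennreal \<bar>simple_integral W (n k) (p k) (\<xi> k) \<omega> - I \<omega>\<bar> > ennreal \<epsilon>}"
  let ?C = "prob {\<omega> \<in> space M. (\<integral>\<^sup>+s\<in>{a..b}. ennreal ((?R s \<omega> - H s \<omega>)\<^sup>2) \<partial>lborel) > ennreal \<delta>}"
  have I[measurable]: "I \<in> borel_measurable M" using ito by (simp add: has_ito_integral_def)
  have \<eta>M[measurable]: "\<And>j. j < m \<Longrightarrow> \<eta> j \<in> borel_measurable M" using \<eta> measurable_F_M by blast
  have qa: "0 \<le> q j" if "j \<le> m" for j using steps_mono[of m q 0 j] q that \<open>0 \<le> a\<close> by auto
  have R[measurable]: "simple_integral W m q \<eta> \<in> borel_measurable M"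
    unfolding simple_integral_def[abs_def] using qa W_measurable_M by measurable
  have *: "(\<lambda>(\<omega>, s). (H s \<omega> * indicator {a..b} s)) \<in> borel_measurable (M \<Otimes>\<^sub>M lborel)"
    using H by (simp only: measurable_cong_sets[OF sets_pair_measure_cong[OF refl sets_lborel] refl])
  have dist_meas: "(\<lambda>\<omega>. \<integral>\<^sup>+s\<in>{a..b}. ennreal ((f s \<omega> - H s \<omega>)\<^sup>2) \<partial>lborel) \<in> borel_measurable M"
    if [measurable]: "(\<lambda>(\<omega>, s). f s \<omega>) \<in> borel_measurable (M \<Otimes>\<^sub>M lborel)" for f
  proof -
    define H' where "H' s \<omega> = H s \<omega> * indicator {a..b} s" for s \<omega>
    have [measurable]: "(\<lambda>(\<omega>, s). H' s \<omega>) \<in> borel_measurable (M \<Otimes>\<^sub>M lborel)"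
      unfolding H'_def by (rule *)
    have eq: "(\<integral>\<^sup>+s\<in>{a..b}. ennreal ((f s \<omega> - H s \<omega>)\<^sup>2) \<partial>lborel)
      = (\<integral>\<^sup>+s\<in>{a..b}. ennreal ((f s \<omega> - H' s \<omega>)\<^sup>2) \<partial>lborel)" for \<omega>
      by (intro nn_integral_cong) (auto simp: H'_def split: split_indicator)
    show ?thesis unfolding eq by measurable
  qed
  have bound: "prob {\<omega> \<in> space M. \<bar>simple_integral W m q \<eta> \<omega> - I \<omega>\<bar> > 2 * \<epsilon>} \<le> ?A k + ?C + 4 * \<delta> / \<epsilon>\<^sup>2 + ?B k" for k
  proof -
    obtain n' p' \<xi>' where c: "p' 0 = a" "p' n' = b" "\<And>i. i < n' \<Longrightarrow> p' i \<le> p' (Suc i)"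
      "\<And>i. i < n' \<Longrightarrow> \<xi>' i \<in> borel_measurable (F (p' i))"
      "simple_process n' p' \<xi>' = ?S k" "simple_integral W n' p' \<xi>' = simple_integral W (n k) (p k) (\<xi> k)"
      using simple_integrand_cover[OF S assms(2,3)] by metis
    have [measurable]: "\<And>i. i < n' \<Longrightarrow> \<xi>' i \<in> borel_measurable M" using c(4) measurable_F_M by blast
    have pa: "0 \<le> p' i" if "i \<le> n'" for i using steps_mono[of n' p' 0 i] c that \<open>0 \<le> a\<close> by auto
    have [measurable]: "simple_integral W n' p' \<xi>' \<in> borel_measurable M"
      unfolding simple_integral_def[abs_def] using pa W_measurable_M by measurable
    let ?d = "\<lambda>\<omega>. \<integral>\<^sup>+s\<in>{a..b}. ennreal ((simple_process n' p' \<xi>' s \<omega> - ?R s \<omega>)\<^sup>2) \<partial>lborel"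
    have dS[measurable]: "(\<lambda>\<omega>. \<integral>\<^sup>+s\<in>{a..b}. ennreal ((simple_process n' p' \<xi>' s \<omega> - H s \<omega>)\<^sup>2) \<partial>lborel) \<in> borel_measurable M"
      by (rule dist_meas) (unfold simple_process_def, measurable)
    have dR[measurable]: "(\<lambda>\<omega>. \<integral>\<^sup>+s\<in>{a..b}. ennreal ((?R s \<omega> - H s \<omega>)\<^sup>2) \<partial>lborel) \<in> borel_measurable M"
      by (rule dist_meas) (unfold simple_process_def, measurable)
    have "prob {\<omega> \<in> space M. \<bar>simple_integral W m q \<eta> \<omega> - I \<omega>\<bar> > 2 * \<epsilon>}
      \<le> prob ({\<omega> \<in> space M. \<bar>simple_integral W n' p' \<xi>' \<omega> - simple_integral W m q \<eta> \<omega>\<bar> > \<epsilon>}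
          \<union> {\<omega> \<in> space M. ennreal \<bar>simple_integral W n' p' \<xi>' \<omega> - I \<omega>\<bar> > ennreal \<epsilon>})"
      using \<open>0 < \<epsilon>\<close> by (intro finite_measure_mono) (auto simp: ennreal_less_iff)
    also have "\<dots> \<le> prob {\<omega> \<in> space M. \<bar>simple_integral W n' p' \<xi>' \<omega> - simple_integral W m q \<eta> \<omega>\<bar> > \<epsilon>} + ?B k"
      unfolding c(6)[symmetric] by (intro measure_Un_le) auto
    \<comment> \<open>The threshold is \<open>4 * \<delta>\<close> because
      \<open>(x - y)\<^sup>2 \<le> 2 * x\<^sup>2 + 2 * y\<^sup>2\<close>: if both distances to
      \<open>H\<close> are at most \<open>\<delta>\<close>, the mutual one is at most
      \<open>4 * \<delta>\<close>.\<close>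
    also have "prob {\<omega> \<in> space M. \<bar>simple_integral W n' p' \<xi>' \<omega> - simple_integral W m q \<eta> \<omega>\<bar> > \<epsilon>}
      \<le> prob {\<omega> \<in> space M. ?d \<omega> > ennreal (4 * \<delta>)} + 4 * \<delta> / \<epsilon>\<^sup>2"
      using \<open>0 < \<delta>\<close> by (intro simple_integral_diff_tail assms c) auto
    also have "prob {\<omega> \<in> space M. ?d \<omega> > ennreal (4 * \<delta>)}
      \<le> prob ({\<omega> \<in> space M. (\<integral>\<^sup>+s\<in>{a..b}. ennreal ((simple_process n' p' \<xi>' s \<omega> - H s \<omega>)\<^sup>2) \<partial>lborel) > ennreal \<delta>}
        \<union> {\<omega> \<in> space M. (\<integral>\<^sup>+s\<in>{a..b}. ennreal ((?R s \<omega> - H s \<omega>)\<^sup>2) \<partial>lborel) > ennreal \<delta>})"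
    proof (intro finite_measure_mono subsetI)
      fix \<omega> assume w: "\<omega> \<in> {\<omega> \<in> space M. ?d \<omega> > ennreal (4 * \<delta>)}"
      then have \<omega>: "\<omega> \<in> space M" by simp
      let ?x = "\<lambda>s. ennreal ((simple_process n' p' \<xi>' s \<omega> - H s \<omega>)\<^sup>2) * indicator {a..b} s"
        and ?y = "\<lambda>s. ennreal ((?R s \<omega> - H s \<omega>)\<^sup>2) * indicator {a..b} s"
      have Hm: "(\<lambda>s. H s \<omega> * indicator {a..b} s) \<in> borel_measurable borel"
        using measurable_Pair2[OF H \<omega>] by simp
      have xy[measurable]: "?x \<in> borel_measurable borel" "?y \<in> borel_measurable borel"
      proof -
        define h where "h s = H s \<omega> * indicator {a..b} s" for s
        have [measurable]: "h \<in> borel_measurable borel" using Hm by (simp add: h_def[abs_def])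
        have eq: "?x = (\<lambda>s. ennreal ((simple_process n' p' \<xi>' s \<omega> - h s)\<^sup>2) * indicator {a..b} s)"
          "?y = (\<lambda>s. ennreal ((?R s \<omega> - h s)\<^sup>2) * indicator {a..b} s)"
          by (auto simp: h_def split: split_indicator)
        show "?x \<in> borel_measurable borel" "?y \<in> borel_measurable borel"
          unfolding eq unfolding simple_process_def by measurable
      qed
      have "ennreal (4 * \<delta>) < ?d \<omega>" using w by simp
      also have "\<dots> \<le> (\<integral>\<^sup>+s. 2 * ?x s + 2 * ?y s \<partial>lborel)"
      proof (intro nn_integral_mono)
        fix s
        have "(simple_process n' p' \<xi>' s \<omega> - ?R s \<omega>)\<^sup>2
          \<le> 2 * (simple_process n' p' \<xi>' s \<omega> - H s \<omega>)\<^sup>2 + 2 * (?R s \<omega> - H s \<omega>)\<^sup>2"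
          using zero_le_power2[of "simple_process n' p' \<xi>' s \<omega> + ?R s \<omega> - 2 * H s \<omega>"]
          by (simp add: power2_eq_square algebra_simps)
        then have "ennreal ((simple_process n' p' \<xi>' s \<omega> - ?R s \<omega>)\<^sup>2)
          \<le> ennreal (2 * (simple_process n' p' \<xi>' s \<omega> - H s \<omega>)\<^sup>2 + 2 * (?R s \<omega> - H s \<omega>)\<^sup>2)"
          by (rule ennreal_leI)
        then show "ennreal ((simple_process n' p' \<xi>' s \<omega> - ?R s \<omega>)\<^sup>2) * indicator {a..b} s \<le> 2 * ?x s + 2 * ?y s"
          by (auto simp: ennreal_plus ennreal_mult split: split_indicator)
      qed
      also have "\<dots> = 2 * (\<integral>\<^sup>+s. ?x s \<partial>lborel) + 2 * (\<integral>\<^sup>+s. ?y s \<partial>lborel)"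
        by (subst nn_integral_add) (auto simp: nn_integral_cmult)
      finally have lt: "ennreal (4 * \<delta>) < 2 * (\<integral>\<^sup>+s. ?x s \<partial>lborel) + 2 * (\<integral>\<^sup>+s. ?y s \<partial>lborel)" .
      have "\<not> ((\<integral>\<^sup>+s. ?x s \<partial>lborel) \<le> ennreal \<delta> \<and> (\<integral>\<^sup>+s. ?y s \<partial>lborel) \<le> ennreal \<delta>)"
      proof
        assume "(\<integral>\<^sup>+s. ?x s \<partial>lborel) \<le> ennreal \<delta> \<and> (\<integral>\<^sup>+s. ?y s \<partial>lborel) \<le> ennreal \<delta>"
        then have "2 * (\<integral>\<^sup>+s. ?x s \<partial>lborel) + 2 * (\<integral>\<^sup>+s. ?y s \<partial>lborel) \<le> 2 * ennreal \<delta> + 2 * ennreal \<delta>"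
          by (intro add_mono mult_left_mono) auto
        also have "\<dots> = ennreal (4 * \<delta>)"
          using \<open>0 < \<delta>\<close> by (simp add: ennreal_mult flip: distrib_right)
        finally show False using lt by simp
      qed
      then show "\<omega> \<in> {\<omega> \<in> space M. (\<integral>\<^sup>+s\<in>{a..b}. ennreal ((simple_process n' p' \<xi>' s \<omega> - H s \<omega>)\<^sup>2) \<partial>lborel) > ennreal \<delta>}
        \<union> {\<omega> \<in> space M. (\<integral>\<^sup>+s\<in>{a..b}. ennreal ((?R s \<omega> - H s \<omega>)\<^sup>2) \<partial>lborel) > ennreal \<delta>}"
        using \<omega> by auto
    qed measurable
    also have "\<dots> \<le> ?A k + ?C"
      unfolding c(5)[symmetric] by (intro measure_Un_le) measurable
    finally show ?thesis by simp
  qed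
  have "(\<lambda>k. ?A k + ?C + 4 * \<delta> / \<epsilon>\<^sup>2 + ?B k) \<longlonglongrightarrow> 0 + ?C + 4 * \<delta> / \<epsilon>\<^sup>2 + 0"
    using E L \<open>0 < \<epsilon>\<close> \<open>0 < \<delta>\<close> unfolding tendsto_in_prob0_def by (intro tendsto_intros) auto
  then show ?thesis
    using bound by (intro LIMSEQ_le_const[where X="\<lambda>k. ?A k + ?C + 4 * \<delta> / \<epsilon>\<^sup>2 + ?B k"]) auto
qed

end

lemma simple_process_trunc:
  assumes "\<And>i. i < m \<Longrightarrow> p i \<le> p (Suc i)" "j \<le> m"
  shows "simple_process j p \<xi> s \<omega> = simple_process m p \<xi> s \<omega> * indicator {p 0..p j} s"
proof -
  have "simple_process m p \<xi> s \<omega> * indicator {p 0..p j} s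
      = (\<Sum>i<m. if i < j then \<xi> i \<omega> * indicator {p i<..p (Suc i)} s else 0)"
    unfolding simple_process_def sum_distrib_right
  proof (intro sum.cong refl)
    fix i assume i: "i \<in> {..<m}"
    show "\<xi> i \<omega> * indicator {p i<..p (Suc i)} s * indicator {p 0..p j} s
      = (if i < j then \<xi> i \<omega> * indicator {p i<..p (Suc i)} s else 0)"
    proof (cases "i < j")
      case True
      have "p 0 \<le> p i" by (rule steps_mono[of m p]) (use i in \<open>simp_all add: assms(1)\<close>)
      moreover have "p (Suc i) \<le> p j"
        by (rule steps_mono[of m p]) (use True assms(2) in \<open>simp_all add: assms(1)\<close>)
      ultimately show ?thesis using True by (auto split: split_indicator)
    next
      case False
      have "p j \<le> p i"
        by (rule steps_mono[of m p]) (use False i in \<open>simp_all add: assms(1)\<close>)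
      then show ?thesis using False by (auto split: split_indicator)
    qed
  qed
  also have "\<dots> = (\<Sum>i\<in>{..<m} \<inter> {..<j}. \<xi> i \<omega> * indicator {p i<..p (Suc i)} s)"
    by (simp add: sum.If_cases lessThan_def)
  also have "{..<m} \<inter> {..<j} = {..<j}" using assms(2) by auto
  finally show ?thesis by (simp add: simple_process_def)
qed

lemma has_bochner_integral_simple_process:
  assumes "\<And>i. i < m \<Longrightarrow> p i \<le> p (Suc i)"
  shows "has_bochner_integral lborel (\<lambda>s. simple_process m p \<xi> s \<omega>) (\<Sum>i<m. \<xi> i \<omega> * (p (Suc i) - p i))"
  unfolding simple_process_def
proof (intro has_bochner_integral_sum)
  fix i assume "i \<in> {..<m}"
  then have "p i \<le> p (Suc i)" using assms by simp
  then have "has_bochner_integral lborel (indicator {p i<..p (Suc i)}) (p (Suc i) - p i)"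
    using has_bochner_integral_real_indicator[of "{p i<..p (Suc i)}" lborel] by simp
  then show "has_bochner_integral lborel (\<lambda>s. \<xi> i \<omega> * indicator {p i<..p (Suc i)} s) (\<xi> i \<omega> * (p (Suc i) - p i))"
    by (rule has_bochner_integral_mult_right)
qed

lemma continuous_on_clamp:
  fixes f :: "real \<Rightarrow> real"
  assumes "continuous_on {t..u} f" "t \<le> u"
  shows "continuous_on UNIV (\<lambda>s. f (max t (min u s)))"
  using assms by (intro continuous_on_compose2[OF assms(1)] continuous_intros) auto

section \<open>Riemann sums of the price equation\<close>

text \<open>The grids may be uneven, so that a prescribed time between \<open>t\<close> and
  \<open>u\<close> can be a point of each of them. The volatility is continuous up to the end
  \<open>u\<close>; for \<open>vol\<close> this is ensured by \<open>u < T\<close>.\<close>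

locale gbm_grid = bm M F W
  for M :: "'a measure" and F :: "real \<Rightarrow> 'a measure" and W :: "real \<Rightarrow> 'a \<Rightarrow> real" +
  fixes r x t u :: real and \<sigma> :: "real \<Rightarrow> real" and X :: "real \<Rightarrow> 'a \<Rightarrow> real"
    and m :: "nat \<Rightarrow> nat" and g :: "nat \<Rightarrow> nat \<Rightarrow> real" and \<delta> :: "nat \<Rightarrow> real"
  assumes t0: "0 \<le> t" and tu: "t \<le> u" and r0: "0 < r" and x0: "0 < x"
    and \<sigma>_cont: "continuous_on {t..u} \<sigma>"
    and X_adapted: "s \<in> {t..u} \<Longrightarrow> X s \<in> borel_measurable (F s)"
    and X_cont: "\<omega> \<in> space M \<Longrightarrow> continuous_on {t..u} (\<lambda>s. X s \<omega>)"
    and X_sde: "s \<in> {t..u} \<Longrightarrow> \<exists>I. has_ito_integral M F W t s (\<lambda>s \<omega>. \<sigma> s * X s \<omega>) I \<and>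
      (AE \<omega> in M. set_integrable lborel {t..s} (\<lambda>v. r * X v \<omega>) \<and>
        X s \<omega> = x + (LINT v:{t..s}|lborel. r * X v \<omega>) + I \<omega>)"
    and g_0: "g n 0 = t" and g_m: "g n (m n) = u"
    and g_step: "i < m n \<Longrightarrow> g n i \<le> g n (Suc i)"
    and g_mesh: "i < m n \<Longrightarrow> g n (Suc i) - g n i \<le> \<delta> n"
    and \<delta>_lim: "\<delta> \<longlonglongrightarrow> 0"
begin

lemma g_mono: "i \<le> j \<Longrightarrow> j \<le> m n \<Longrightarrow> g n i \<le> g n j"
  by (rule steps_mono[of "m n"]) (auto intro: g_step)

lemma g_in: "i \<le> m n \<Longrightarrow> g n i \<in> {t..u}"
  using g_mono[of 0 i n] g_mono[of i "m n" n] by (simp add: g_0 g_m)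

lemma g_nonneg: "i \<le> m n \<Longrightarrow> 0 \<le> g n i"
  using g_in[of i n] t0 by auto

lemma X_M: "s \<in> {t..u} \<Longrightarrow> X s \<in> borel_measurable M"
  using X_adapted measurable_F_M by blast

lemma X_joint:
  assumes f: "continuous_on {t..u} f" and "s \<le> u"
  shows "(\<lambda>(\<omega>, v). f v * X v \<omega> * indicator {t..s} v) \<in> borel_measurable (M \<Otimes>\<^sub>M borel)"
proof -
  let ?c = "\<lambda>v. max t (min u v)"
  have 1: "(\<lambda>(\<omega>, v). f (?c v) * X (?c v) \<omega>) \<in> borel_measurable (M \<Otimes>\<^sub>M borel)"
  proof (rule continuous_process_jointly_measurable)
    show "(\<lambda>\<omega>. f (?c v) * X (?c v) \<omega>) \<in> borel_measurable M" for v
      using tu by (intro borel_measurable_times X_M) auto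
    show "continuous_on UNIV (\<lambda>v. f (?c v) * X (?c v) \<omega>)" if "\<omega> \<in> space M" for \<omega>
      using continuous_on_clamp[OF f tu] continuous_on_clamp[OF X_cont[OF that] tu]
      by (rule continuous_on_mult)
  qed
  have "(\<lambda>z. (case z of (\<omega>, v) \<Rightarrow> f (?c v) * X (?c v) \<omega>) * indicator {t..s} (snd z))
    \<in> borel_measurable (M \<Otimes>\<^sub>M borel)"
    by (intro borel_measurable_times 1) measurable
  also have "(\<lambda>z. (case z of (\<omega>, v) \<Rightarrow> f (?c v) * X (?c v) \<omega>) * indicator {t..s} (snd z))
    = (\<lambda>(\<omega>, v). f v * X v \<omega> * indicator {t..s} v)"
    using assms(2) by (auto simp: fun_eq_iff max_absorb2 min_absorb2 split: split_indicator)
  finally show ?thesis .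
qed

definition left_sum :: "(real \<Rightarrow> real) \<Rightarrow> nat \<Rightarrow> real \<Rightarrow> 'a \<Rightarrow> real" where
  "left_sum f n = simple_process (m n) (g n) (\<lambda>i \<omega>. f (g n i) * X (g n i) \<omega>)"

text \<open>Uniform continuity of a single path. The start \<open>t\<close> is excluded because the
  cells are open on the left, so the step process vanishes there.\<close>

lemma left_sum_close:
  assumes f: "continuous_on {t..u} f" and \<omega>: "\<omega> \<in> space M" and "0 < \<theta>"
  shows "\<forall>\<^sub>F n in sequentially. \<forall>s\<in>{t<..u}. \<bar>left_sum f n s \<omega> - f s * X s \<omega>\<bar> \<le> \<theta>"
proof -
  have "uniformly_continuous_on {t..u} (\<lambda>s. f s * X s \<omega>)"
    using f X_cont[OF \<omega>] by (intro compact_uniformly_continuous continuous_on_mult) auto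
  then obtain d where d: "0 < d"
    "\<And>s s'. s \<in> {t..u} \<Longrightarrow> s' \<in> {t..u} \<Longrightarrow> dist s' s < d \<Longrightarrow> dist (f s' * X s' \<omega>) (f s * X s \<omega>) < \<theta>"
    using \<open>0 < \<theta>\<close> unfolding uniformly_continuous_on_def by metis
  have "\<forall>\<^sub>F n in sequentially. \<delta> n < d" using \<delta>_lim d(1) by (intro order_tendstoD) auto
  then show ?thesis
  proof eventually_elim
    fix n assume n: "\<delta> n < d"
    show "\<forall>s\<in>{t<..u}. \<bar>left_sum f n s \<omega> - f s * X s \<omega>\<bar> \<le> \<theta>"
    proof
      fix s assume s: "s \<in> {t<..u}"
      have "(\<Sum>i<m n. indicator {g n i<..g n (Suc i)} s) = (1 :: ennreal)"
        using s sum_indicator_steps[of "m n" "g n" s] g_step by (simp add: g_0 g_m)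
      then have "\<exists>i<m n. indicator {g n i<..g n (Suc i)} s \<noteq> (0 :: ennreal)"
        by (metis (no_types, lifting) lessThan_iff sum.not_neutral_contains_not_neutral zero_neq_one)
      then obtain i where i: "i < m n" "g n i < s" "s \<le> g n (Suc i)" by (auto split: split_indicator_asm)
      have "left_sum f n s \<omega> = f (g n i) * X (g n i) \<omega>"
        unfolding left_sum_def using i by (intro simple_process_eq g_step)
      moreover have "dist (g n i) s < d"
        using i g_mesh[of i n] n by (simp add: dist_real_def)
      ultimately show "\<bar>left_sum f n s \<omega> - f s * X s \<omega>\<bar> \<le> \<theta>"
        using d(2)[of s "g n i"] s g_in[of i n] i by (simp add: dist_real_def)
    qed
  qed
qed

lemma left_sum_dist_measurable:
  assumes f: "continuous_on {t..u} f"
  shows "(\<lambda>\<omega>. \<integral>\<^sup>+s\<in>{t..u}. ennreal (\<bar>left_sum f n s \<omega> - f s * X s \<omega>\<bar> ^ k) \<partial>lborel) \<in> borel_measurable M"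
proof -
  define Y where "Y s \<omega> = f s * X s \<omega> * indicator {t..u} s" for s \<omega>
  have [measurable]: "(\<lambda>(\<omega>, s). Y s \<omega>) \<in> borel_measurable (M \<Otimes>\<^sub>M lborel)"
    using X_joint[OF f order_refl] unfolding Y_def
    by (simp only: measurable_cong_sets[OF sets_pair_measure_cong[OF refl sets_lborel] refl])
  have [measurable]: "X (g n i) \<in> borel_measurable M" if "i < m n" for i
    using that g_in[of i n] by (intro X_M) auto
  have eq: "(\<integral>\<^sup>+s\<in>{t..u}. ennreal (\<bar>left_sum f n s \<omega> - f s * X s \<omega>\<bar> ^ k) \<partial>lborel)
    = (\<integral>\<^sup>+s\<in>{t..u}. ennreal (\<bar>left_sum f n s \<omega> - Y s \<omega>\<bar> ^ k) \<partial>lborel)" for \<omega>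
    by (intro nn_integral_cong) (auto simp: Y_def split: split_indicator)
  show ?thesis unfolding eq unfolding left_sum_def simple_process_def by measurable
qed

text \<open>Exponent 1 serves the drift, exponent 2 the stochastic integral.\<close>

lemma left_sum_dist_tendsto_0:
  assumes f: "continuous_on {t..u} f" and "0 < k" "0 < \<epsilon>"
  shows "(\<lambda>n. prob {\<omega> \<in> space M. (\<integral>\<^sup>+s\<in>{t..u}. ennreal (\<bar>left_sum f n s \<omega> - f s * X s \<omega>\<bar> ^ k) \<partial>lborel) > ennreal \<epsilon>}) \<longlonglongrightarrow> 0"
proof (rule nn_tail_tendsto_0[OF left_sum_dist_measurable[OF f] _ assms(3)])
  fix \<omega> assume \<omega>: "\<omega> \<in> space M"
  show "(\<lambda>n. \<integral>\<^sup>+s\<in>{t..u}. ennreal (\<bar>left_sum f n s \<omega> - f s * X s \<omega>\<bar> ^ k) \<partial>lborel) \<longlonglongrightarrow> 0"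
  proof (rule tendsto_zero_ennreal)
    fix e :: real assume e: "0 < e"
    define c where "c = u - t + 1"
    have c: "0 < c" "u - t \<le> c" using tu by (auto simp: c_def)
    \<comment> \<open>The bound by 1 makes every positive power of \<open>\<theta>\<close> at most
      \<open>\<theta>\<close>, whatever \<open>k\<close> is.\<close>
    define \<theta> where "\<theta> = min 1 (e / (2 * c))"
    have \<theta>: "0 < \<theta>" "\<theta> \<le> 1" "\<theta> * (u - t) < e"
    proof -
      have "\<theta> * (u - t) \<le> e / (2 * c) * c"
        using tu e c by (intro mult_mono) (auto simp: \<theta>_def)
      also have "\<dots> = e / 2" using c by simp
      also have "\<dots> < e" using e by simp
      finally show "\<theta> * (u - t) < e" .
    qed (use e c in \<open>auto simp: \<theta>_def\<close>)
    show "\<forall>\<^sub>F n in sequentially. (\<integral>\<^sup>+s\<in>{t..u}. ennreal (\<bar>left_sum f n s \<omega> - f s * X s \<omega>\<bar> ^ k) \<partial>lborel) < ennreal e"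
      using left_sum_close[OF f \<omega> \<theta>(1)]
    proof eventually_elim
      fix n assume n: "\<forall>s\<in>{t<..u}. \<bar>left_sum f n s \<omega> - f s * X s \<omega>\<bar> \<le> \<theta>"
      have "(\<integral>\<^sup>+s\<in>{t..u}. ennreal (\<bar>left_sum f n s \<omega> - f s * X s \<omega>\<bar> ^ k) \<partial>lborel)
        \<le> (\<integral>\<^sup>+s. ennreal \<theta> * indicator {t..u} s \<partial>lborel)"
      proof (intro nn_integral_mono_AE, use AE_lborel_singleton[of t] in eventually_elim)
        fix s assume "s \<noteq> t"
        have "\<bar>left_sum f n s \<omega> - f s * X s \<omega>\<bar> ^ k \<le> \<theta>" if "s \<in> {t..u}"
        proof -
          have "\<bar>left_sum f n s \<omega> - f s * X s \<omega>\<bar> ^ k \<le> \<theta> ^ k"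
            using n that \<open>s \<noteq> t\<close> by (intro power_mono) auto
          also have "\<dots> \<le> \<theta> ^ 1" using \<theta> assms(2) by (intro power_decreasing) auto
          finally show ?thesis by simp
        qed
        then show "ennreal (\<bar>left_sum f n s \<omega> - f s * X s \<omega>\<bar> ^ k) * indicator {t..u} s \<le> ennreal \<theta> * indicator {t..u} s"
          by (auto split: split_indicator intro: ennreal_leI)
      qed
      also have "\<dots> = ennreal (\<theta> * (u - t))"
        using tu \<theta> by (simp add: nn_integral_cmult_indicator ennreal_mult)
      also have "\<dots> < ennreal e" using \<theta>(3) e tu \<theta>(1) by (subst ennreal_less_iff) auto
      finally show "(\<integral>\<^sup>+s\<in>{t..u}. ennreal (\<bar>left_sum f n s \<omega> - f s * X s \<omega>\<bar> ^ k) \<partial>lborel) < ennreal e" .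
    qed
  qed
qed

text \<open>Not a recursive scheme: the coefficients are the true prices, so this is a Riemann sum
  for the right side of the equation.\<close>

definition euler :: "nat \<Rightarrow> nat \<Rightarrow> 'a \<Rightarrow> real" where
  "euler n j \<omega> = x + (\<Sum>i<j. X (g n i) \<omega> * (r * (g n (Suc i) - g n i)
      + \<sigma> (g n i) * (W (g n (Suc i)) \<omega> - W (g n i) \<omega>)))"

text \<open>The Riemann sum is the time integral of the step process cut at \<open>g n j\<close>, so
  the error is bounded by the mean distance over the whole interval.\<close>

lemma drift_error:
  assumes "j \<le> m n" and int: "set_integrable lborel {t..g n j} (\<lambda>v. r * X v \<omega>)" and \<omega>: "\<omega> \<in> space M"
  shows "ennreal \<bar>(LINT v:{t..g n j}|lborel. r * X v \<omega>) - (\<Sum>i<j. X (g n i) \<omega> * (r * (g n (Suc i) - g n i)))\<bar>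
    \<le> (\<integral>\<^sup>+s\<in>{t..u}. ennreal (\<bar>left_sum (\<lambda>_. r) n s \<omega> - r * X s \<omega>\<bar> ^ 1) \<partial>lborel)"
proof -
  let ?p = "\<lambda>s. simple_process j (g n) (\<lambda>i \<omega>. r * X (g n i) \<omega>) s \<omega>"
  let ?q = "\<lambda>s. indicator {t..g n j} s * (r * X s \<omega>)"
  have hb: "has_bochner_integral lborel ?p (\<Sum>i<j. r * X (g n i) \<omega> * (g n (Suc i) - g n i))"
    by (rule has_bochner_integral_simple_process) (use assms(1) g_step in auto)
  have iq: "integrable lborel ?q" using int by (simp add: set_integrable_def)
  have e: "(LINT v:{t..g n j}|lborel. r * X v \<omega>) - (\<Sum>i<j. X (g n i) \<omega> * (r * (g n (Suc i) - g n i)))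
    = (LINT s|lborel. ?q s - ?p s)"
    using hb iq by (simp add: has_bochner_integral_iff set_lebesgue_integral_def mult_ac)
  have "ennreal \<bar>LINT s|lborel. ?q s - ?p s\<bar> \<le> (\<integral>\<^sup>+s. ennreal (norm (?q s - ?p s)) \<partial>lborel)"
    using hb iq integral_norm_bound_ennreal[of lborel "\<lambda>s. ?q s - ?p s"] by (simp add: has_bochner_integral_iff)
  also have "\<dots> \<le> (\<integral>\<^sup>+s\<in>{t..u}. ennreal (\<bar>left_sum (\<lambda>_. r) n s \<omega> - r * X s \<omega>\<bar> ^ 1) \<partial>lborel)"
  proof (intro nn_integral_mono)
    fix s
    have "?p s = left_sum (\<lambda>_. r) n s \<omega> * indicator {t..g n j} s"
      unfolding left_sum_def using simple_process_trunc[of "m n" "g n" j] g_step assms(1) by (simp add: g_0)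
    then show "ennreal (norm (?q s - ?p s)) \<le> ennreal (\<bar>left_sum (\<lambda>_. r) n s \<omega> - r * X s \<omega>\<bar> ^ 1) * indicator {t..u} s"
      using g_in[OF assms(1)] by (auto simp: abs_minus_commute split: split_indicator)
  qed
  finally show ?thesis unfolding e .
qed

text \<open>Uniformity in \<open>j\<close> costs nothing, since the errors up to
  \<open>g n j\<close> are dominated by integrals over the whole of \<open>[t, u]\<close>.\<close>

lemma euler_error:
  assumes "0 < \<epsilon>" "0 < \<kappa>"
  shows "\<forall>\<^sub>F n in sequentially. \<forall>j\<le>m n. prob {\<omega> \<in> space M. \<bar>X (g n j) \<omega> - euler n j \<omega>\<bar> > \<epsilon>} \<le> \<kappa>"
proof -
  \<comment> \<open>\<open>\<kappa>\<close> is split into thirds: for the drift, for the mean-square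
    distance, and for the constant \<open>4 * d / (\<epsilon> / 4)\<^sup>2\<close> from
    \<open>ito_simple_tail\<close>.\<close>
  define d where "d = \<kappa> * (\<epsilon> / 4)\<^sup>2 / 12"
  have d: "0 < d" "4 * d / (\<epsilon> / 4)\<^sup>2 = \<kappa> / 3" using assms by (auto simp: d_def field_simps)
  let ?A = "\<lambda>n. prob {\<omega> \<in> space M. (\<integral>\<^sup>+s\<in>{t..u}. ennreal (\<bar>left_sum (\<lambda>_. r) n s \<omega> - r * X s \<omega>\<bar> ^ 1) \<partial>lborel) > ennreal (\<epsilon> / 2)}"
  let ?B = "\<lambda>n. prob {\<omega> \<in> space M. (\<integral>\<^sup>+s\<in>{t..u}. ennreal (\<bar>left_sum \<sigma> n s \<omega> - \<sigma> s * X s \<omega>\<bar> ^ 2) \<partial>lborel) > ennreal d}"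
  have "\<forall>\<^sub>F n in sequentially. ?A n < \<kappa> / 3" "\<forall>\<^sub>F n in sequentially. ?B n < \<kappa> / 3"
    using assms d(1) order_tendstoD(2)[OF left_sum_dist_tendsto_0[of "\<lambda>_. r" 1 "\<epsilon> / 2"], of "\<kappa> / 3"]
      order_tendstoD(2)[OF left_sum_dist_tendsto_0[of \<sigma> 2 d], of "\<kappa> / 3"] \<sigma>_cont by (simp_all del: power_one_right power2_abs)
  then show ?thesis
  proof eventually_elim
    fix n assume A: "?A n < \<kappa> / 3" and B: "?B n < \<kappa> / 3"
    show "\<forall>j\<le>m n. prob {\<omega> \<in> space M. \<bar>X (g n j) \<omega> - euler n j \<omega>\<bar> > \<epsilon>} \<le> \<kappa>"
    proof (intro allI impI)
      fix j assume j: "j \<le> m n"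
      let ?\<eta> = "\<lambda>i \<omega>. \<sigma> (g n i) * X (g n i) \<omega>"
      obtain I where I: "has_ito_integral M F W t (g n j) (\<lambda>s \<omega>. \<sigma> s * X s \<omega>) I"
        and XI: "AE \<omega> in M. set_integrable lborel {t..g n j} (\<lambda>v. r * X v \<omega>) \<and>
          X (g n j) \<omega> = x + (LINT v:{t..g n j}|lborel. r * X v \<omega>) + I \<omega>"
        using X_sde[OF g_in[OF j]] by auto
      have [measurable]: "I \<in> borel_measurable M" using I by (simp add: has_ito_integral_def)
      have Xm[measurable]: "X (g n i) \<in> borel_measurable M" "W (g n i) \<in> borel_measurable M" if "i \<le> j" for i
        using that j g_in[of i n] g_nonneg[of i n] by (auto intro!: X_M W_measurable_M)
      have [measurable]: "simple_integral W j (g n) ?\<eta> \<in> borel_measurable M"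
        unfolding simple_integral_def by (intro borel_measurable_sum borel_measurable_times borel_measurable_diff Xm) auto
      note [measurable] = left_sum_dist_measurable[OF continuous_on_const] left_sum_dist_measurable[OF \<sigma>_cont]
      have euler: "euler n j \<omega> = x + (\<Sum>i<j. X (g n i) \<omega> * (r * (g n (Suc i) - g n i))) + simple_integral W j (g n) ?\<eta> \<omega>" for \<omega>
        by (simp add: euler_def simple_integral_def sum.distrib distrib_left mult_ac)
      let ?E1 = "{\<omega> \<in> space M. (\<integral>\<^sup>+s\<in>{t..u}. ennreal (\<bar>left_sum (\<lambda>_. r) n s \<omega> - r * X s \<omega>\<bar> ^ 1) \<partial>lborel) > ennreal (\<epsilon> / 2)}"
        and ?E2 = "{\<omega> \<in> space M. \<bar>simple_integral W j (g n) ?\<eta> \<omega> - I \<omega>\<bar> > 2 * (\<epsilon> / 4)}"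
      have "prob {\<omega> \<in> space M. \<bar>X (g n j) \<omega> - euler n j \<omega>\<bar> > \<epsilon>} \<le> prob (?E1 \<union> ?E2)"
      proof (rule finite_measure_mono_AE)
        show "AE \<omega> in M. \<omega> \<in> {\<omega> \<in> space M. \<bar>X (g n j) \<omega> - euler n j \<omega>\<bar> > \<epsilon>} \<longrightarrow> \<omega> \<in> ?E1 \<union> ?E2"
          using XI
        proof eventually_elim
          case (elim \<omega>)
          have False if \<omega>: "\<omega> \<in> space M" "\<bar>X (g n j) \<omega> - euler n j \<omega>\<bar> > \<epsilon>" "\<omega> \<notin> ?E1" "\<omega> \<notin> ?E2"
          proof -
            have "ennreal \<bar>(LINT v:{t..g n j}|lborel. r * X v \<omega>) - (\<Sum>i<j. X (g n i) \<omega> * (r * (g n (Suc i) - g n i)))\<bar> \<le> ennreal (\<epsilon> / 2)"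
              using \<omega>(1,3) by (intro order_trans[OF drift_error[OF j _ \<omega>(1)]]) (use elim in auto)
            then have "\<bar>(LINT v:{t..g n j}|lborel. r * X v \<omega>) - (\<Sum>i<j. X (g n i) \<omega> * (r * (g n (Suc i) - g n i)))\<bar> \<le> \<epsilon> / 2"
              using assms(1) by (subst (asm) ennreal_le_iff) auto
            moreover have "\<bar>simple_integral W j (g n) ?\<eta> \<omega> - I \<omega>\<bar> \<le> \<epsilon> / 2" using \<omega>(1,4) by simp
            ultimately show False using \<omega>(2) elim unfolding euler by linarith
          qed
          then show ?case by blast
        qed
      qed measurable
      also have "\<dots> \<le> prob ?E1 + prob ?E2" by (intro measure_Un_le) measurable
      also have "prob ?E2 \<le> prob {\<omega> \<in> space M. (\<integral>\<^sup>+s\<in>{t..g n j}. ennreal ((simple_process j (g n) ?\<eta> s \<omega> - \<sigma> s * X s \<omega>)\<^sup>2) \<partial>lborel) > ennreal d}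
        + 4 * d / (\<epsilon> / 4)\<^sup>2"
        using j g_in[OF j] assms d(1) t0
      proof (intro ito_simple_tail[OF I])
        fix i assume "i < j"
        then show "?\<eta> i \<in> borel_measurable (F (g n i))" "g n i \<le> g n (Suc i)"
          using g_in[of i n] j g_step[of i n] by (auto intro!: borel_measurable_times X_adapted)
      qed (auto simp: g_0 intro: X_joint[OF \<sigma>_cont])
      also have "prob {\<omega> \<in> space M. (\<integral>\<^sup>+s\<in>{t..g n j}. ennreal ((simple_process j (g n) ?\<eta> s \<omega> - \<sigma> s * X s \<omega>)\<^sup>2) \<partial>lborel) > ennreal d} \<le> ?B n"
      proof (intro finite_measure_mono subsetI)
        fix \<omega> assume "\<omega> \<in> {\<omega> \<in> space M. (\<integral>\<^sup>+s\<in>{t..g n j}. ennreal ((simple_process j (g n) ?\<eta> s \<omega> - \<sigma> s * X s \<omega>)\<^sup>2) \<partial>lborel) > ennreal d}"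
        then have "\<omega> \<in> space M" "ennreal d < (\<integral>\<^sup>+s\<in>{t..g n j}. ennreal ((simple_process j (g n) ?\<eta> s \<omega> - \<sigma> s * X s \<omega>)\<^sup>2) \<partial>lborel)" by auto
        note this(2)
        also have "(\<integral>\<^sup>+s\<in>{t..g n j}. ennreal ((simple_process j (g n) ?\<eta> s \<omega> - \<sigma> s * X s \<omega>)\<^sup>2) \<partial>lborel)
          \<le> (\<integral>\<^sup>+s\<in>{t..u}. ennreal (\<bar>left_sum \<sigma> n s \<omega> - \<sigma> s * X s \<omega>\<bar> ^ 2) \<partial>lborel)"
        proof (intro nn_integral_mono)
          fix s
          have "simple_process j (g n) ?\<eta> s \<omega> = left_sum \<sigma> n s \<omega> * indicator {t..g n j} s"
            unfolding left_sum_def using simple_process_trunc[of "m n" "g n" j] g_step j by (simp add: g_0)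
          then show "ennreal ((simple_process j (g n) ?\<eta> s \<omega> - \<sigma> s * X s \<omega>)\<^sup>2) * indicator {t..g n j} s
            \<le> ennreal (\<bar>left_sum \<sigma> n s \<omega> - \<sigma> s * X s \<omega>\<bar> ^ 2) * indicator {t..u} s"
            using g_in[OF j] by (auto split: split_indicator)
        qed
        finally show "\<omega> \<in> {\<omega> \<in> space M. (\<integral>\<^sup>+s\<in>{t..u}. ennreal (\<bar>left_sum \<sigma> n s \<omega> - \<sigma> s * X s \<omega>\<bar> ^ 2) \<partial>lborel) > ennreal d}"
          using \<open>\<omega> \<in> space M\<close> by simp
      qed measurable
      finally show "prob {\<omega> \<in> space M. \<bar>X (g n j) \<omega> - euler n j \<omega>\<bar> > \<epsilon>} \<le> \<kappa>"
        using A B d(2) by linarith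
    qed
  qed
qed

end

section \<open>The law of the price\<close>

lemma stdn_affine:
  "integrable stdn (\<lambda>y. a + b * y)" "(LINT y|stdn. a + b * y) = a"
  "integrable stdn (\<lambda>y. (a + b * y)\<^sup>2)" "(LINT y|stdn. (a + b * y)\<^sup>2) = a\<^sup>2 + b\<^sup>2"
proof -
  have e: "(a + b * y)\<^sup>2 = a\<^sup>2 + (2 * a * b * y + b\<^sup>2 * y\<^sup>2)" for y
    by (simp add: power2_eq_square algebra_simps)
  note [simp] = stdn_moments stdn.prob_space[simplified]
  show "integrable stdn (\<lambda>y. a + b * y)" "(LINT y|stdn. a + b * y) = a"
    "integrable stdn (\<lambda>y. (a + b * y)\<^sup>2)" "(LINT y|stdn. (a + b * y)\<^sup>2) = a\<^sup>2 + b\<^sup>2"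
    unfolding e by simp_all
qed

lemma stdn_exp_affine:
  "integrable stdn (\<lambda>y. exp (a - b\<^sup>2 / 2 + b * y))" "(LINT y|stdn. exp (a - b\<^sup>2 / 2 + b * y)) = exp a"
proof -
  have e: "exp (a - b\<^sup>2 / 2 + b * y) = exp (a - b\<^sup>2 / 2) * exp (b * y)" for y by (rule exp_add)
  show "integrable stdn (\<lambda>y. exp (a - b\<^sup>2 / 2 + b * y))" unfolding e by (intro integrable_mult_right stdn_exp)
  show "(LINT y|stdn. exp (a - b\<^sup>2 / 2 + b * y)) = exp a"
    unfolding e by (simp only: integral_mult_right_zero stdn_exp) (simp flip: exp_add)
qed

text \<open>One step of the exponential scheme minus one Euler step, relative to the current value,
  with \<open>a = r * D\<close> and \<open>b = \<sigma> * sqrt D\<close> for a step of length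
  \<open>D\<close>.\<close>

definition exp_rem :: "real \<Rightarrow> real \<Rightarrow> real \<Rightarrow> real" where
  "exp_rem a b y = exp (a - b\<^sup>2 / 2 + b * y) - 1 - (a + b * y)"

lemma stdn_exp_rem: "integrable stdn (exp_rem a b)" "(LINT y|stdn. exp_rem a b y) = exp a - 1 - a"
  unfolding exp_rem_def[abs_def]
  by (simp_all add: stdn_affine stdn_exp_affine stdn.prob_space[simplified])

text \<open>The bound is quadratic in the step length, so the remainders still vanish with the mesh
  when summed over all steps. The moment is computed exactly;
  \<open>exp x \<le> 1 + x + x\<^sup>2\<close> and \<open>1 + a \<le> exp a\<close> then make all
  terms of first order cancel.\<close>

lemma stdn_exp_rem_sq:
  assumes "0 \<le> a" "2 * a + b\<^sup>2 \<le> 1"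
  shows "integrable stdn (\<lambda>y. (exp_rem a b y)\<^sup>2)" "(LINT y|stdn. (exp_rem a b y)\<^sup>2) \<le> (2 * a + b\<^sup>2)\<^sup>2"
proof -
  let ?k = "exp (a - b\<^sup>2 / 2)"
  have e: "(exp_rem a b y)\<^sup>2 = ?k\<^sup>2 * exp (2 * b * y)
    + ((- (2 * (1 + a) * ?k)) * exp (b * y) + ((- (2 * b * ?k)) * (exp (b * y) * y) + ((1 + a) + b * y)\<^sup>2))" for y
    unfolding exp_rem_def by (simp add: exp_add power2_eq_square algebra_simps exp_double flip: exp_double)
      (simp add: exp_add[symmetric] algebra_simps)
  show "integrable stdn (\<lambda>y. (exp_rem a b y)\<^sup>2)"
    unfolding e by (intro Bochner_Integration.integrable_add integrable_mult_right stdn_exp stdn_exp_id stdn_affine)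
  have "(LINT y|stdn. (exp_rem a b y)\<^sup>2) = ?k\<^sup>2 * exp ((2 * b)\<^sup>2 / 2)
    + ((- (2 * (1 + a) * ?k)) * exp (b\<^sup>2 / 2) + ((- (2 * b * ?k)) * (exp (b\<^sup>2 / 2) * b) + ((1 + a)\<^sup>2 + b\<^sup>2)))"
    unfolding e by (simp only: Bochner_Integration.integral_add Bochner_Integration.integrable_add integrable_mult_right
        stdn_exp stdn_exp_id stdn_affine integral_mult_right_zero)
  also have "?k\<^sup>2 * exp ((2 * b)\<^sup>2 / 2) = exp (2 * a + b\<^sup>2)"
    by (simp add: exp_double[symmetric] exp_add[symmetric] power_mult_distrib field_simps)
  also have "(- (2 * (1 + a) * ?k)) * exp (b\<^sup>2 / 2) = - 2 * (1 + a) * exp a"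
    by (simp only: mult.assoc mult_minus_left exp_add[symmetric]) (simp add: algebra_simps)
  also have "(- (2 * b * ?k)) * (exp (b\<^sup>2 / 2) * b) = - 2 * b\<^sup>2 * (?k * exp (b\<^sup>2 / 2))"
    by (simp add: power2_eq_square)
  also have "?k * exp (b\<^sup>2 / 2) = exp a" by (simp add: exp_add[symmetric])
  finally have I: "(LINT y|stdn. (exp_rem a b y)\<^sup>2)
    = exp (2 * a + b\<^sup>2) - 2 * (1 + a + b\<^sup>2) * exp a + ((1 + a)\<^sup>2 + b\<^sup>2)" by (simp add: algebra_simps)
  have "exp (2 * a + b\<^sup>2) \<le> 1 + (2 * a + b\<^sup>2) + (2 * a + b\<^sup>2)\<^sup>2"
    using assms by (intro exp_bound) auto
  moreover have "2 * (1 + a + b\<^sup>2) * (1 + a) \<le> 2 * (1 + a + b\<^sup>2) * exp a"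
    using assms exp_ge_add_one_self[of a] by (intro mult_left_mono) (auto simp: add.commute)
  moreover have "0 \<le> a\<^sup>2 + 2 * (a * b\<^sup>2)" using assms by auto
  moreover have "1 + (2 * a + b\<^sup>2) - 2 * (1 + a + b\<^sup>2) * (1 + a) + ((1 + a)\<^sup>2 + b\<^sup>2) = - (a\<^sup>2 + 2 * (a * b\<^sup>2))"
    by (simp add: power2_eq_square algebra_simps)
  ultimately show "(LINT y|stdn. (exp_rem a b y)\<^sup>2) \<le> (2 * a + b\<^sup>2)\<^sup>2"
    unfolding I by linarith
qed

lemma (in prob_space) integrable_mult_L2:
  fixes f h :: "'a \<Rightarrow> real"
  assumes [measurable]: "f \<in> borel_measurable M" "h \<in> borel_measurable M"
    and "integrable M (\<lambda>\<omega>. (f \<omega>)\<^sup>2)" "integrable M (\<lambda>\<omega>. (h \<omega>)\<^sup>2)"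
  shows "integrable M (\<lambda>\<omega>. f \<omega> * h \<omega>)"
    "\<bar>2 * expectation (\<lambda>\<omega>. f \<omega> * h \<omega>)\<bar> \<le> expectation (\<lambda>\<omega>. (f \<omega>)\<^sup>2) + expectation (\<lambda>\<omega>. (h \<omega>)\<^sup>2)"
proof -
  have b: "2 * \<bar>a * c\<bar> \<le> a\<^sup>2 + c\<^sup>2" for a c :: real
    using zero_le_power2[of "\<bar>a\<bar> - \<bar>c\<bar>"] by (simp add: power2_diff abs_mult)
  show i: "integrable M (\<lambda>\<omega>. f \<omega> * h \<omega>)"
  proof (rule Bochner_Integration.integrable_bound)
    show "integrable M (\<lambda>\<omega>. (f \<omega>)\<^sup>2 + (h \<omega>)\<^sup>2)" using assms by auto
    have "\<bar>f \<omega> * h \<omega>\<bar> \<le> (f \<omega>)\<^sup>2 + (h \<omega>)\<^sup>2" for \<omega>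
      using b[of "f \<omega>" "h \<omega>"] by linarith
    then show "AE \<omega> in M. norm (f \<omega> * h \<omega>) \<le> norm ((f \<omega>)\<^sup>2 + (h \<omega>)\<^sup>2)" by auto
  qed simp
  have "\<bar>2 * expectation (\<lambda>\<omega>. f \<omega> * h \<omega>)\<bar> = 2 * \<bar>expectation (\<lambda>\<omega>. f \<omega> * h \<omega>)\<bar>" by simp
  also have "\<dots> \<le> 2 * expectation (\<lambda>\<omega>. \<bar>f \<omega> * h \<omega>\<bar>)"
    using integral_abs_bound[of M "\<lambda>\<omega>. f \<omega> * h \<omega>"] by simp
  also have "\<dots> = expectation (\<lambda>\<omega>. 2 * \<bar>f \<omega> * h \<omega>\<bar>)" by simp
  also have "\<dots> \<le> expectation (\<lambda>\<omega>. (f \<omega>)\<^sup>2 + (h \<omega>)\<^sup>2)"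
    using i assms b by (intro integral_mono) auto
  finally show "\<bar>2 * expectation (\<lambda>\<omega>. f \<omega> * h \<omega>)\<bar> \<le> expectation (\<lambda>\<omega>. (f \<omega>)\<^sup>2) + expectation (\<lambda>\<omega>. (h \<omega>)\<^sup>2)"
    using assms by simp
qed

text \<open>Up to the level \<open>L\<close> the variable is bounded by \<open>L\<close>, beyond it
  by \<open>Z\<^sup>2 / L\<close>: a small event carries little mass once the second moment is under
  control.\<close>

lemma (in prob_space) expectation_truncation:
  assumes [measurable]: "Z \<in> borel_measurable M" "B \<in> events" and "integrable M (\<lambda>\<omega>. (Z \<omega>)\<^sup>2)" "0 < L"
    and Z: "\<And>\<omega>. 0 \<le> Z \<omega>"
  shows "integrable M (\<lambda>\<omega>. Z \<omega> * indicator B \<omega>)"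
    "expectation (\<lambda>\<omega>. Z \<omega> * indicator B \<omega>) \<le> L * prob B + expectation (\<lambda>\<omega>. (Z \<omega>)\<^sup>2) / L"
proof -
  have b: "Z \<omega> * indicator B \<omega> \<le> L * indicator B \<omega> + (Z \<omega>)\<^sup>2 / L" for \<omega>
  proof (cases "Z \<omega> \<le> L")
    case False
    then have "Z \<omega> * L \<le> Z \<omega> * Z \<omega>" using Z[of \<omega>] by (intro mult_left_mono) auto
    then have "Z \<omega> \<le> (Z \<omega>)\<^sup>2 / L" using \<open>0 < L\<close> by (simp add: field_simps power2_eq_square)
    then show ?thesis using \<open>0 < L\<close> Z[of \<omega>] by (auto split: split_indicator)
  next
    case True
    have "0 \<le> (Z \<omega>)\<^sup>2 / L" using \<open>0 < L\<close> by simp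
    then show ?thesis using True by (auto split: split_indicator intro: order_trans)
  qed
  have i: "integrable M (\<lambda>\<omega>. L * indicator B \<omega> + (Z \<omega>)\<^sup>2 / L)"
    using assms by (intro Bochner_Integration.integrable_add integrable_mult_right integrable_divide)
      (auto intro: integrable_real_indicator simp: emeasure_eq_measure)
  show i': "integrable M (\<lambda>\<omega>. Z \<omega> * indicator B \<omega>)"
  proof (rule Bochner_Integration.integrable_bound[OF i])
    show "AE \<omega> in M. norm (Z \<omega> * indicator B \<omega>) \<le> norm (L * indicator B \<omega> + (Z \<omega>)\<^sup>2 / L)"
    proof (rule AE_I2)
      fix \<omega>
      have "0 \<le> Z \<omega> * indicator B \<omega>" using Z by auto
      then show "norm (Z \<omega> * indicator B \<omega>) \<le> norm (L * indicator B \<omega> + (Z \<omega>)\<^sup>2 / L)"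
        using b[of \<omega>] by simp
    qed
  qed simp
  have "expectation (\<lambda>\<omega>. Z \<omega> * indicator B \<omega>) \<le> expectation (\<lambda>\<omega>. L * indicator B \<omega> + (Z \<omega>)\<^sup>2 / L)"
    using i i' b by (intro integral_mono) auto
  also have "\<dots> = L * prob B + expectation (\<lambda>\<omega>. (Z \<omega>)\<^sup>2) / L"
    using assms by (subst Bochner_Integration.integral_add) (auto simp: emeasure_eq_measure)
  finally show "expectation (\<lambda>\<omega>. Z \<omega> * indicator B \<omega>) \<le> L * prob B + expectation (\<lambda>\<omega>. (Z \<omega>)\<^sup>2) / L" .
qed

section \<open>One step of the Euler and exponential schemes\<close>

context bm
begin

lemma increment_L2:
  fixes f :: "'a \<Rightarrow> real" and h :: "real \<Rightarrow> real"
  assumes "0 \<le> s" "s \<le> v" and f: "f \<in> borel_measurable (F s)" and [measurable]: "h \<in> borel_measurable borel"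
    and "integrable M (\<lambda>\<omega>. (f \<omega>)\<^sup>2)" "integrable stdn (\<lambda>y. (h (sqrt (v - s) * y))\<^sup>2)"
  shows "integrable M (\<lambda>\<omega>. (f \<omega> * h (W v \<omega> - W s \<omega>))\<^sup>2)"
    "expectation (\<lambda>\<omega>. (f \<omega> * h (W v \<omega> - W s \<omega>))\<^sup>2)
      = expectation (\<lambda>\<omega>. (f \<omega>)\<^sup>2) * (LINT y|stdn. (h (sqrt (v - s) * y))\<^sup>2)"
  using increment_integral[of s v "\<lambda>\<omega>. (f \<omega>)\<^sup>2" "\<lambda>x. (h x)\<^sup>2"] assms
  by (auto simp: power_mult_distrib)

text \<open>\<open>d\<close> is the error so far, \<open>w\<close> the error of the coefficient,
  \<open>y\<close> the exponential scheme. The mixed terms with \<open>d\<close> see the increments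
  only through their means, which are at most of order \<open>v - s\<close>; so the error is
  multiplied by 1 plus a multiple of \<open>v - s\<close>, not of its square root.\<close>

lemma euler_step:
  fixes \<sigma> r S :: real
  assumes s: "0 \<le> s" "s \<le> v" and r: "0 \<le> r" and \<sigma>: "\<bar>\<sigma>\<bar> \<le> S"
    and c: "c = 2 * r + S\<^sup>2 + 1" "c * (v - s) \<le> 1"
    and dF: "d \<in> borel_measurable (F s)" and wF: "w \<in> borel_measurable (F s)" and yF: "y \<in> borel_measurable (F s)"
    and d2: "integrable M (\<lambda>\<omega>. (d \<omega>)\<^sup>2)" and w2: "integrable M (\<lambda>\<omega>. (w \<omega>)\<^sup>2)" and y2: "integrable M (\<lambda>\<omega>. (y \<omega>)\<^sup>2)"
  defines "\<eta> \<equiv> \<lambda>\<omega>. r * (v - s) + \<sigma> * (W v \<omega> - W s \<omega>)"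
    and "\<rho> \<equiv> \<lambda>\<omega>. exp ((r - \<sigma>\<^sup>2 / 2) * (v - s) + \<sigma> * (W v \<omega> - W s \<omega>)) - 1 - (r * (v - s) + \<sigma> * (W v \<omega> - W s \<omega>))"
  shows "integrable M (\<lambda>\<omega>. (d \<omega> + w \<omega> * \<eta> \<omega> - y \<omega> * \<rho> \<omega>)\<^sup>2)"
    "expectation (\<lambda>\<omega>. (d \<omega> + w \<omega> * \<eta> \<omega> - y \<omega> * \<rho> \<omega>)\<^sup>2) \<le>
      (1 + 2 * c\<^sup>2 * (v - s)) * expectation (\<lambda>\<omega>. (d \<omega>)\<^sup>2)
      + 3 * c\<^sup>2 * (v - s) * expectation (\<lambda>\<omega>. (w \<omega>)\<^sup>2) + 3 * c\<^sup>2 * (v - s)\<^sup>2 * expectation (\<lambda>\<omega>. (y \<omega>)\<^sup>2)"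
proof -
  define D where "D = v - s"
  define a where "a = r * D"
  define b where "b = \<sigma> * sqrt D"
  have D: "0 \<le> D" using s by (simp add: D_def)
  have b2: "b\<^sup>2 = \<sigma>\<^sup>2 * D" using D by (simp add: b_def power_mult_distrib)
  have a0: "0 \<le> a" using r D by (simp add: a_def)
  have \<sigma>2: "\<sigma>\<^sup>2 \<le> S\<^sup>2" using \<sigma> by (simp add: abs_le_square_iff[symmetric])
  have c1: "1 \<le> c" using r by (simp add: c)
  have cD: "c * D \<le> 1" using c(2) by (simp add: D_def)
  have D1: "D \<le> 1"
  proof -
    have "1 * D \<le> c * D" using c1 D by (intro mult_right_mono)
    then show ?thesis using cD by simp
  qed
  have ab: "2 * a + b\<^sup>2 \<le> c * D"
  proof -
    have "2 * a + b\<^sup>2 = (2 * r + \<sigma>\<^sup>2) * D" by (simp add: a_def b2 algebra_simps)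
    also have "\<dots> \<le> c * D" using D \<sigma>2 by (intro mult_right_mono) (auto simp: c)
    finally show ?thesis .
  qed
  define h\<eta> where "h\<eta> x = a + \<sigma> * x" for x
  define h\<rho> where "h\<rho> x = exp (a - b\<^sup>2 / 2 + \<sigma> * x) - 1 - (a + \<sigma> * x)" for x
  have \<eta>: "\<eta> = (\<lambda>\<omega>. h\<eta> (W v \<omega> - W s \<omega>))" by (simp add: \<eta>_def h\<eta>_def a_def D_def)
  have \<rho>: "\<rho> = (\<lambda>\<omega>. h\<rho> (W v \<omega> - W s \<omega>))" by (simp add: \<rho>_def h\<rho>_def a_def b2 D_def algebra_simps)
  have h\<eta>: "h\<eta> (sqrt (v - s) * z) = a + b * z" for z by (simp add: h\<eta>_def b_def D_def)
  have h\<rho>: "h\<rho> (sqrt (v - s) * z) = exp_rem a b z" for z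
    by (simp add: h\<rho>_def exp_rem_def b_def D_def mult.assoc)
  have [measurable]: "h\<eta> \<in> borel_measurable borel" "h\<rho> \<in> borel_measurable borel"
    unfolding h\<eta>_def[abs_def] h\<rho>_def[abs_def] by measurable
  have [measurable]: "d \<in> borel_measurable M" "w \<in> borel_measurable M" "y \<in> borel_measurable M"
    using dF wF yF measurable_F_M by blast+
  have [measurable]: "W v \<in> borel_measurable M" "W s \<in> borel_measurable M" using s W_measurable_M by auto
  have \<rho>I: "integrable stdn (\<lambda>z. (exp_rem a b z)\<^sup>2)" "(LINT z|stdn. (exp_rem a b z)\<^sup>2) \<le> (2 * a + b\<^sup>2)\<^sup>2"
    using stdn_exp_rem_sq[OF a0, of b] ab cD by auto
  have w\<eta>: "integrable M (\<lambda>\<omega>. (w \<omega> * \<eta> \<omega>)\<^sup>2)" "expectation (\<lambda>\<omega>. (w \<omega> * \<eta> \<omega>)\<^sup>2) = expectation (\<lambda>\<omega>. (w \<omega>)\<^sup>2) * (a\<^sup>2 + b\<^sup>2)"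
    using increment_L2[OF s wF _ w2, of h\<eta>] by (auto simp: \<eta> h\<eta> stdn_affine)
  have y\<rho>: "integrable M (\<lambda>\<omega>. (y \<omega> * \<rho> \<omega>)\<^sup>2)"
    "expectation (\<lambda>\<omega>. (y \<omega> * \<rho> \<omega>)\<^sup>2) = expectation (\<lambda>\<omega>. (y \<omega>)\<^sup>2) * (LINT z|stdn. (exp_rem a b z)\<^sup>2)"
    using increment_L2[OF s yF _ y2, of h\<rho>] \<rho>I by (auto simp: \<rho> h\<rho>)
  note dw = integrable_mult_L2[of d w, OF _ _ d2 w2, simplified]
    and dy = integrable_mult_L2[of d y, OF _ _ d2 y2, simplified]
  have dwF: "(\<lambda>\<omega>. d \<omega> * w \<omega>) \<in> borel_measurable (F s)" "(\<lambda>\<omega>. d \<omega> * y \<omega>) \<in> borel_measurable (F s)"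
    using dF wF yF by auto
  have dw\<eta>: "integrable M (\<lambda>\<omega>. d \<omega> * w \<omega> * \<eta> \<omega>)" "expectation (\<lambda>\<omega>. d \<omega> * w \<omega> * \<eta> \<omega>) = expectation (\<lambda>\<omega>. d \<omega> * w \<omega>) * a"
    using increment_integral[OF s dwF(1), of h\<eta>] dw by (auto simp: \<eta> h\<eta> stdn_affine)
  have dy\<rho>: "integrable M (\<lambda>\<omega>. d \<omega> * y \<omega> * \<rho> \<omega>)"
    "expectation (\<lambda>\<omega>. d \<omega> * y \<omega> * \<rho> \<omega>) = expectation (\<lambda>\<omega>. d \<omega> * y \<omega>) * (exp a - 1 - a)"
    using increment_integral[OF s dwF(2), of h\<rho>] dy by (auto simp: \<rho> h\<rho> stdn_exp_rem)
  have mr: "\<rho> \<in> borel_measurable M" "\<eta> \<in> borel_measurable M" unfolding \<rho> \<eta> by measurable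
  \<comment> \<open>Only the square of the two new terms is estimated, by
    \<open>(p - q)\<^sup>2 \<le> 2 * p\<^sup>2 + 2 * q\<^sup>2\<close>. The mixed terms with
    \<open>d\<close> stay exact, so that independence can be used on them.\<close>
  let ?b = "\<lambda>\<omega>. (d \<omega>)\<^sup>2 + 2 * (w \<omega> * \<eta> \<omega>)\<^sup>2 + 2 * (y \<omega> * \<rho> \<omega>)\<^sup>2 + 2 * (d \<omega> * w \<omega> * \<eta> \<omega>) - 2 * (d \<omega> * y \<omega> * \<rho> \<omega>)"
  have bi: "integrable M ?b" using d2 w\<eta> y\<rho> dw\<eta> dy\<rho> by auto
  have le: "(d \<omega> + w \<omega> * \<eta> \<omega> - y \<omega> * \<rho> \<omega>)\<^sup>2 \<le> ?b \<omega>" for \<omega>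
    using zero_le_power2[of "w \<omega> * \<eta> \<omega> + y \<omega> * \<rho> \<omega>"] by (simp add: power2_eq_square algebra_simps)
  show i: "integrable M (\<lambda>\<omega>. (d \<omega> + w \<omega> * \<eta> \<omega> - y \<omega> * \<rho> \<omega>)\<^sup>2)"
    using mr le by (intro Bochner_Integration.integrable_bound[OF bi]) (auto intro!: AE_I2 order_trans[OF le abs_ge_self])
  let ?d = "expectation (\<lambda>\<omega>. (d \<omega>)\<^sup>2)" and ?w = "expectation (\<lambda>\<omega>. (w \<omega>)\<^sup>2)" and ?y = "expectation (\<lambda>\<omega>. (y \<omega>)\<^sup>2)"
  have nn: "0 \<le> ?d" "0 \<le> ?w" "0 \<le> ?y" by auto
  have "expectation (\<lambda>\<omega>. (d \<omega> + w \<omega> * \<eta> \<omega> - y \<omega> * \<rho> \<omega>)\<^sup>2) \<le> expectation ?b"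
    by (intro integral_mono i bi le)
  also have "\<dots> = ?d + 2 * (?w * (a\<^sup>2 + b\<^sup>2)) + 2 * (?y * (LINT z|stdn. (exp_rem a b z)\<^sup>2))
      + 2 * (expectation (\<lambda>\<omega>. d \<omega> * w \<omega>) * a) - 2 * (expectation (\<lambda>\<omega>. d \<omega> * y \<omega>) * (exp a - 1 - a))"
    using d2 w\<eta> y\<rho> dw\<eta> dy\<rho> by simp
  also have "\<dots> \<le> ?d + 2 * (?w * (c\<^sup>2 * D)) + 2 * (?y * (c\<^sup>2 * D\<^sup>2)) + (?d + ?w) * (c\<^sup>2 * D) + (?d + ?y) * (c\<^sup>2 * D\<^sup>2)"
  proof -
    \<comment> \<open>The summand 1 in \<open>c\<close> gives \<open>c \<le> c\<^sup>2\<close>, so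
      that \<open>c\<^sup>2\<close> absorbs all coefficients.\<close>
    have rc: "r \<le> c\<^sup>2" "r\<^sup>2 \<le> c\<^sup>2" "r\<^sup>2 + S\<^sup>2 \<le> c\<^sup>2"
    proof -
      have "r \<le> c" using r by (simp add: c)
      moreover have "c \<le> c\<^sup>2" using c1 by (simp add: power2_eq_square)
      ultimately show "r \<le> c\<^sup>2" by simp
      show "r\<^sup>2 \<le> c\<^sup>2" using \<open>r \<le> c\<close> r by (intro power_mono)
      have "c\<^sup>2 = r\<^sup>2 + S\<^sup>2 + (3 * r\<^sup>2 + S\<^sup>2 + S\<^sup>2 * S\<^sup>2 + 1 + 4 * (r * S\<^sup>2) + 4 * r)"
        unfolding c(1) by (simp add: power2_eq_square algebra_simps)
      moreover have "0 \<le> r * S\<^sup>2" using r by simp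
      moreover have "0 \<le> r\<^sup>2" "0 \<le> S\<^sup>2" "0 \<le> S\<^sup>2 * S\<^sup>2" by auto
      ultimately show "r\<^sup>2 + S\<^sup>2 \<le> c\<^sup>2" using r by linarith
    qed
    have D2: "D\<^sup>2 \<le> D" using D D1 by (simp add: power2_eq_square mult_left_le)
    have 1: "a\<^sup>2 + b\<^sup>2 \<le> c\<^sup>2 * D"
    proof -
      have "a\<^sup>2 + b\<^sup>2 = r\<^sup>2 * D\<^sup>2 + \<sigma>\<^sup>2 * D" by (simp add: a_def b2 power_mult_distrib)
      also have "\<dots> \<le> r\<^sup>2 * D + S\<^sup>2 * D" using D D2 \<sigma>2 by (intro add_mono mult_left_mono mult_right_mono) auto
      also have "\<dots> = (r\<^sup>2 + S\<^sup>2) * D" by (simp add: algebra_simps)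
      also have "\<dots> \<le> c\<^sup>2 * D" using rc D by (intro mult_right_mono)
      finally show ?thesis .
    qed
    have 2: "(LINT z|stdn. (exp_rem a b z)\<^sup>2) \<le> c\<^sup>2 * D\<^sup>2"
    proof -
      have "(2 * a + b\<^sup>2)\<^sup>2 \<le> (c * D)\<^sup>2" using ab a0 by (intro power_mono) auto
      then show ?thesis using \<rho>I(2) by (simp add: power_mult_distrib)
    qed
    have 3: "2 * (expectation (\<lambda>\<omega>. d \<omega> * w \<omega>) * a) \<le> (?d + ?w) * (c\<^sup>2 * D)"
    proof -
      have "2 * expectation (\<lambda>\<omega>. d \<omega> * w \<omega>) * a \<le> (?d + ?w) * a"
        using dw(2) a0 by (intro mult_right_mono) auto
      also have "\<dots> \<le> (?d + ?w) * (c\<^sup>2 * D)"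
        unfolding a_def using rc D nn by (intro mult_left_mono mult_right_mono) auto
      finally show ?thesis by simp
    qed
    have 4: "- 2 * (expectation (\<lambda>\<omega>. d \<omega> * y \<omega>) * (exp a - 1 - a)) \<le> (?d + ?y) * (c\<^sup>2 * D\<^sup>2)"
    proof -
      have e: "0 \<le> exp a - 1 - a" "exp a - 1 - a \<le> c\<^sup>2 * D\<^sup>2"
      proof -
        show "0 \<le> exp a - 1 - a" using exp_ge_add_one_self[of a] by linarith
        have "0 \<le> b\<^sup>2" by simp
        then have "a \<le> 1" using ab cD a0 by linarith
        then have "exp a \<le> 1 + a + a\<^sup>2" using a0 by (intro exp_bound) auto
        moreover have "a\<^sup>2 \<le> c\<^sup>2 * D\<^sup>2" unfolding a_def power_mult_distrib using rc by (intro mult_right_mono) auto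
        ultimately show "exp a - 1 - a \<le> c\<^sup>2 * D\<^sup>2" by simp
      qed
      have "(- 2 * expectation (\<lambda>\<omega>. d \<omega> * y \<omega>)) * (exp a - 1 - a) \<le> (?d + ?y) * (exp a - 1 - a)"
        using dy(2) e by (intro mult_right_mono) auto
      also have "\<dots> \<le> (?d + ?y) * (c\<^sup>2 * D\<^sup>2)" using e nn by (intro mult_left_mono) auto
      finally show ?thesis by simp
    qed
    have "2 * (?w * (a\<^sup>2 + b\<^sup>2)) \<le> 2 * (?w * (c\<^sup>2 * D))"
      "2 * (?y * (LINT z|stdn. (exp_rem a b z)\<^sup>2)) \<le> 2 * (?y * (c\<^sup>2 * D\<^sup>2))"
      using 1 2 nn by (intro mult_left_mono; simp)+
    then show ?thesis using 3 4 by linarith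
  qed
  also have "\<dots> \<le> (1 + 2 * c\<^sup>2 * D) * ?d + 3 * c\<^sup>2 * D * ?w + 3 * c\<^sup>2 * D\<^sup>2 * ?y"
  proof -
    have "?d * (c\<^sup>2 * D\<^sup>2) \<le> ?d * (c\<^sup>2 * D)"
      using D D1 nn by (intro mult_left_mono) (auto simp: power2_eq_square[of D] mult_left_le)
    then show ?thesis by (simp add: algebra_simps)
  qed
  finally show "expectation (\<lambda>\<omega>. (d \<omega> + w \<omega> * \<eta> \<omega> - y \<omega> * \<rho> \<omega>)\<^sup>2) \<le>
      (1 + 2 * c\<^sup>2 * (v - s)) * ?d + 3 * c\<^sup>2 * (v - s) * ?w + 3 * c\<^sup>2 * (v - s)\<^sup>2 * ?y"
    by (simp add: D_def)
qed

text \<open>Fourth moments are needed because squared errors are themselves truncated with a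
  second-moment bound. The rate is
  \<open>4 * (r - \<sigma>\<^sup>2 / 2) + (4 * \<sigma>)\<^sup>2 / 2\<close>.\<close>

lemma exp_step_moment4:
  fixes r \<sigma> :: real
  assumes s: "0 \<le> s" "s \<le> v" and f: "f \<in> borel_measurable (F s)" and int: "integrable M (\<lambda>\<omega>. (f \<omega>) ^ 4)"
  defines "f' \<equiv> \<lambda>\<omega>. f \<omega> * exp ((r - \<sigma>\<^sup>2 / 2) * (v - s) + \<sigma> * (W v \<omega> - W s \<omega>))"
  shows "integrable M (\<lambda>\<omega>. (f' \<omega>) ^ 4)"
    "expectation (\<lambda>\<omega>. (f' \<omega>) ^ 4) = expectation (\<lambda>\<omega>. (f \<omega>) ^ 4) * exp ((4 * r + 6 * \<sigma>\<^sup>2) * (v - s))"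
proof -
  define h where "h z = exp (4 * (r - \<sigma>\<^sup>2 / 2) * (v - s)) * exp (4 * \<sigma> * z)" for z
  have [measurable]: "h \<in> borel_measurable borel" unfolding h_def[abs_def] by measurable
  have e: "(f' \<omega>) ^ 4 = (f \<omega>) ^ 4 * h (W v \<omega> - W s \<omega>)" for \<omega>
  proof -
    have "exp q ^ 4 = exp (4 * q)" for q :: real by (simp flip: exp_of_nat_mult)
    then show ?thesis
      by (simp add: f'_def h_def power_mult_distrib exp_add[symmetric] distrib_left mult.assoc)
  qed
  have h: "h (sqrt (v - s) * y) = exp (4 * (r - \<sigma>\<^sup>2 / 2) * (v - s)) * exp ((4 * \<sigma> * sqrt (v - s)) * y)" for y
    by (simp add: h_def mult.assoc)
  have hI: "integrable stdn (\<lambda>y. h (sqrt (v - s) * y))" "(LINT y|stdn. h (sqrt (v - s) * y)) = exp ((4 * r + 6 * \<sigma>\<^sup>2) * (v - s))"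
  proof -
    have "4 * (r - \<sigma>\<^sup>2 / 2) * (v - s) + (4 * \<sigma> * sqrt (v - s))\<^sup>2 / 2 = (4 * r + 6 * \<sigma>\<^sup>2) * (v - s)"
      using s by (simp add: power_mult_distrib) (simp add: field_simps)
    then show "integrable stdn (\<lambda>y. h (sqrt (v - s) * y))"
      "(LINT y|stdn. h (sqrt (v - s) * y)) = exp ((4 * r + 6 * \<sigma>\<^sup>2) * (v - s))"
      unfolding h
      by (simp_all only: integrable_mult_right stdn_exp integral_mult_right_zero) (simp_all only: exp_add[symmetric])
  qed
  have f4: "(\<lambda>\<omega>. (f \<omega>) ^ 4) \<in> borel_measurable (F s)" using f by simp
  show "integrable M (\<lambda>\<omega>. (f' \<omega>) ^ 4)"
    "expectation (\<lambda>\<omega>. (f' \<omega>) ^ 4) = expectation (\<lambda>\<omega>. (f \<omega>) ^ 4) * exp ((4 * r + 6 * \<sigma>\<^sup>2) * (v - s))"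
    unfolding e using increment_integral[OF s f4 _ int hI(1)] hI(2) by auto
qed

end

lemma power4_sum_le: "(a + b) ^ 4 \<le> 8 * a ^ 4 + 8 * b ^ 4" for a b :: real
proof -
  have 1: "(a + b)\<^sup>2 \<le> 2 * (a\<^sup>2 + b\<^sup>2)"
    using zero_le_power2[of "a - b"] by (simp add: power2_eq_square algebra_simps)
  have 2: "(a\<^sup>2 + b\<^sup>2)\<^sup>2 \<le> 2 * (a ^ 4 + b ^ 4)"
    using zero_le_power2[of "a\<^sup>2 - b\<^sup>2"] by (simp add: power2_eq_square power4_eq_xxxx algebra_simps)
  have "(a + b) ^ 4 = ((a + b)\<^sup>2)\<^sup>2" by (simp add: power2_eq_square power4_eq_xxxx)
  also have "\<dots> \<le> (2 * (a\<^sup>2 + b\<^sup>2))\<^sup>2" using 1 by (intro power_mono) auto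
  also have "\<dots> = 4 * (a\<^sup>2 + b\<^sup>2)\<^sup>2" by (simp only: power_mult_distrib) simp
  also have "\<dots> \<le> 4 * (2 * (a ^ 4 + b ^ 4))" using 2 by (intro mult_left_mono) auto
  also have "\<dots> = 8 * a ^ 4 + 8 * b ^ 4" by simp
  finally show ?thesis .
qed

section \<open>Mean-square comparison with the exponential scheme\<close>

context gbm_grid
begin

abbreviation dt :: "nat \<Rightarrow> nat \<Rightarrow> real" where "dt n i \<equiv> g n (Suc i) - g n i"
abbreviation dW :: "nat \<Rightarrow> nat \<Rightarrow> 'a \<Rightarrow> real" where "dW n i \<omega> \<equiv> W (g n (Suc i)) \<omega> - W (g n i) \<omega>"

text \<open>The price that would result if the volatility were frozen over each cell; its logarithm
  is exactly normal.\<close>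

definition explicit :: "nat \<Rightarrow> nat \<Rightarrow> 'a \<Rightarrow> real" where
  "explicit n j \<omega> = x * exp (\<Sum>i<j. (r - (\<sigma> (g n i))\<^sup>2 / 2) * dt n i + \<sigma> (g n i) * dW n i \<omega>)"

definition inside :: "nat \<Rightarrow> nat \<Rightarrow> nat \<Rightarrow> 'a \<Rightarrow> bool" where
  "inside N n j \<omega> \<longleftrightarrow> (\<forall>i\<in>{..j}. \<bar>X (g n i) \<omega>\<bar> \<le> real N)"

text \<open>From the first grid time at which the price exceeds \<open>N\<close> in absolute value,
  that time included, the value is 0. It is bounded and known at \<open>g n j\<close>, which makes
  second moments available although nothing is known about those of the price.\<close>

definition cut_price :: "nat \<Rightarrow> nat \<Rightarrow> nat \<Rightarrow> 'a \<Rightarrow> real" where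
  "cut_price N n j \<omega> = (if inside N n j \<omega> then X (g n j) \<omega> else 0)"

definition cut_euler :: "nat \<Rightarrow> nat \<Rightarrow> nat \<Rightarrow> 'a \<Rightarrow> real" where
  "cut_euler N n j \<omega> = x + (\<Sum>i<j. cut_price N n i \<omega> * (r * dt n i + \<sigma> (g n i) * dW n i \<omega>))"

lemma explicit_pos: "0 < explicit n j \<omega>" using x0 by (simp add: explicit_def)

lemma explicit_Suc: "explicit n (Suc j) \<omega> = explicit n j \<omega> * exp ((r - (\<sigma> (g n j))\<^sup>2 / 2) * dt n j + \<sigma> (g n j) * dW n j \<omega>)"
  by (simp add: explicit_def exp_add)

lemma F_grid:
  assumes "i \<le> j" "j \<le> m n"
  shows "X (g n i) \<in> borel_measurable (F (g n j))" "W (g n i) \<in> borel_measurable (F (g n j))"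
  using assms g_in[of i n] g_mono[of i j n] g_nonneg[of i n]
  by (auto intro!: measurable_F_mono[OF X_adapted] W_measurable)

lemma explicit_F: "j \<le> m n \<Longrightarrow> explicit n j \<in> borel_measurable (F (g n j))"
  unfolding explicit_def[abs_def]
  by (intro borel_measurable_times borel_measurable_exp[THEN measurable_compose[rotated]] borel_measurable_sum
      borel_measurable_add borel_measurable_diff F_grid borel_measurable_const) auto

lemma inside_F:
  assumes "j \<le> m n"
  shows "Measurable.pred (F (g n j)) (inside N n j)"
proof -
  have [measurable]: "X (g n i) \<in> borel_measurable (F (g n j))" if "i \<in> {..j}" for i
    using that assms F_grid by auto
  show ?thesis unfolding inside_def[abs_def] by measurable
qed

lemma cut_price_F: "j \<le> m n \<Longrightarrow> cut_price N n j \<in> borel_measurable (F (g n j))"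
  unfolding cut_price_def[abs_def] using inside_F[of j n N] F_grid(1)[of j j n]
  by (intro measurable_If) (auto simp: Measurable.pred_def)

lemma cut_euler_F: 
  assumes "j \<le> m n"
  shows "cut_euler N n j \<in> borel_measurable (F (g n j))"
proof -
  have "cut_price N n i \<in> borel_measurable (F (g n j))" if "i < j" for i
    using that assms by (intro measurable_F_mono[OF cut_price_F] g_mono) auto
  then show ?thesis
    unfolding cut_euler_def[abs_def] using assms
    by (intro borel_measurable_times borel_measurable_sum
      borel_measurable_add borel_measurable_diff F_grid borel_measurable_const) auto
qed

lemma cut_euler_eq_euler:
  assumes "\<And>i. i < j \<Longrightarrow> inside N n i \<omega>"
  shows "cut_euler N n j \<omega> = euler n j \<omega>"
  using assms by (simp add: cut_euler_def euler_def cut_price_def)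

lemma inside_mono: "inside N n j \<omega> \<Longrightarrow> i \<le> j \<Longrightarrow> inside N n i \<omega>"
  by (auto simp: inside_def)

text \<open>The union runs over all grids, so that one \<open>N\<close> works for every mesh. As
  paths are bounded on \<open>[t, u]\<close>, the probability tends to 0.\<close>

definition exits :: "nat \<Rightarrow> 'a set" where
  "exits N = (\<Union>n. \<Union>i\<in>{..m n}. {\<omega> \<in> space M. \<bar>X (g n i) \<omega>\<bar> > real N})"

lemma exits_events[measurable]: "exits N \<in> events"
proof -
  have [measurable]: "X (g n i) \<in> borel_measurable M" if "i \<in> {..m n}" for n i
    using that g_in by (intro X_M) auto
  show ?thesis unfolding exits_def by measurable
qed

lemma exits_lim: "(\<lambda>N. prob (exits N)) \<longlonglongrightarrow> 0"
proof -
  have "(\<lambda>N. prob (exits N)) \<longlonglongrightarrow> prob (\<Inter>N. exits N)"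
  proof (rule finite_Lim_measure_decseq)
    show "decseq exits"
      unfolding decseq_def
    proof (intro allI impI subsetI)
      fix N N' \<omega> assume "N \<le> N'" "\<omega> \<in> exits N'"
      then obtain n i where "i \<le> m n" "\<omega> \<in> space M" "real N' < \<bar>X (g n i) \<omega>\<bar>" by (auto simp: exits_def)
      moreover then have "real N < \<bar>X (g n i) \<omega>\<bar>" using \<open>N \<le> N'\<close> by simp
      ultimately show "\<omega> \<in> exits N" by (auto simp: exits_def)
    qed
  qed auto
  also have "(\<Inter>N. exits N) = {}"
  proof (rule equals0I)
    fix \<omega> assume \<omega>: "\<omega> \<in> (\<Inter>N. exits N)"
    then have "\<omega> \<in> space M" by (auto simp: exits_def)
    then have "compact ((\<lambda>s. X s \<omega>) ` {t..u})"
      by (intro compact_continuous_image X_cont) auto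
    then obtain C where C: "\<forall>s\<in>{t..u}. \<bar>X s \<omega>\<bar> \<le> C"
      by (auto dest!: compact_imp_bounded simp: bounded_iff)
    obtain N where "C < real N" using reals_Archimedean2 by blast
    moreover have "\<omega> \<in> exits N" using \<omega> by blast
    then obtain n i where "i \<le> m n" "real N < \<bar>X (g n i) \<omega>\<bar>" by (auto simp: exits_def)
    ultimately show False using C g_in[of i n] by fastforce
  qed
  finally show ?thesis by simp
qed

lemma not_inside_exits: "\<omega> \<in> space M \<Longrightarrow> j \<le> m n \<Longrightarrow> \<not> inside N n j \<omega> \<Longrightarrow> \<omega> \<in> exits N"
  by (fastforce simp: inside_def exits_def not_le)

lemma prob_not_inside:
  assumes "j \<le> m n"
  shows "prob {\<omega> \<in> space M. \<not> inside N n j \<omega>} \<le> prob (exits N)"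
  using not_inside_exits[OF _ assms] by (intro finite_measure_mono) auto

end

text \<open>The recursion says that \<open>D + k\<close> grows by at most a factor
  \<open>1 + 8 * a\<close>, with a surplus \<open>2 * a * k\<close> given away; \<open>e\<close> is
  the exponential accumulated so far.\<close>

lemma gronwall_step:
  fixes a e D k :: real
  assumes "0 \<le> a" "0 \<le> k" "D \<le> k * (e - 1)" "D' \<le> (1 + 8 * a) * D + 6 * a * k" "1 \<le> e"
  shows "D' \<le> k * (e * exp (8 * a) - 1)"
proof -
  have "D' \<le> (1 + 8 * a) * (k * (e - 1)) + 6 * a * k"
    using assms by (intro order_trans[OF assms(4)] add_mono mult_left_mono) auto
  also have "\<dots> = k * ((1 + 8 * a) * e - 1) - 2 * a * k" by (simp add: algebra_simps)
  also have "\<dots> \<le> k * ((1 + 8 * a) * e - 1)" using assms by simp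
  also have "\<dots> \<le> k * (e * exp (8 * a) - 1)"
  proof (intro mult_left_mono diff_right_mono)
    have "(1 + 8 * a) * e \<le> exp (8 * a) * e"
      using assms exp_ge_add_one_self[of "8 * a"] by (intro mult_right_mono) auto
    then show "(1 + 8 * a) * e \<le> e * exp (8 * a)" by (simp add: mult.commute)
  qed fact
  finally show ?thesis .
qed

context gbm_grid
begin

text \<open>The error of the price against the exponential is capped at \<open>N + explicit\<close>, so the Gronwall
  constant does not depend on \<open>N\<close>.\<close>

lemma truncated_scheme_close:
  assumes "0 < \<kappa>"
  shows "\<exists>N. prob (exits N) \<le> \<kappa> \<and> (\<forall>\<^sub>F n in sequentially. \<forall>j\<le>m n.
    integrable M (\<lambda>\<omega>. (cut_euler N n j \<omega> - explicit n j \<omega>)\<^sup>2) \<and> expectation (\<lambda>\<omega>. (cut_euler N n j \<omega> - explicit n j \<omega>)\<^sup>2) \<le> \<kappa>)"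
proof -
  obtain S where S: "\<And>s. s \<in> {t..u} \<Longrightarrow> \<bar>\<sigma> s\<bar> \<le> S" "0 \<le> S"
  proof -
    have "compact (\<sigma> ` {t..u})" by (intro compact_continuous_image \<sigma>_cont) auto
    then obtain C where "\<forall>s\<in>{t..u}. \<bar>\<sigma> s\<bar> \<le> C"
      by (auto dest!: compact_imp_bounded simp: bounded_iff)
    then show ?thesis using tu by (intro that[of C]) (auto intro: order_trans[OF abs_ge_zero, of "\<sigma> t"])
  qed
  define c where "c = 2 * r + S\<^sup>2 + 1"
  have c1: "1 \<le> c" using r0 by (simp add: c_def)
  \<comment> \<open>\<open>C\<close> is the Gronwall factor over the whole interval; the source term
    of the recursion must therefore have the size \<open>k = \<kappa> / C\<close>.\<close>
  define C where "C = exp (8 * c\<^sup>2 * (u - t))"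
  have C: "1 \<le> C" using tu by (simp add: C_def)
  define k where "k = \<kappa> / C"
  have k: "0 < k" using assms C by (simp add: k_def)
  define Y where "Y = x ^ 4 * exp ((4 * r + 6 * S\<^sup>2) * (u - t))"
  have Y: "0 < Y" using x0 by (simp add: Y_def)
  have yM[measurable]: "explicit n j \<in> borel_measurable M" if "j \<le> m n" for n j
    using explicit_F[OF that] by (rule measurable_F_M)
  have y4: "integrable M (\<lambda>\<omega>. (explicit n j \<omega>) ^ 4) \<and>
      expectation (\<lambda>\<omega>. (explicit n j \<omega>) ^ 4) \<le> x ^ 4 * exp ((4 * r + 6 * S\<^sup>2) * (g n j - t))" if "j \<le> m n" for n j
    using that
  proof (induction j)
    case 0 then show ?case by (simp add: explicit_def g_0 prob_space)
  next
    case (Suc j)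
    then have j: "j \<le> m n" "j < m n" by auto
    note st = exp_step_moment4[OF g_nonneg[OF j(1)] g_step[OF j(2)] explicit_F[OF j(1)], of r "\<sigma> (g n j)", folded explicit_Suc]
    have "expectation (\<lambda>\<omega>. (explicit n (Suc j) \<omega>) ^ 4)
      = expectation (\<lambda>\<omega>. (explicit n j \<omega>) ^ 4) * exp ((4 * r + 6 * (\<sigma> (g n j))\<^sup>2) * dt n j)"
      using st Suc j by auto
    also have "\<dots> \<le> (x ^ 4 * exp ((4 * r + 6 * S\<^sup>2) * (g n j - t))) * exp ((4 * r + 6 * S\<^sup>2) * dt n j)"
    proof (intro mult_mono)
      have "(\<sigma> (g n j))\<^sup>2 \<le> S\<^sup>2" using S(1)[OF g_in[OF j(1)]] by (simp add: abs_le_square_iff[symmetric])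
      then show "exp ((4 * r + 6 * (\<sigma> (g n j))\<^sup>2) * dt n j) \<le> exp ((4 * r + 6 * S\<^sup>2) * dt n j)"
        using g_step[OF j(2)] by (auto intro!: mult_right_mono)
    qed (use Suc j in auto)
    also have "\<dots> = x ^ 4 * exp ((4 * r + 6 * S\<^sup>2) * (g n (Suc j) - t))"
      by (simp add: exp_add[symmetric] algebra_simps)
    finally show ?case using st Suc j by auto
  qed
  have y4': "integrable M (\<lambda>\<omega>. (explicit n j \<omega>) ^ 4)" "expectation (\<lambda>\<omega>. (explicit n j \<omega>) ^ 4) \<le> Y" if "j \<le> m n" for n j
  proof -
    have "x ^ 4 * exp ((4 * r + 6 * S\<^sup>2) * (g n j - t)) \<le> Y"
      unfolding Y_def using g_in[OF that] r0 by (intro mult_left_mono) (auto intro!: mult_left_mono)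
    then show "integrable M (\<lambda>\<omega>. (explicit n j \<omega>) ^ 4)" "expectation (\<lambda>\<omega>. (explicit n j \<omega>) ^ 4) \<le> Y"
      using y4[OF that] by auto
  qed
  have y2: "integrable M (\<lambda>\<omega>. (explicit n j \<omega>)\<^sup>2)" "expectation (\<lambda>\<omega>. (explicit n j \<omega>)\<^sup>2) \<le> 1 + Y" if "j \<le> m n" for n j
  proof -
    have b: "a\<^sup>2 \<le> 1 + a ^ 4" for a :: real
    proof -
      have "0 \<le> (a\<^sup>2 - 1)\<^sup>2" by simp
      also have "\<dots> = 1 + a ^ 4 - 2 * a\<^sup>2" by (simp add: power2_diff flip: power_mult)
      finally show ?thesis using zero_le_power2[of a] by linarith
    qed
    have i: "integrable M (\<lambda>\<omega>. 1 + (explicit n j \<omega>) ^ 4)" using y4' that by auto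
    show i2: "integrable M (\<lambda>\<omega>. (explicit n j \<omega>)\<^sup>2)"
      using b yM[OF that] by (intro Bochner_Integration.integrable_bound[OF i]) (auto intro: order_trans[OF b])
    have "expectation (\<lambda>\<omega>. (explicit n j \<omega>)\<^sup>2) \<le> expectation (\<lambda>\<omega>. 1 + (explicit n j \<omega>) ^ 4)"
      by (intro integral_mono i i2 b)
    also have "\<dots> \<le> 1 + Y" using y4'[OF that] by (simp add: prob_space)
    finally show "expectation (\<lambda>\<omega>. (explicit n j \<omega>)\<^sup>2) \<le> 1 + Y" .
  qed
  \<comment> \<open>The order of the choices matters: \<open>L'\<close> depends on the moment bound
    \<open>Y\<close> only, then \<open>N\<close> is chosen for \<open>L'\<close>, then
    \<open>Z\<close> and \<open>L\<close> for \<open>N\<close>, and the grid index comes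
    last.\<close>
  define L' where "L' = 4 * Y / k"
  have L': "0 < L'" "Y / L' = k / 4" using Y k by (auto simp: L'_def)
  have "0 < min \<kappa> (k / (4 * L'))" using k L' assms by auto
  then obtain N where "prob (exits N) < min \<kappa> (k / (4 * L'))"
    using order_tendstoD(2)[OF exits_lim] eventually_happens'[OF sequentially_bot] by blast
  then have N: "prob (exits N) \<le> \<kappa>" "L' * prob (exits N) \<le> k / 4" using L' k by (auto simp: field_simps)
  define Z where "Z = 8 * real N ^ 4 + 8 * Y"
  have Z: "0 < Z" using Y by (simp add: Z_def add_nonneg_pos)
  define L where "L = 16 * Z / k"
  have L: "0 < L" "Z / L = k / 16" using Z k by (auto simp: L_def)
  define \<theta> where "\<theta> = sqrt k / 4"
  have \<theta>: "0 < \<theta>" "\<theta>\<^sup>2 = k / 16" using k by (auto simp: \<theta>_def power_divide)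
  have "0 < k / (16 * L)" using k L by auto
  from euler_error[OF \<theta>(1) this]
  have "\<forall>\<^sub>F n in sequentially. \<forall>j\<le>m n. prob {\<omega> \<in> space M. \<bar>X (g n j) \<omega> - euler n j \<omega>\<bar> > \<theta>} \<le> k / (16 * L)" .
  \<comment> \<open>The first bound on the mesh makes \<open>euler_step\<close> applicable, the
    second absorbs its term with the squared step length.\<close>
  moreover have "\<forall>\<^sub>F n in sequentially. \<delta> n < 1 / c" "\<forall>\<^sub>F n in sequentially. \<delta> n < k / (1 + Y)"
    using c1 k Y by (auto intro!: order_tendstoD(2)[OF \<delta>_lim])
  ultimately have "\<forall>\<^sub>F n in sequentially. \<forall>j\<le>m n.
    integrable M (\<lambda>\<omega>. (cut_euler N n j \<omega> - explicit n j \<omega>)\<^sup>2) \<and> expectation (\<lambda>\<omega>. (cut_euler N n j \<omega> - explicit n j \<omega>)\<^sup>2) \<le> \<kappa>"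
  proof eventually_elim
    fix n
    assume E: "\<forall>j\<le>m n. prob {\<omega> \<in> space M. \<bar>X (g n j) \<omega> - euler n j \<omega>\<bar> > \<theta>} \<le> k / (16 * L)"
      and dc: "\<delta> n < 1 / c" and dY: "\<delta> n < k / (1 + Y)"
    let ?d = "\<lambda>j \<omega>. cut_euler N n j \<omega> - explicit n j \<omega>" and ?w = "\<lambda>j \<omega>. cut_price N n j \<omega> - explicit n j \<omega>"
    have wM[measurable]: "euler n j \<in> borel_measurable M" "cut_price N n j \<in> borel_measurable M" "cut_euler N n j \<in> borel_measurable M"
      "X (g n j) \<in> borel_measurable M" "Measurable.pred M (inside N n j)" if "j \<le> m n" for j
    proof -
      show "cut_price N n j \<in> borel_measurable M" "cut_euler N n j \<in> borel_measurable M"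
        "X (g n j) \<in> borel_measurable M" "Measurable.pred M (inside N n j)"
        using measurable_F_M[OF cut_price_F[OF that]] measurable_F_M[OF cut_euler_F[OF that]] X_M[OF g_in[OF that]]
          measurable_F_M[OF inside_F[OF that]] by auto
      have "X (g n i) \<in> borel_measurable M" "W (g n i) \<in> borel_measurable M" if "i \<le> j" for i
        using that \<open>j \<le> m n\<close> g_in[of i n] g_nonneg[of i n] by (auto intro!: X_M W_measurable_M)
      then show "euler n j \<in> borel_measurable M"
        unfolding euler_def[abs_def]
        by (intro borel_measurable_times borel_measurable_sum
          borel_measurable_add borel_measurable_diff borel_measurable_const) auto
    qed
    have w2: "integrable M (\<lambda>\<omega>. (?w j \<omega>)\<^sup>2)" if j: "j \<le> m n" for j
    proof (rule Bochner_Integration.integrable_bound)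
      show "integrable M (\<lambda>\<omega>. 2 * (real N)\<^sup>2 + 2 * (explicit n j \<omega>)\<^sup>2)" using y2[OF j] by auto
      have "(?w j \<omega>)\<^sup>2 \<le> 2 * (real N)\<^sup>2 + 2 * (explicit n j \<omega>)\<^sup>2" for \<omega>
      proof -
        have "\<bar>cut_price N n j \<omega>\<bar> \<le> real N" by (auto simp: cut_price_def inside_def)
        then have "(cut_price N n j \<omega>)\<^sup>2 \<le> (real N)\<^sup>2" by (simp add: abs_le_square_iff[symmetric])
        moreover have "(?w j \<omega>)\<^sup>2 \<le> 2 * (cut_price N n j \<omega>)\<^sup>2 + 2 * (explicit n j \<omega>)\<^sup>2"
          using zero_le_power2[of "cut_price N n j \<omega> + explicit n j \<omega>"] by (simp add: power2_eq_square algebra_simps)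
        ultimately show ?thesis by linarith
      qed
      then show "AE \<omega> in M. norm ((?w j \<omega>)\<^sup>2) \<le> norm (2 * (real N)\<^sup>2 + 2 * (explicit n j \<omega>)\<^sup>2)"
        by (auto intro: order_trans)
      show "(\<lambda>\<omega>. (?w j \<omega>)\<^sup>2) \<in> borel_measurable M" using wM(2)[OF j] yM[OF j] by auto
    qed
    have wbound: "expectation (\<lambda>\<omega>. (?w j \<omega>)\<^sup>2) \<le> 2 * expectation (\<lambda>\<omega>. (?d j \<omega>)\<^sup>2) + k"
      if j: "j \<le> m n" and d2: "integrable M (\<lambda>\<omega>. (?d j \<omega>)\<^sup>2)" for j
    proof -
      note [measurable] = wM[OF j] yM[OF j]
      let ?B1 = "{\<omega> \<in> space M. \<bar>X (g n j) \<omega> - euler n j \<omega>\<bar> > \<theta>}" and ?B2 = "{\<omega> \<in> space M. \<not> inside N n j \<omega>}"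
      let ?Z = "\<lambda>\<omega>. (real N + explicit n j \<omega>)\<^sup>2"
      have Zi: "integrable M (\<lambda>\<omega>. (?Z \<omega>)\<^sup>2)" "expectation (\<lambda>\<omega>. (?Z \<omega>)\<^sup>2) \<le> Z"
      proof -
        have i: "integrable M (\<lambda>\<omega>. 8 * real N ^ 4 + 8 * (explicit n j \<omega>) ^ 4)" using y4'[OF j] by auto
        have e: "(?Z \<omega>)\<^sup>2 = (real N + explicit n j \<omega>) ^ 4" for \<omega> by (simp flip: power_mult)
        show Zi: "integrable M (\<lambda>\<omega>. (?Z \<omega>)\<^sup>2)"
          unfolding e by (rule Bochner_Integration.integrable_bound[OF i])
            (auto intro: order_trans[OF power4_sum_le] simp: abs_of_nonneg)
        have "expectation (\<lambda>\<omega>. (?Z \<omega>)\<^sup>2) \<le> expectation (\<lambda>\<omega>. 8 * real N ^ 4 + 8 * (explicit n j \<omega>) ^ 4)"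
          using Zi unfolding e by (intro integral_mono i power4_sum_le)
        also have "\<dots> \<le> Z" using y4'[OF j] by (simp add: prob_space Z_def)
        finally show "expectation (\<lambda>\<omega>. (?Z \<omega>)\<^sup>2) \<le> Z" .
      qed
      have "integrable M (\<lambda>\<omega>. ((explicit n j \<omega>)\<^sup>2)\<^sup>2)" using y4'(1)[OF j] by (simp flip: power_mult)
      note T1 = expectation_truncation[of ?Z ?B1 L, OF _ _ Zi(1) L(1)]
        and T2 = expectation_truncation[of "\<lambda>\<omega>. (explicit n j \<omega>)\<^sup>2" ?B2 L', OF _ _ this L'(1)]
      have T1': "integrable M (\<lambda>\<omega>. ?Z \<omega> * indicator ?B1 \<omega>)" "expectation (\<lambda>\<omega>. ?Z \<omega> * indicator ?B1 \<omega>) \<le> k / 8"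
      proof -
        show "integrable M (\<lambda>\<omega>. ?Z \<omega> * indicator ?B1 \<omega>)" by (rule T1) auto
        have "expectation (\<lambda>\<omega>. ?Z \<omega> * indicator ?B1 \<omega>) \<le> L * prob ?B1 + expectation (\<lambda>\<omega>. (?Z \<omega>)\<^sup>2) / L"
          by (rule T1) auto
        also have "\<dots> \<le> L * (k / (16 * L)) + Z / L"
          using E j Zi L by (intro add_mono mult_left_mono divide_right_mono) auto
        finally show "expectation (\<lambda>\<omega>. ?Z \<omega> * indicator ?B1 \<omega>) \<le> k / 8" using L by simp
      qed
      have T2': "integrable M (\<lambda>\<omega>. (explicit n j \<omega>)\<^sup>2 * indicator ?B2 \<omega>)" "expectation (\<lambda>\<omega>. (explicit n j \<omega>)\<^sup>2 * indicator ?B2 \<omega>) \<le> k / 2"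
      proof -
        show "integrable M (\<lambda>\<omega>. (explicit n j \<omega>)\<^sup>2 * indicator ?B2 \<omega>)" by (rule T2) auto
        have "expectation (\<lambda>\<omega>. (explicit n j \<omega>)\<^sup>2 * indicator ?B2 \<omega>) \<le> L' * prob ?B2 + expectation (\<lambda>\<omega>. ((explicit n j \<omega>)\<^sup>2)\<^sup>2) / L'"
          by (rule T2) auto
        also have "\<dots> \<le> L' * prob (exits N) + Y / L'"
          using prob_not_inside[OF j] y4'(2)[OF j] L' by (intro add_mono mult_left_mono divide_right_mono) (auto simp flip: power_mult)
        also have "\<dots> \<le> k / 2" using N(2) L'(2) by simp
        finally show "expectation (\<lambda>\<omega>. (explicit n j \<omega>)\<^sup>2 * indicator ?B2 \<omega>) \<le> k / 2" .
      qed
      \<comment> \<open>Three cases: a price within \<open>N\<close> and near its Riemann sum adds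
        \<open>2 * \<theta>\<^sup>2\<close>; within \<open>N\<close> but far from that sum is the
        rare event \<open>?B1\<close>; beyond \<open>N\<close> the cut price is 0 and only the
        exponential scheme remains, on the event \<open>?B2\<close>.\<close>
      have pw: "(?w j \<omega>)\<^sup>2 \<le> 2 * (?d j \<omega>)\<^sup>2 + (2 * \<theta>\<^sup>2 + (2 * (?Z \<omega> * indicator ?B1 \<omega>) + (explicit n j \<omega>)\<^sup>2 * indicator ?B2 \<omega>))"
        if \<omega>: "\<omega> \<in> space M" for \<omega>
      proof (cases "inside N n j \<omega>")
        case False
        then show ?thesis using \<omega> by (simp add: cut_price_def)
      next
        case True
        then have [simp]: "cut_price N n j \<omega> = X (g n j) \<omega>" by (simp add: cut_price_def)
        have xx: "cut_euler N n j \<omega> = euler n j \<omega>" using True by (intro cut_euler_eq_euler) (auto intro: inside_mono)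
        show ?thesis
        proof (cases "\<omega> \<in> ?B1")
          case False
          then have "\<bar>X (g n j) \<omega> - euler n j \<omega>\<bar> \<le> \<theta>" using \<omega> by simp
          then have "(X (g n j) \<omega> - euler n j \<omega>)\<^sup>2 \<le> \<theta>\<^sup>2" using \<theta>(1) by (simp add: abs_le_square_iff[symmetric])
          moreover have "(?w j \<omega>)\<^sup>2 \<le> 2 * (?d j \<omega>)\<^sup>2 + 2 * (X (g n j) \<omega> - euler n j \<omega>)\<^sup>2"
            using zero_le_power2[of "?d j \<omega> - (X (g n j) \<omega> - euler n j \<omega>)"] unfolding xx
            by (simp add: power2_eq_square algebra_simps)
          ultimately show ?thesis using \<omega> False True by simp
        next
          case B: True
          have "\<bar>X (g n j) \<omega>\<bar> \<le> real N" using True by (auto simp: inside_def)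
          then have "\<bar>?w j \<omega>\<bar> \<le> real N + explicit n j \<omega>" using explicit_pos[of n j \<omega>] by simp
          then have "(?w j \<omega>)\<^sup>2 \<le> ?Z \<omega>" by (simp only: power2_le_iff_abs_le abs_ge_zero order_trans[OF abs_ge_zero])
          moreover have "0 \<le> 2 * (?d j \<omega>)\<^sup>2" "0 \<le> 2 * \<theta>\<^sup>2" "0 \<le> (explicit n j \<omega>)\<^sup>2 * indicator ?B2 \<omega>" "0 \<le> ?Z \<omega>" by auto
          moreover have "?Z \<omega> * indicator ?B1 \<omega> = ?Z \<omega>" using B by simp
          ultimately show ?thesis by linarith
        qed
      qed
      have "expectation (\<lambda>\<omega>. (?w j \<omega>)\<^sup>2) \<le> expectation (\<lambda>\<omega>. 2 * (?d j \<omega>)\<^sup>2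
          + (2 * \<theta>\<^sup>2 + (2 * (?Z \<omega> * indicator ?B1 \<omega>) + (explicit n j \<omega>)\<^sup>2 * indicator ?B2 \<omega>)))"
        using w2[OF j] d2 T1' T2' by (intro integral_mono pw) auto
      also have "\<dots> = 2 * expectation (\<lambda>\<omega>. (?d j \<omega>)\<^sup>2) + (2 * \<theta>\<^sup>2 + (2 * expectation (\<lambda>\<omega>. ?Z \<omega> * indicator ?B1 \<omega>)
          + expectation (\<lambda>\<omega>. (explicit n j \<omega>)\<^sup>2 * indicator ?B2 \<omega>)))"
        using d2 T1'(1) T2'(1) by (simp add: prob_space)
      also have "\<dots> \<le> 2 * expectation (\<lambda>\<omega>. (?d j \<omega>)\<^sup>2) + k"
        using T1'(2) T2'(2) \<theta>(2) k by simp
      finally show ?thesis .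
    qed
    have "integrable M (\<lambda>\<omega>. (?d j \<omega>)\<^sup>2) \<and> expectation (\<lambda>\<omega>. (?d j \<omega>)\<^sup>2) \<le> k * (exp (8 * c\<^sup>2 * (g n j - t)) - 1)"
      if "j \<le> m n" for j
      using that
    proof (induction j)
      case 0 then show ?case by (simp add: cut_euler_def explicit_def g_0)
    next
      case (Suc j)
      then have j: "j \<le> m n" "j < m n" by auto
      have d2: "integrable M (\<lambda>\<omega>. (?d j \<omega>)\<^sup>2)" and IH: "expectation (\<lambda>\<omega>. (?d j \<omega>)\<^sup>2) \<le> k * (exp (8 * c\<^sup>2 * (g n j - t)) - 1)"
        using Suc j by auto
      have D: "0 \<le> dt n j" "dt n j \<le> \<delta> n" using g_step[OF j(2)] g_mesh[OF j(2)] by auto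
      have cD: "c * dt n j \<le> 1"
      proof -
        have "c * dt n j \<le> c * (1 / c)" using D dc c1 by (intro mult_left_mono) auto
        then show ?thesis using c1 by simp
      qed
      have eq: "?d (Suc j) \<omega> = ?d j \<omega> + ?w j \<omega> * (r * dt n j + \<sigma> (g n j) * dW n j \<omega>)
        - explicit n j \<omega> * (exp ((r - (\<sigma> (g n j))\<^sup>2 / 2) * dt n j + \<sigma> (g n j) * dW n j \<omega>) - 1 - (r * dt n j + \<sigma> (g n j) * dW n j \<omega>))" for \<omega>
        by (simp add: cut_euler_def explicit_Suc algebra_simps)
      have dF: "?d j \<in> borel_measurable (F (g n j))" "?w j \<in> borel_measurable (F (g n j))"
        using cut_euler_F[OF j(1)] explicit_F[OF j(1)] cut_price_F[OF j(1)] by auto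
      note st = euler_step[OF g_nonneg[OF j(1)] g_step[OF j(2)] less_imp_le[OF r0] S(1)[OF g_in[OF j(1)]] c_def cD
          dF explicit_F[OF j(1)] d2 w2[OF j(1)] y2(1)[OF j(1)], folded eq]
      let ?a = "c\<^sup>2 * dt n j" and ?D = "expectation (\<lambda>\<omega>. (?d j \<omega>)\<^sup>2)"
      have a: "0 \<le> ?a" using D by simp
      have "expectation (\<lambda>\<omega>. (?d (Suc j) \<omega>)\<^sup>2) \<le> (1 + 2 * ?a) * ?D
          + 3 * ?a * expectation (\<lambda>\<omega>. (?w j \<omega>)\<^sup>2) + 3 * ?a * (dt n j * expectation (\<lambda>\<omega>. (explicit n j \<omega>)\<^sup>2))"
        using st(2) by (simp only: mult.assoc power2_eq_square[of "dt n j"])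
      \<comment> \<open>Here the numbers of \<open>gronwall_step\<close> arise:
        \<open>2 + 3 * 2 = 8\<close> multiplies the error and \<open>3 + 3 = 6\<close> the source
        term.\<close>
      also have "\<dots> \<le> (1 + 2 * ?a) * ?D + 3 * ?a * (2 * ?D + k) + 3 * ?a * k"
      proof (intro add_mono mult_left_mono order_refl)
        show "expectation (\<lambda>\<omega>. (?w j \<omega>)\<^sup>2) \<le> 2 * ?D + k" by (rule wbound[OF j(1) d2])
        have "dt n j * expectation (\<lambda>\<omega>. (explicit n j \<omega>)\<^sup>2) \<le> (k / (1 + Y)) * (1 + Y)"
          using D dY y2[OF j(1)] Y k by (intro mult_mono) auto
        then show "dt n j * expectation (\<lambda>\<omega>. (explicit n j \<omega>)\<^sup>2) \<le> k" using Y by simp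
      qed (use a in auto)
      also have "\<dots> = (1 + 8 * ?a) * ?D + 6 * ?a * k" by (simp add: algebra_simps)
      finally have "expectation (\<lambda>\<omega>. (?d (Suc j) \<omega>)\<^sup>2) \<le> (1 + 8 * ?a) * ?D + 6 * ?a * k" .
      then have "expectation (\<lambda>\<omega>. (?d (Suc j) \<omega>)\<^sup>2) \<le> k * (exp (8 * c\<^sup>2 * (g n j - t)) * exp (8 * ?a) - 1)"
        using a k IH g_in[OF j(1)] by (intro gronwall_step[where D = ?D]) auto
      also have "exp (8 * c\<^sup>2 * (g n j - t)) * exp (8 * ?a) = exp (8 * c\<^sup>2 * (g n (Suc j) - t))"
        by (simp add: exp_add[symmetric] algebra_simps)
      finally show ?case using st(1) by simp
    qed
    moreover have "k * (exp (8 * c\<^sup>2 * (g n j - t)) - 1) \<le> \<kappa>" if "j \<le> m n" for j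
    proof -
      have "exp (8 * c\<^sup>2 * (g n j - t)) \<le> C" unfolding C_def using g_in[OF that] by (auto intro!: mult_left_mono)
      then have "k * (exp (8 * c\<^sup>2 * (g n j - t)) - 1) \<le> k * C" using k by (intro mult_left_mono) auto
      also have "\<dots> = \<kappa>" using C by (simp add: k_def)
      finally show ?thesis .
    qed
    ultimately show "\<forall>j\<le>m n. integrable M (\<lambda>\<omega>. (?d j \<omega>)\<^sup>2) \<and> expectation (\<lambda>\<omega>. (?d j \<omega>)\<^sup>2) \<le> \<kappa>"
      by (meson order_trans)
  qed
  then show ?thesis using N(1) by blast
qed

text \<open>Outside \<open>exits N\<close> the cut-off scheme is the plain Riemann sum. The price is
  near that sum by \<open>euler_error\<close>, and the sum is near the exponential scheme by
  Chebyshev's inequality.\<close>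

lemma grid_convergence:
  assumes "0 < \<epsilon>" "0 < \<kappa>"
  shows "\<forall>\<^sub>F n in sequentially. \<forall>j\<le>m n. prob {\<omega> \<in> space M. \<bar>X (g n j) \<omega> - explicit n j \<omega>\<bar> > \<epsilon>} \<le> \<kappa>"
proof -
  define k where "k = min (\<kappa> / 3) (\<kappa> / 3 * (\<epsilon> / 2)\<^sup>2)"
  have k: "0 < k" "k \<le> \<kappa> / 3" "k / (\<epsilon> / 2)\<^sup>2 \<le> \<kappa> / 3" using assms by (auto simp: k_def field_simps min_def)
  obtain N where N: "prob (exits N) \<le> k" and d: "\<forall>\<^sub>F n in sequentially. \<forall>j\<le>m n.
    integrable M (\<lambda>\<omega>. (cut_euler N n j \<omega> - explicit n j \<omega>)\<^sup>2) \<and> expectation (\<lambda>\<omega>. (cut_euler N n j \<omega> - explicit n j \<omega>)\<^sup>2) \<le> k"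
    using truncated_scheme_close[OF k(1)] by blast
  have "\<forall>\<^sub>F n in sequentially. \<forall>j\<le>m n. prob {\<omega> \<in> space M. \<bar>X (g n j) \<omega> - euler n j \<omega>\<bar> > \<epsilon> / 2} \<le> \<kappa> / 3"
    using assms by (intro euler_error) auto
  with d show ?thesis
  proof eventually_elim
    fix n
    assume d: "\<forall>j\<le>m n. integrable M (\<lambda>\<omega>. (cut_euler N n j \<omega> - explicit n j \<omega>)\<^sup>2) \<and> expectation (\<lambda>\<omega>. (cut_euler N n j \<omega> - explicit n j \<omega>)\<^sup>2) \<le> k"
      and e: "\<forall>j\<le>m n. prob {\<omega> \<in> space M. \<bar>X (g n j) \<omega> - euler n j \<omega>\<bar> > \<epsilon> / 2} \<le> \<kappa> / 3"
    show "\<forall>j\<le>m n. prob {\<omega> \<in> space M. \<bar>X (g n j) \<omega> - explicit n j \<omega>\<bar> > \<epsilon>} \<le> \<kappa>"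
    proof (intro allI impI)
      fix j assume j: "j \<le> m n"
      have [measurable]: "cut_euler N n j \<in> borel_measurable M" "explicit n j \<in> borel_measurable M" "X (g n j) \<in> borel_measurable M"
        using measurable_F_M[OF cut_euler_F[OF j]] measurable_F_M[OF explicit_F[OF j]] X_M[OF g_in[OF j]] by auto
      have [measurable]: "euler n j \<in> borel_measurable M"
      proof -
        have "X (g n i) \<in> borel_measurable M" "W (g n i) \<in> borel_measurable M" if "i \<le> j" for i
          using that j g_in[of i n] g_nonneg[of i n] by (auto intro!: X_M W_measurable_M)
        then show ?thesis
          unfolding euler_def[abs_def]
          by (intro borel_measurable_times borel_measurable_sum
            borel_measurable_add borel_measurable_diff borel_measurable_const) auto
      qed
      let ?E = "{\<omega> \<in> space M. \<bar>X (g n j) \<omega> - euler n j \<omega>\<bar> > \<epsilon> / 2}"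
        and ?D = "{\<omega> \<in> space M. (cut_euler N n j \<omega> - explicit n j \<omega>)\<^sup>2 \<ge> (\<epsilon> / 2)\<^sup>2}"
      have "prob {\<omega> \<in> space M. \<bar>X (g n j) \<omega> - explicit n j \<omega>\<bar> > \<epsilon>} \<le> prob (exits N \<union> (?E \<union> ?D))"
      proof (intro finite_measure_mono subsetI)
        fix \<omega> assume w: "\<omega> \<in> {\<omega> \<in> space M. \<bar>X (g n j) \<omega> - explicit n j \<omega>\<bar> > \<epsilon>}"
        then have \<omega>: "\<omega> \<in> space M" by simp
        show "\<omega> \<in> exits N \<union> (?E \<union> ?D)"
        proof (rule ccontr)
          assume n: "\<omega> \<notin> exits N \<union> (?E \<union> ?D)"
          then have "inside N n j \<omega>" using not_inside_exits[OF \<omega> j] by blast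
          then have "cut_euler N n j \<omega> = euler n j \<omega>" by (intro cut_euler_eq_euler) (auto intro: inside_mono)
          moreover have "\<bar>cut_euler N n j \<omega> - explicit n j \<omega>\<bar> < \<epsilon> / 2"
          proof (rule ccontr)
            assume "\<not> \<bar>cut_euler N n j \<omega> - explicit n j \<omega>\<bar> < \<epsilon> / 2"
            then have "(\<epsilon> / 2)\<^sup>2 \<le> \<bar>cut_euler N n j \<omega> - explicit n j \<omega>\<bar>\<^sup>2" using assms(1) by (intro power_mono) auto
            then show False using n \<omega> by simp
          qed
          moreover have "\<bar>X (g n j) \<omega> - euler n j \<omega>\<bar> \<le> \<epsilon> / 2" "\<bar>X (g n j) \<omega> - explicit n j \<omega>\<bar> > \<epsilon>" using n w by auto
          ultimately show False by linarith
        qed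
      qed measurable
      also have "\<dots> \<le> prob (exits N) + prob (?E \<union> ?D)" by (intro measure_Un_le) auto
      also have "prob (?E \<union> ?D) \<le> prob ?E + prob ?D" by (intro measure_Un_le) auto
      also have "prob ?D \<le> expectation (\<lambda>\<omega>. (cut_euler N n j \<omega> - explicit n j \<omega>)\<^sup>2) / (\<epsilon> / 2)\<^sup>2"
        using d j assms by (intro integral_Markov_inequality_measure[where A="{}"]) auto
      also have "\<dots> \<le> k / (\<epsilon> / 2)\<^sup>2" using d j by (intro divide_right_mono) auto
      finally show "prob {\<omega> \<in> space M. \<bar>X (g n j) \<omega> - explicit n j \<omega>\<bar> > \<epsilon>} \<le> \<kappa>"
        using N k e[rule_format, OF j] by linarith
    qed
  qed
qed

end

section \<open>The limit of the transition law\<close>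

lemma tendsto_gauss:
  assumes k: "continuous_on UNIV k" "\<And>z. \<bar>k z\<bar> \<le> C" and "V \<longlonglongrightarrow> v" "Z \<longlonglongrightarrow> z"
  shows "(\<lambda>n. gauss (V n) k (Z n)) \<longlonglongrightarrow> gauss v k z"
  unfolding gauss_def
proof (rule integral_dominated_convergence[where w = "\<lambda>_. C"])
  have [measurable]: "k \<in> borel_measurable borel" using k(1) by (rule borel_measurable_continuous_onI)
  show "(\<lambda>y. k (z + sqrt v * y)) \<in> borel_measurable stdn" "(\<lambda>y. k (Z n + sqrt (V n) * y)) \<in> borel_measurable stdn" for n
    by measurable
  have "(\<lambda>n. k (Z n + sqrt (V n) * y)) \<longlonglongrightarrow> k (z + sqrt v * y)" for y
    using assms(3,4) by (intro continuous_on_tendsto_compose[OF k(1)] tendsto_intros) auto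
  then show "AE y in stdn. (\<lambda>n. k (Z n + sqrt (V n) * y)) \<longlonglongrightarrow> k (z + sqrt v * y)" by simp
qed (use k in auto)

text \<open>Boundedness upgrades convergence in probability to convergence in mean, which has an
  almost surely convergent subsequence.\<close>

lemma (in prob_space) tendsto_prob_AE_subseq:
  fixes D :: "nat \<Rightarrow> 'a \<Rightarrow> real"
  assumes [measurable]: "\<And>n. D n \<in> borel_measurable M" and D: "\<And>n \<omega>. 0 \<le> D n \<omega>" "\<And>n \<omega>. D n \<omega> \<le> C"
    and lim: "\<And>\<epsilon> \<kappa>. 0 < \<epsilon> \<Longrightarrow> 0 < \<kappa> \<Longrightarrow> \<forall>\<^sub>F n in sequentially. prob {\<omega> \<in> space M. D n \<omega> > \<epsilon>} \<le> \<kappa>"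
  shows "\<exists>f. strict_mono f \<and> (AE \<omega> in M. (\<lambda>n. D (f n) \<omega>) \<longlonglongrightarrow> 0)"
proof (rule tendsto_L1_AE_subseq)
  have C: "0 \<le> C" using D[of 0 undefined] by linarith
  show i: "integrable M (D n)" for n using D C by (intro integrable_const_bound[of _ C]) auto
  show "(\<lambda>n. expectation (\<lambda>\<omega>. norm (D n \<omega>))) \<longlonglongrightarrow> 0"
  proof (rule LIMSEQ_I)
    fix e :: real assume e: "0 < e"
    define c where "c = C + 1"
    have c: "0 < c" "C \<le> c" using C by (auto simp: c_def)
    define \<kappa> where "\<kappa> = e / (4 * c)"
    have \<kappa>: "0 < \<kappa>" "C * \<kappa> \<le> e / 4"
    proof -
      show "0 < \<kappa>" using e c by (simp add: \<kappa>_def)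
      have "C * \<kappa> \<le> c * \<kappa>" using \<open>0 < \<kappa>\<close> c by (intro mult_right_mono) auto
      also have "\<dots> = e / 4" using c by (simp add: \<kappa>_def)
      finally show "C * \<kappa> \<le> e / 4" .
    qed
    have "\<forall>\<^sub>F n in sequentially. prob {\<omega> \<in> space M. D n \<omega> > e / 4} \<le> \<kappa>" using e \<kappa> by (intro lim) auto
    then obtain n0 where n0: "\<And>n. n \<ge> n0 \<Longrightarrow> prob {\<omega> \<in> space M. D n \<omega> > e / 4} \<le> \<kappa>"
      by (auto simp: eventually_sequentially)
    have "norm (expectation (\<lambda>\<omega>. norm (D n \<omega>)) - 0) < e" if "n \<ge> n0" for n
    proof -
      let ?B = "{\<omega> \<in> space M. D n \<omega> > e / 4}"
      have "expectation (D n) \<le> expectation (\<lambda>\<omega>. e / 4 + C * indicator ?B \<omega>)"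
      proof (intro integral_mono i)
        show "D n \<omega> \<le> e / 4 + C * indicator ?B \<omega>" if "\<omega> \<in> space M" for \<omega>
          using D(2)[of n \<omega>] e that by (cases "D n \<omega> > e / 4") auto
      qed (auto simp: emeasure_eq_measure)
      also have "\<dots> = e / 4 + C * prob ?B" by (simp add: prob_space emeasure_eq_measure)
      also have "\<dots> \<le> e / 4 + C * \<kappa>" using n0[OF that] C by (intro add_left_mono mult_left_mono) auto
      also have "\<dots> < e" using \<kappa> e by simp
      finally show ?thesis using D by simp
    qed
    then show "\<exists>no. \<forall>n\<ge>no. norm (expectation (\<lambda>\<omega>. norm (D n \<omega>)) - 0) < e" by blast
  qed
qed

lemma sum_diff_add: "(\<Sum>i\<in>A. a i - b i + c i) = sum a A - sum b A + sum c A" for a b c :: "'b \<Rightarrow> real"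
  by (simp add: sum.distrib sum_subtractf)

context bm
begin

text \<open>Induction on the last increment: \<open>gauss_increment\<close> integrates it out, and
  the semigroup adds its variance to the rest.\<close>

lemma gauss_increments:
  assumes p: "0 \<le> p j" "\<And>i. j \<le> i \<Longrightarrow> i < j' \<Longrightarrow> p i \<le> p (Suc i)" and "j \<le> j'"
    and c: "\<And>i. j \<le> i \<Longrightarrow> i < j' \<Longrightarrow> 0 \<le> c i"
    and A: "A \<in> sets (F (p j))" and Y: "Y \<in> borel_measurable (F (p j))"
    and "k \<in> borel_measurable borel" "\<And>z. \<bar>k z\<bar> \<le> C"
  shows "expectation (\<lambda>\<omega>. indicator A \<omega> * k (Y \<omega> + (\<Sum>i=j..<j'. c i * (W (p (Suc i)) \<omega> - W (p i) \<omega>))))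
    = expectation (\<lambda>\<omega>. indicator A \<omega> * gauss (\<Sum>i=j..<j'. (c i)\<^sup>2 * (p (Suc i) - p i)) k (Y \<omega>))"
  using \<open>j \<le> j'\<close> p(2) c assms(7,8)
proof (induction j' arbitrary: k rule: dec_induct)
  case base
  then show ?case by (simp add: gauss_def stdn.prob_space[simplified])
next
  case (step n)
  have mono: "p j \<le> p i" if "j \<le> i" "i \<le> Suc n" for i
    using that step.prems(1)
  proof (induction i rule: dec_induct)
    case (step i) then show ?case using step.prems(2)[of i] by fastforce
  qed simp
  have meas: "(\<lambda>\<omega>. Y \<omega> + (\<Sum>i=j..<n. c i * (W (p (Suc i)) \<omega> - W (p i) \<omega>))) \<in> borel_measurable (F (p n))"
  proof (intro borel_measurable_add borel_measurable_sum borel_measurable_times borel_measurable_const borel_measurable_diff)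
    show "Y \<in> borel_measurable (F (p n))" using step.hyps mono[of n] by (intro measurable_F_mono[OF Y]) auto
    fix i assume "i \<in> {j..<n}"
    then have i: "j \<le> i" "i < n" by auto
    have "p i' \<le> p n" if "j \<le> i'" "i' \<le> n" for i'
      using that(2,1) step.prems(1)
    proof (induction i' rule: inc_induct)
      case (step i') then show ?case using step.prems(2)[of i'] by fastforce
    qed simp
    then show "W (p (Suc i)) \<in> borel_measurable (F (p n))" "W (p i) \<in> borel_measurable (F (p n))"
      using i mono[of i] mono[of "Suc i"] p(1) by (auto intro!: W_measurable)
  qed
  have "A \<in> sets (F (p n))" using A sets_F_mono[OF mono[of n]] step.hyps by auto
  from gauss_increment[OF _ _ _ this meas step.prems(3,4), of "p (Suc n)" "c n"]
  have "expectation (\<lambda>\<omega>. indicator A \<omega> * k (Y \<omega> + (\<Sum>i=j..<Suc n. c i * (W (p (Suc i)) \<omega> - W (p i) \<omega>))))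
    = expectation (\<lambda>\<omega>. indicator A \<omega> * gauss ((c n)\<^sup>2 * (p (Suc n) - p n)) k (Y \<omega> + (\<Sum>i=j..<n. c i * (W (p (Suc i)) \<omega> - W (p i) \<omega>))))"
    using step.hyps step.prems(1,2)[of n] mono[of n] p(1) by (simp add: add.assoc)
  also have "\<dots> = expectation (\<lambda>\<omega>. indicator A \<omega> * gauss (\<Sum>i=j..<n. (c i)\<^sup>2 * (p (Suc i) - p i))
      (gauss ((c n)\<^sup>2 * (p (Suc n) - p n)) k) (Y \<omega>))"
    using step.prems by (intro step.IH gauss_bound borel_measurable_gauss) auto
  also have "\<dots> = expectation (\<lambda>\<omega>. indicator A \<omega> * gauss (\<Sum>i=j..<Suc n. (c i)\<^sup>2 * (p (Suc i) - p i)) k (Y \<omega>))"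
    using step.hyps step.prems(1)
    by (subst gauss_semigroup)
      (auto intro!: sum_nonneg mult_nonneg_nonneg stdn.integrable_const_bound[of _ C] step.prems AE_I2
        measurable_compose[OF _ step.prems(3)] simp: less_Suc_eq)
  finally show ?case .
qed

end

context gbm_grid
begin

lemma sum_sq_tendsto:
  assumes f: "continuous_on {t..u} f" and j: "\<And>n. j n \<le> j' n" "\<And>n. j' n \<le> m n"
    and s: "\<And>n. g n (j n) = s" "\<And>n. g n (j' n) = s'"
  shows "(\<lambda>n. \<Sum>i=j n..<j' n. f (g n i) * dt n i) \<longlonglongrightarrow> integral {s..s'} f"
proof (rule LIMSEQ_I)
  fix e :: real assume e: "0 < e"
  have ss: "s \<in> {t..u}" "s' \<in> {t..u}" "s \<le> s'"
    using g_in[of "j 0" 0] g_in[of "j' 0" 0] g_mono[of "j 0" "j' 0" 0] j[of 0] s[of 0] by auto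
  define \<theta> where "\<theta> = e / (2 * (s' - s + 1))"
  define c where "c = s' - s + 1"
  have c: "0 < c" "s' - s \<le> c" using ss by (auto simp: c_def)
  have \<theta>: "0 < \<theta>" "\<theta> * (s' - s) < e"
  proof -
    show "0 < \<theta>" using e c by (simp add: \<theta>_def flip: c_def)
    have "\<theta> * (s' - s) \<le> \<theta> * c" using c \<open>0 < \<theta>\<close> by (intro mult_left_mono) auto
    also have "\<dots> = e / 2" using c by (simp add: \<theta>_def flip: c_def)
    finally show "\<theta> * (s' - s) < e" using e by simp
  qed
  have "uniformly_continuous_on {t..u} f"
    using f by (intro compact_uniformly_continuous) auto
  then obtain d where d: "0 < d"
    "\<And>a b. a \<in> {t..u} \<Longrightarrow> b \<in> {t..u} \<Longrightarrow> dist b a < d \<Longrightarrow> dist (f b) (f a) < \<theta>"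
    using \<theta>(1) unfolding uniformly_continuous_on_def by metis
  have "\<forall>\<^sub>F n in sequentially. \<delta> n < d" using \<delta>_lim d(1) by (intro order_tendstoD) auto
  then obtain n0 where n0: "\<And>n. n \<ge> n0 \<Longrightarrow> \<delta> n < d" by (auto simp: eventually_sequentially)
  have "norm ((\<Sum>i=j n..<j' n. f (g n i) * dt n i) - integral {s..s'} f) < e" if "n \<ge> n0" for n
  proof -
    have "\<bar>(\<Sum>i=j n..<l. f (g n i) * dt n i) - integral {g n (j n)..g n l} f\<bar> \<le> \<theta> * (g n l - g n (j n))"
      if "j n \<le> l" "l \<le> j' n" for l
      using that
    proof (induction l rule: dec_induct)
      case (step l)
      have l: "l \<le> m n" "Suc l \<le> m n" "l < m n" "j n \<le> m n" using step j[of n] by auto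
      have fi: "f integrable_on {a..b}" if "t \<le> a" "b \<le> u" for a b
        using that by (intro integrable_continuous_real continuous_on_subset[OF f]) auto
      have "integral {g n (j n)..g n l} f + integral {g n l..g n (Suc l)} f = integral {g n (j n)..g n (Suc l)} f"
        using g_in[OF l(4)] g_in[OF l(2)] g_mono[OF step.hyps(1) l(1)] g_step[OF l(3)]
        by (intro Henstock_Kurzweil_Integration.integral_combine fi) auto
      moreover have "\<bar>f (g n l) * dt n l - integral {g n l..g n (Suc l)} f\<bar> \<le> \<theta> * dt n l"
      proof -
        have "f (g n l) * dt n l - integral {g n l..g n (Suc l)} f = integral {g n l..g n (Suc l)} (\<lambda>a. f (g n l) - f a)"
          using g_in[OF l(1)] g_in[OF l(2)] g_step[OF l(3)]
          by (subst integral_diff) (auto intro!: fi simp: mult.commute)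
        also have "norm \<dots> \<le> \<theta> * dt n l"
          using g_in[OF l(1)] g_in[OF l(2)] g_step[OF l(3)]
        proof (intro integral_bound)
          show "continuous_on {g n l..g n (Suc l)} (\<lambda>a. f (g n l) - f a)"
            using g_in[OF l(1)] g_in[OF l(2)] by (intro continuous_intros continuous_on_subset[OF f]) auto
          show "norm (f (g n l) - f a) \<le> \<theta>" if "a \<in> {g n l..g n (Suc l)}" for a
            using d(2)[of a "g n l"] that g_in[OF l(1)] g_in[OF l(2)] g_mesh[OF l(3)] n0[OF \<open>n \<ge> n0\<close>]
            by (auto simp: dist_real_def)
        qed auto
        finally show ?thesis by simp
      qed
      ultimately show ?case using step by (auto simp: algebra_simps)
    qed simp
    from this[OF j(1) order_refl] show ?thesis using s \<theta>(2) by simp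
  qed
  then show "\<exists>no. \<forall>n\<ge>no. norm ((\<Sum>i=j n..<j' n. f (g n i) * dt n i) - integral {s..s'} f) < e" by blast
qed

lemma ln_explicit: "ln (explicit n j \<omega>) = ln x + (\<Sum>i<j. (r - (\<sigma> (g n i))\<^sup>2 / 2) * dt n i + \<sigma> (g n i) * dW n i \<omega>)"
  using x0 by (simp add: explicit_def ln_mult)

lemma explicit_M: "j \<le> m n \<Longrightarrow> explicit n j \<in> borel_measurable M"
  using explicit_F measurable_F_M by blast

lemma sum_dt: "j \<le> j' \<Longrightarrow> (\<Sum>i=j..<j'. dt n i) = g n j' - g n j"
  by (rule sum_Suc_diff')

lemma ln_explicit_step:
  assumes "j \<le> j'"
  shows "ln (explicit n j' \<omega>) = (ln (explicit n j \<omega>) + (r * (g n j' - g n j) - (\<Sum>i=j..<j'. (\<sigma> (g n i))\<^sup>2 * dt n i) / 2))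
    + (\<Sum>i=j..<j'. \<sigma> (g n i) * dW n i \<omega>)"
proof -
  have "(\<Sum>i<j'. (r - (\<sigma> (g n i))\<^sup>2 / 2) * dt n i + \<sigma> (g n i) * dW n i \<omega>)
    = (\<Sum>i<j. (r - (\<sigma> (g n i))\<^sup>2 / 2) * dt n i + \<sigma> (g n i) * dW n i \<omega>)
    + (\<Sum>i=j..<j'. (r - (\<sigma> (g n i))\<^sup>2 / 2) * dt n i + \<sigma> (g n i) * dW n i \<omega>)"
    using assms by (simp add: lessThan_atLeast0 sum.atLeastLessThan_concat)
  also have "(\<Sum>i=j..<j'. (r - (\<sigma> (g n i))\<^sup>2 / 2) * dt n i + \<sigma> (g n i) * dW n i \<omega>)
    = (\<Sum>i=j..<j'. r * dt n i - (\<sigma> (g n i))\<^sup>2 * dt n i / 2 + \<sigma> (g n i) * dW n i \<omega>)"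
    by (intro sum.cong refl) (simp add: left_diff_distrib)
  also have "\<dots> = r * (\<Sum>i=j..<j'. dt n i) - (\<Sum>i=j..<j'. (\<sigma> (g n i))\<^sup>2 * dt n i) / 2 + (\<Sum>i=j..<j'. \<sigma> (g n i) * dW n i \<omega>)"
    unfolding sum_distrib_left sum_divide_distrib by (rule sum_diff_add)
  finally show ?thesis by (simp add: ln_explicit sum_dt[OF assms])
qed

lemma explicit_transition:
  assumes j: "j \<le> j'" "j' \<le> m n" and \<sigma>0: "\<And>s. s \<in> {t..u} \<Longrightarrow> 0 \<le> \<sigma> s"
    and A: "A \<in> sets (F (g n j))" and k: "k \<in> borel_measurable borel" "\<And>z. \<bar>k z\<bar> \<le> C"
  shows "expectation (\<lambda>\<omega>. indicator A \<omega> * k (ln (explicit n j' \<omega>)))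
    = expectation (\<lambda>\<omega>. indicator A \<omega> * gauss (\<Sum>i=j..<j'. (\<sigma> (g n i))\<^sup>2 * dt n i) k
      (ln (explicit n j \<omega>) + (r * (g n j' - g n j) - (\<Sum>i=j..<j'. (\<sigma> (g n i))\<^sup>2 * dt n i) / 2)))"
  unfolding ln_explicit_step[OF j(1)]
  using j g_nonneg[of j n] A g_in
  by (intro gauss_increments[where C=C] k)
    (auto intro!: g_step \<sigma>0 explicit_F borel_measurable_ln[THEN measurable_compose[rotated]] borel_measurable_add)

text \<open>A limit of positive variables might be 0. A bound on the lower tails of the exponential
  scheme, uniform over the grids, excludes this.\<close>

lemma X_pos_AE:
  assumes j: "\<And>n. j n \<le> m n" and s: "\<And>n. g n (j n) = s" and \<sigma>0: "\<And>s. s \<in> {t..u} \<Longrightarrow> 0 \<le> \<sigma> s"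
  shows "AE \<omega> in M. 0 < X s \<omega>"
proof -
  have sin: "s \<in> {t..u}" using g_in[OF j[of 0]] s by simp
  have [measurable]: "X s \<in> borel_measurable M" by (rule X_M[OF sin])
  let ?V = "\<lambda>n. \<Sum>i=0..<j n. (\<sigma> (g n i))\<^sup>2 * dt n i"
  have "?V \<longlonglongrightarrow> integral {t..s} (\<lambda>s. (\<sigma> s)\<^sup>2)"
    using j s by (intro sum_sq_tendsto) (auto intro!: continuous_intros \<sigma>_cont simp: g_0)
  then have "Bseq ?V" by (rule convergentI[THEN convergent_imp_Bseq])
  then obtain B where B: "\<And>n. \<bar>?V n\<bar> \<le> B" by (auto simp: Bseq_def)
  \<comment> \<open>Markov's inequality for the reciprocal of \<open>explicit\<close>, whose mean is
    controlled by the bound \<open>B\<close> on the variances \<open>?V n\<close>.\<close>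
  have small: "prob {\<omega> \<in> space M. explicit n (j n) \<omega> \<le> exp a} \<le> exp a * (exp B / x)" for n a
  proof -
    have [measurable]: "explicit n (j n) \<in> borel_measurable M" by (rule explicit_M[OF j])
    have V0: "0 \<le> ?V n" using j[of n] by (intro sum_nonneg mult_nonneg_nonneg) (auto intro!: g_step)
    let ?k = "indicator {..a} :: real \<Rightarrow> real" and ?z = "ln x + (r * (s - t) - ?V n / 2)"
    have "prob {\<omega> \<in> space M. explicit n (j n) \<omega> \<le> exp a} = expectation (\<lambda>\<omega>. indicator (space M) \<omega> * ?k (ln (explicit n (j n) \<omega>)))"
    proof -
      have "expectation (\<lambda>\<omega>. indicator (space M) \<omega> * ?k (ln (explicit n (j n) \<omega>))) = expectation (indicator {\<omega> \<in> space M. explicit n (j n) \<omega> \<le> exp a})"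
      proof (intro Bochner_Integration.integral_cong refl)
        fix \<omega>
        have "ln (explicit n (j n) \<omega>) \<le> a \<longleftrightarrow> explicit n (j n) \<omega> \<le> exp a"
          using explicit_pos[of n "j n" \<omega>] by (metis exp_le_cancel_iff exp_ln)
        then show "indicator (space M) \<omega> * ?k (ln (explicit n (j n) \<omega>)) = indicator {\<omega> \<in> space M. explicit n (j n) \<omega> \<le> exp a} \<omega>"
          by (auto split: split_indicator)
      qed
      then show ?thesis by simp
    qed
    also have "\<dots> = expectation (\<lambda>\<omega>. indicator (space M) \<omega> * gauss (?V n) ?k (ln (explicit n 0 \<omega>) + (r * (g n (j n) - g n 0) - ?V n / 2)))"
      using sets.top[of "F (g n 0)"] j by (intro explicit_transition[where C=1] \<sigma>0) (auto split: split_indicator)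
    also have "\<dots> = gauss (?V n) ?k ?z"
    proof -
      have "expectation (\<lambda>\<omega>. indicator (space M) \<omega> * gauss (?V n) ?k ?z) = gauss (?V n) ?k ?z"
        by (simp add: prob_space)
      then show ?thesis using s by (simp add: ln_explicit g_0)
    qed
    also have "\<dots> \<le> (LINT y|stdn. exp (a - ?z) * exp (- sqrt (?V n) * y))"
      unfolding gauss_def
    proof (intro integral_mono integrable_mult_right stdn_exp)
      show "integrable stdn (\<lambda>y. ?k (?z + sqrt (?V n) * y))"
        by (intro stdn.integrable_const_bound[of _ 1]) auto
      show "?k (?z + sqrt (?V n) * y) \<le> exp (a - ?z) * exp (- sqrt (?V n) * y)" for y
      proof (cases "?z + sqrt (?V n) * y \<le> a")
        case True
        then have "0 \<le> a - ?z + - sqrt (?V n) * y" by simp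
        then have "1 \<le> exp (a - ?z + - sqrt (?V n) * y)" by (simp only: one_le_exp_iff)
        then show ?thesis using True by (simp only: exp_add) simp
      qed simp
    qed
    also have "\<dots> = exp (a - ?z) * exp (?V n / 2)" using V0 by (simp only: integral_mult_right_zero stdn_exp) simp
    also have "\<dots> = exp (a + (?V n - r * (s - t)) + - ln x)" by (simp add: exp_add[symmetric] algebra_simps)
    also have "\<dots> = exp (a + (?V n - r * (s - t))) / x" using x0 by (simp only: exp_add exp_minus) (simp add: field_simps)
    also have "\<dots> \<le> exp (a + B) / x"
    proof -
      have "0 \<le> r * (s - t)" using r0 sin by simp
      then show ?thesis using B[of n] x0 by (intro divide_right_mono) (auto simp: abs_le_iff)
    qed
    finally show ?thesis by (simp add: exp_add)
  qed
  have "prob {\<omega> \<in> space M. X s \<omega> \<le> 0} \<le> 0"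
  proof (rule field_le_epsilon)
    fix e :: real assume e: "0 < e"
    define a where "a = ln (e / 2 / (exp B / x))"
    have a: "exp a * (exp B / x) = e / 2" using e x0 by (simp add: a_def)
    have "\<forall>\<^sub>F n in sequentially. \<forall>j\<le>m n. prob {\<omega> \<in> space M. \<bar>X (g n j) \<omega> - explicit n j \<omega>\<bar> > exp a / 2} \<le> e / 2"
      using e by (intro grid_convergence) auto
    then obtain n where n: "\<forall>j\<le>m n. prob {\<omega> \<in> space M. \<bar>X (g n j) \<omega> - explicit n j \<omega>\<bar> > exp a / 2} \<le> e / 2"
      using eventually_happens'[OF sequentially_bot] by blast
    have [measurable]: "explicit n (j n) \<in> borel_measurable M" by (rule explicit_M[OF j])
    have "prob {\<omega> \<in> space M. X s \<omega> \<le> 0} \<le> prob ({\<omega> \<in> space M. \<bar>X s \<omega> - explicit n (j n) \<omega>\<bar> > exp a / 2} \<union> {\<omega> \<in> space M. explicit n (j n) \<omega> \<le> exp a})"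
      by (intro finite_measure_mono) (auto, smt (verit) exp_gt_zero field_sum_of_halves)
    also have "\<dots> \<le> prob {\<omega> \<in> space M. \<bar>X s \<omega> - explicit n (j n) \<omega>\<bar> > exp a / 2} + prob {\<omega> \<in> space M. explicit n (j n) \<omega> \<le> exp a}"
      by (intro measure_Un_le) auto
    also have "\<dots> \<le> e / 2 + e / 2"
    proof (rule add_mono)
      show "prob {\<omega> \<in> space M. \<bar>X s \<omega> - explicit n (j n) \<omega>\<bar> > exp a / 2} \<le> e / 2"
        using n[rule_format, OF j] s by simp
      show "prob {\<omega> \<in> space M. explicit n (j n) \<omega> \<le> exp a} \<le> e / 2"
        using small[of n a] a by linarith
    qed
    finally show "prob {\<omega> \<in> space M. X s \<omega> \<le> 0} \<le> 0 + e" by simp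
  qed
  then have "prob {\<omega> \<in> space M. X s \<omega> \<le> 0} = 0" using measure_nonneg[of M "{\<omega> \<in> space M. X s \<omega> \<le> 0}"] by linarith
  then have "AE \<omega> in M. \<omega> \<notin> {\<omega> \<in> space M. X s \<omega> \<le> 0}"
    by (subst (asm) prob_eq_0) auto
  then show ?thesis using AE_space by eventually_elim auto
qed

text \<open>\<open>explicit_transition\<close> in the limit of fine grids: continuity of
  \<open>k\<close> passes almost sure convergence along a subsequence on, and boundedness gives the
  domination.\<close>

lemma X_transition:
  assumes j: "\<And>n. j n \<le> j' n" "\<And>n. j' n \<le> m n" and s: "\<And>n. g n (j n) = s" "\<And>n. g n (j' n) = s'"
    and \<sigma>0: "\<And>s. s \<in> {t..u} \<Longrightarrow> 0 \<le> \<sigma> s"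
    and A: "A \<in> sets (F s)" and k: "continuous_on UNIV k" "\<And>z. \<bar>k z\<bar> \<le> C"
  shows "expectation (\<lambda>\<omega>. indicator A \<omega> * k (ln (X s' \<omega>)))
    = expectation (\<lambda>\<omega>. indicator A \<omega> * gauss (integral {s..s'} (\<lambda>v. (\<sigma> v)\<^sup>2)) k
      (ln (X s \<omega>) + (r * (s' - s) - integral {s..s'} (\<lambda>v. (\<sigma> v)\<^sup>2) / 2)))"
proof -
  have jm: "j n \<le> m n" for n using j[of n] by simp
  have sin: "s \<in> {t..u}" "s' \<in> {t..u}" using g_in[OF jm[of 0]] g_in[OF j(2)[of 0]] s by auto
  have [measurable]: "X s \<in> borel_measurable M" "X s' \<in> borel_measurable M" using X_M sin by auto
  have [measurable]: "explicit n (j n) \<in> borel_measurable M" "explicit n (j' n) \<in> borel_measurable M" for n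
    using explicit_M jm j by auto
  have [measurable]: "A \<in> events" using A by (rule sets_F_M)
  have [measurable]: "k \<in> borel_measurable borel" using k(1) by (rule borel_measurable_continuous_onI)
  have C: "0 \<le> C" using k(2)[of 0] by (rule order_trans[OF abs_ge_zero])
  \<comment> \<open>Both times are put into one distance, so that a single subsequence serves them;
    the caps at 1 make it bounded.\<close>
  define D where "D n \<omega> = min 1 \<bar>X s \<omega> - explicit n (j n) \<omega>\<bar> + min 1 \<bar>X s' \<omega> - explicit n (j' n) \<omega>\<bar>" for n \<omega>
  have "\<exists>f. strict_mono f \<and> (AE \<omega> in M. (\<lambda>n. D (f n) \<omega>) \<longlonglongrightarrow> 0)"
  proof (rule tendsto_prob_AE_subseq[where C=2])
    show "D n \<in> borel_measurable M" for n unfolding D_def[abs_def] by measurable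
    fix \<epsilon> \<kappa> :: real assume e: "0 < \<epsilon>" "0 < \<kappa>"
    have "\<forall>\<^sub>F n in sequentially. \<forall>j\<le>m n. prob {\<omega> \<in> space M. \<bar>X (g n j) \<omega> - explicit n j \<omega>\<bar> > \<epsilon> / 2} \<le> \<kappa> / 2"
      using e by (intro grid_convergence) auto
    then show "\<forall>\<^sub>F n in sequentially. prob {\<omega> \<in> space M. D n \<omega> > \<epsilon>} \<le> \<kappa>"
    proof eventually_elim
      fix n assume n: "\<forall>j\<le>m n. prob {\<omega> \<in> space M. \<bar>X (g n j) \<omega> - explicit n j \<omega>\<bar> > \<epsilon> / 2} \<le> \<kappa> / 2"
      have "prob {\<omega> \<in> space M. D n \<omega> > \<epsilon>} \<le> prob ({\<omega> \<in> space M. \<bar>X s \<omega> - explicit n (j n) \<omega>\<bar> > \<epsilon> / 2} \<union> {\<omega> \<in> space M. \<bar>X s' \<omega> - explicit n (j' n) \<omega>\<bar> > \<epsilon> / 2})"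
        by (intro finite_measure_mono) (auto simp: D_def min_def split: if_splits)
      also have "\<dots> \<le> prob {\<omega> \<in> space M. \<bar>X s \<omega> - explicit n (j n) \<omega>\<bar> > \<epsilon> / 2} + prob {\<omega> \<in> space M. \<bar>X s' \<omega> - explicit n (j' n) \<omega>\<bar> > \<epsilon> / 2}"
        by (intro measure_Un_le) auto
      also have "\<dots> \<le> \<kappa> / 2 + \<kappa> / 2"
        using n[rule_format, OF jm] n[rule_format, OF j(2)] s by (intro add_mono) auto
      finally show "prob {\<omega> \<in> space M. D n \<omega> > \<epsilon>} \<le> \<kappa>" by simp
    qed
  qed (auto simp: D_def)
  then obtain f where f: "strict_mono f" "AE \<omega> in M. (\<lambda>n. D (f n) \<omega>) \<longlonglongrightarrow> 0" by blast
  \<comment> \<open>Convergence of the logarithms requires positive limits.\<close>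
  have pos: "AE \<omega> in M. 0 < X s \<omega>" "AE \<omega> in M. 0 < X s' \<omega>"
    using X_pos_AE[OF jm s(1) \<sigma>0] X_pos_AE[OF j(2) s(2) \<sigma>0] by auto
  have min_lim: "a \<longlonglongrightarrow> b" if "(\<lambda>n. min 1 \<bar>b - a n\<bar>) \<longlonglongrightarrow> 0" for a and b :: real
  proof -
    have "\<forall>\<^sub>F n in sequentially. min 1 \<bar>b - a n\<bar> < 1" using that by (intro order_tendstoD) auto
    then have "\<forall>\<^sub>F n in sequentially. min 1 \<bar>b - a n\<bar> = \<bar>b - a n\<bar>" by eventually_elim (auto simp: min_def)
    then have "(\<lambda>n. \<bar>b - a n\<bar>) \<longlonglongrightarrow> 0" using that by (rule Lim_transform_eventually[rotated])
    then have "(\<lambda>n. b - (b - a n)) \<longlonglongrightarrow> b - 0"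
      by (intro tendsto_diff tendsto_const) (simp only: tendsto_rabs_zero_iff)
    then show ?thesis by simp
  qed
  have lim: "AE \<omega> in M. (\<lambda>n. ln (explicit (f n) (j (f n)) \<omega>)) \<longlonglongrightarrow> ln (X s \<omega>) \<and> (\<lambda>n. ln (explicit (f n) (j' (f n)) \<omega>)) \<longlonglongrightarrow> ln (X s' \<omega>)"
    using f(2) pos
  proof eventually_elim
    case (elim \<omega>)
    have "(\<lambda>n. min 1 \<bar>X s \<omega> - explicit (f n) (j (f n)) \<omega>\<bar>) \<longlonglongrightarrow> 0" "(\<lambda>n. min 1 \<bar>X s' \<omega> - explicit (f n) (j' (f n)) \<omega>\<bar>) \<longlonglongrightarrow> 0"
      by (rule tendsto_sandwich[OF _ _ tendsto_const elim(1)]; simp add: D_def)+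
    then have "(\<lambda>n. explicit (f n) (j (f n)) \<omega>) \<longlonglongrightarrow> X s \<omega>" "(\<lambda>n. explicit (f n) (j' (f n)) \<omega>) \<longlonglongrightarrow> X s' \<omega>"
      by (auto dest: min_lim)
    then show ?case using elim by (auto intro!: tendsto_ln)
  qed
  define V where "V n = (\<Sum>i=j n..<j' n. (\<sigma> (g n i))\<^sup>2 * dt n i)" for n
  define v where "v = integral {s..s'} (\<lambda>v. (\<sigma> v)\<^sup>2)"
  have V: "V \<longlonglongrightarrow> v"
    unfolding V_def[abs_def] v_def using j s
    by (intro sum_sq_tendsto) (auto intro!: continuous_intros \<sigma>_cont)
  then have Vf: "(\<lambda>n. V (f n)) \<longlonglongrightarrow> v" using f(1) by (rule LIMSEQ_subseq_LIMSEQ[unfolded comp_def])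
  have lhs: "(\<lambda>n. expectation (\<lambda>\<omega>. indicator A \<omega> * k (ln (explicit (f n) (j' (f n)) \<omega>)))) \<longlonglongrightarrow> expectation (\<lambda>\<omega>. indicator A \<omega> * k (ln (X s' \<omega>)))"
  proof (rule integral_dominated_convergence[where w="\<lambda>_. C"])
    show "AE \<omega> in M. (\<lambda>n. indicator A \<omega> * k (ln (explicit (f n) (j' (f n)) \<omega>))) \<longlonglongrightarrow> indicator A \<omega> * k (ln (X s' \<omega>))"
      using lim by eventually_elim (auto intro!: tendsto_intros continuous_on_tendsto_compose[OF k(1)])
  qed (use k C in \<open>auto split: split_indicator\<close>)
  have rhs: "(\<lambda>n. expectation (\<lambda>\<omega>. indicator A \<omega> * gauss (V (f n)) k (ln (explicit (f n) (j (f n)) \<omega>) + (r * (s' - s) - V (f n) / 2))))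
    \<longlonglongrightarrow> expectation (\<lambda>\<omega>. indicator A \<omega> * gauss v k (ln (X s \<omega>) + (r * (s' - s) - v / 2)))"
  proof (rule integral_dominated_convergence[where w="\<lambda>_. C"])
    show "AE \<omega> in M. (\<lambda>n. indicator A \<omega> * gauss (V (f n)) k (ln (explicit (f n) (j (f n)) \<omega>) + (r * (s' - s) - V (f n) / 2)))
        \<longlonglongrightarrow> indicator A \<omega> * gauss v k (ln (X s \<omega>) + (r * (s' - s) - v / 2))"
      using lim
    proof eventually_elim
      case (elim \<omega>)
      then show ?case using Vf
        by (intro tendsto_mult tendsto_const tendsto_gauss[OF k] tendsto_add tendsto_diff tendsto_divide) auto
    qed
    show "AE \<omega> in M. norm (indicator A \<omega> * gauss (V (f n)) k (ln (explicit (f n) (j (f n)) \<omega>) + (r * (s' - s) - V (f n) / 2))) \<le> C" for n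
      using gauss_bound[OF _ k(2)] C by (auto split: split_indicator)
  qed (use C in auto)
  have "expectation (\<lambda>\<omega>. indicator A \<omega> * k (ln (explicit n (j' n) \<omega>)))
    = expectation (\<lambda>\<omega>. indicator A \<omega> * gauss (V n) k (ln (explicit n (j n) \<omega>) + (r * (s' - s) - V n / 2)))" for n
    using explicit_transition[of "j n" "j' n" n A k C] j \<sigma>0 k(2) A s unfolding V_def by simp
  then show ?thesis
    using LIMSEQ_unique[OF lhs] rhs unfolding v_def by simp
qed

end

section \<open>Optimal stopping\<close>

text \<open>The value of the put in units of \<open>kap\<close>, with the boundary placed at
  \<open>z = 0\<close>.\<close>

definition snell :: "real \<Rightarrow> real \<Rightarrow> real" where
  "snell v z = snell_max v z - exp (v / 2 + z)"

text \<open>The value in the continuation region, extended to all \<open>z\<close>; along the log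
  price it is a martingale, being the mean of \<open>payf\<close>.\<close>

definition martpart :: "real \<Rightarrow> real \<Rightarrow> real" where
  "martpart v z = expabs v z - exp (v / 2 + z)"

text \<open>Twice the hyperbolic sine of the negative part of \<open>y\<close>; it is unbounded for
  decreasing \<open>y\<close>, which is why \<open>trunc_mart\<close> exists.\<close>

definition payf :: "real \<Rightarrow> real" where "payf y = exp \<bar>y\<bar> - exp y"

text \<open>Truncating the terminal value, not the process, keeps the martingale property and makes
  the function bounded, as the transition law demands.\<close>

definition trunc_mart :: "real \<Rightarrow> real \<Rightarrow> real \<Rightarrow> real" where
  "trunc_mart L v = gauss v (\<lambda>y. min L (payf y))"

lemma payf_nonneg: "0 \<le> payf y" by (simp add: payf_def)

lemma payf_antimono:
  assumes "y \<le> y'" shows "payf y' \<le> payf y"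
proof (cases "0 \<le> y'")
  case True then show ?thesis using payf_nonneg[of y] by (simp add: payf_def)
next
  case False
  moreover have "exp (- y') \<le> exp (- y)" "exp y \<le> exp y'" using assms by auto
  then have "exp (- y') - exp y' \<le> exp (- y) - exp y" by linarith
  ultimately show ?thesis using assms by (simp add: payf_def)
qed

lemma continuous_payf: "continuous_on UNIV payf"
  unfolding payf_def[abs_def] by (intro continuous_intros)

lemma borel_measurable_payf[measurable]: "payf \<in> borel_measurable borel"
  by (rule borel_measurable_continuous_onI[OF continuous_payf])

lemma integrable_payf: "integrable stdn (\<lambda>y. payf (z + c * y))"
  unfolding payf_def by (intro Bochner_Integration.integrable_diff stdn_exp_abs) (simp add: exp_add stdn_exp)

lemma martpart_eq: "0 \<le> v \<Longrightarrow> martpart v z = gauss v payf z"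
  unfolding martpart_def expabs_def gauss_exp[symmetric] unfolding gauss_def payf_def
  by (subst Bochner_Integration.integral_diff) (auto intro!: stdn_exp_abs simp: exp_add stdn_exp)

lemma martpart_antimono: "0 \<le> v \<Longrightarrow> z \<le> z' \<Longrightarrow> martpart v z' \<le> martpart v z"
  unfolding martpart_eq gauss_def by (intro integral_mono integrable_payf payf_antimono) auto

lemma snell_eq: "snell v z = (if z \<le> 0 then expabs v 0 - exp (v / 2 + z) else martpart v z)"
  by (simp add: snell_def snell_max_def martpart_def)

lemma snell_ge:
  assumes "0 \<le> v"
  shows "max 0 (expabs v 0 - exp (v / 2 + z)) \<le> snell v z"
proof -
  have "exp (v / 2 + z) \<le> snell_max v z"
  proof (cases "z \<le> 0")
    case True
    then have "exp (v / 2 + z) \<le> exp (v / 2 + 0)" by simp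
    also have "\<dots> \<le> expabs v 0" by (rule expabs_ge_exp[OF assms])
    finally show ?thesis using True by (simp add: snell_max_def)
  qed (simp add: snell_max_def expabs_ge_exp[OF assms])
  moreover have "expabs v 0 \<le> snell_max v z" by (auto simp: snell_max_def intro!: expabs_mono)
  ultimately show ?thesis by (simp add: snell_def)
qed

text \<open>The maximum and the stock are unbounded, their difference is not; hence the transition
  law applies to \<open>snell\<close> as it stands.\<close>

lemma snell_bound:
  assumes "0 \<le> v"
  shows "\<bar>snell v z\<bar> \<le> expabs v 0"
proof -
  have "snell v z \<le> expabs v 0"
  proof (cases "z \<le> 0")
    case False
    then have "martpart v z \<le> martpart v 0" using assms by (intro martpart_antimono) auto
    then have "expabs v z - exp (v / 2 + z) \<le> expabs v 0" by (simp add: martpart_def) (smt (verit) exp_gt_zero)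
    then show ?thesis using False by (simp add: snell_eq martpart_def)
  qed (simp add: snell_eq)
  then show ?thesis using snell_ge[OF assms, of z] by simp
qed

lemma continuous_snell: "continuous_on UNIV (snell v)"
proof -
  have "continuous_on UNIV (expabs v)"
    by (intro continuous_at_imp_continuous_on ballI isCont_expabs)
  then have "continuous_on UNIV (\<lambda>z. expabs v (max 0 z))"
    by (rule continuous_on_compose2) (auto intro!: continuous_intros)
  then have "continuous_on UNIV (\<lambda>z. expabs v (max 0 z) - exp (v / 2 + z))"
    by (intro continuous_on_diff continuous_intros)
  also have "(\<lambda>z. expabs v (max 0 z) - exp (v / 2 + z)) = snell v"
    by (auto simp: fun_eq_iff snell_def snell_max_def max_def)
  finally show ?thesis .
qed

text \<open>The stock part is a martingale, so the inequality for \<open>snell_max\<close> carries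
  over to the difference.\<close>

lemma gauss_snell_le:
  assumes "0 \<le> v" "0 \<le> w"
  shows "gauss v (snell w) z \<le> snell (v + w) z"
proof -
  have e: "integrable stdn (\<lambda>y. exp (w / 2 + (z + sqrt v * y)))"
    "(LINT y|stdn. exp (w / 2 + (z + sqrt v * y))) = exp ((v + w) / 2 + z)"
  proof -
    have s: "exp (w / 2 + (z + sqrt v * y)) = exp (w / 2 + z) * exp (sqrt v * y)" for y
      by (simp add: exp_add)
    show "integrable stdn (\<lambda>y. exp (w / 2 + (z + sqrt v * y)))"
      unfolding s by (intro integrable_mult_right stdn_exp)
    show "(LINT y|stdn. exp (w / 2 + (z + sqrt v * y))) = exp ((v + w) / 2 + z)"
      unfolding s using assms by (simp add: stdn_exp exp_add add_divide_distrib)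
  qed
  have "gauss v (snell w) z = gauss v (snell_max w) z - exp ((v + w) / 2 + z)"
    unfolding gauss_def snell_def using integrable_snell_max[OF assms, of z] e
    by (subst Bochner_Integration.integral_diff) auto
  then show ?thesis using gauss_snell_max_le[OF assms, of z] by (simp add: snell_def)
qed

lemma trunc_payf_bound: "0 \<le> L \<Longrightarrow> \<bar>min L (payf y)\<bar> \<le> L"
  using payf_nonneg[of y] by (auto simp: min_def)

lemma trunc_mart_bound: "0 \<le> L \<Longrightarrow> \<bar>trunc_mart L v z\<bar> \<le> L"
  unfolding trunc_mart_def by (intro gauss_bound trunc_payf_bound) auto

lemma trunc_mart_le_martpart: "0 \<le> L \<Longrightarrow> 0 \<le> v \<Longrightarrow> trunc_mart L v z \<le> martpart v z"
  unfolding trunc_mart_def martpart_eq gauss_def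
  by (intro integral_mono integrable_payf stdn.integrable_const_bound[of _ L])
    (auto intro!: AE_I2 trunc_payf_bound)

lemma gauss_trunc_mart: "0 \<le> L \<Longrightarrow> 0 \<le> v \<Longrightarrow> 0 \<le> w \<Longrightarrow> gauss v (trunc_mart L w) z = trunc_mart L (v + w) z"
  unfolding trunc_mart_def
  by (intro gauss_semigroup stdn.integrable_const_bound[of _ L]) (auto intro!: AE_I2 trunc_payf_bound)

lemma continuous_trunc_mart:
  assumes "0 \<le> L" shows "continuous_on UNIV (trunc_mart L v)"
proof -
  have k: "continuous_on UNIV (\<lambda>y. min L (payf y))" by (intro continuous_intros continuous_payf)
  have "(\<lambda>n. trunc_mart L v (y n)) \<longlonglongrightarrow> trunc_mart L v z" if "y \<longlonglongrightarrow> z" for y z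
    unfolding trunc_mart_def by (rule tendsto_gauss[OF k trunc_payf_bound[OF assms] tendsto_const that])
  then show ?thesis by (simp add: continuous_on_sequentially comp_def)
qed

lemma trunc_mart_tendsto:
  assumes "0 \<le> v"
  shows "(\<lambda>n. trunc_mart (real n) v z) \<longlonglongrightarrow> martpart v z"
  unfolding trunc_mart_def martpart_eq[OF assms] gauss_def
proof (rule integral_dominated_convergence[where w = "\<lambda>y. payf (z + sqrt v * y)"])
  show "AE y in stdn. (\<lambda>n. min (real n) (payf (z + sqrt v * y))) \<longlonglongrightarrow> payf (z + sqrt v * y)"
  proof (rule AE_I2, rule tendsto_eventually)
    fix y
    obtain n0 where n0: "payf (z + sqrt v * y) < real n0" using reals_Archimedean2 by blast
    show "\<forall>\<^sub>F n in sequentially. min (real n) (payf (z + sqrt v * y)) = payf (z + sqrt v * y)"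
      using eventually_ge_at_top[of n0] by eventually_elim (use n0 in \<open>auto simp: min_def\<close>)
  qed
  show "AE y in stdn. norm (min (real n) (payf (z + sqrt v * y))) \<le> payf (z + sqrt v * y)" for n
    using payf_nonneg by (auto simp: min_def)
qed (auto intro: integrable_payf)

text \<open>Observed on a grid, the price may jump past the boundary. This bounds by how much the
  martingale then exceeds the payoff; the excess vanishes as \<open>z\<close> tends to 0.\<close>

lemma martpart_overshoot:
  assumes "0 \<le> v" "z \<le> 0"
  shows "martpart v z - (exp (- z) - 1) * expabs v 0 \<le> expabs v 0 - exp (v / 2 + z)"
  using expabs_le_exp_mult[of v z 0] assms by (simp add: martpart_def algebra_simps)

section \<open>Optional stopping on a grid\<close>

lemma stopped_sum:
  fixes N :: "nat \<Rightarrow> real"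
  assumes "k \<le> m"
  shows "N k = N 0 + (\<Sum>i<m. if i < k then N (Suc i) - N i else 0)"
proof -
  have "(\<Sum>i<m. if i < k then N (Suc i) - N i else 0) = (\<Sum>i\<in>{..<m} \<inter> {..<k}. N (Suc i) - N i)"
    by (simp add: sum.If_cases lessThan_def)
  also have "{..<m} \<inter> {..<k} = {..<k}" using assms by auto
  finally show ?thesis by (simp add: sum_lessThan_telescope)
qed

context bm
begin

text \<open>The stopped value is the start plus the increments over the events
  \<open>i < \<iota>\<close>, each known at time \<open>p i\<close>; on such events the integrated
  supermartingale inequality applies.\<close>

lemma discrete_stopping:
  fixes N :: "nat \<Rightarrow> 'a \<Rightarrow> real" and \<iota> :: "'a \<Rightarrow> nat"
  assumes N[measurable]: "\<And>i. i \<le> m \<Longrightarrow> N i \<in> borel_measurable M"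
    and bound: "\<And>i. i \<le> m \<Longrightarrow> AE \<omega> in M. \<bar>N i \<omega>\<bar> \<le> C"
    and \<iota>: "\<And>\<omega>. \<iota> \<omega> \<le> m" "\<And>i. i < m \<Longrightarrow> {\<omega> \<in> space M. i < \<iota> \<omega>} \<in> sets (F (p i))"
    and super: "\<And>i A. i < m \<Longrightarrow> A \<in> sets (F (p i)) \<Longrightarrow>
      expectation (\<lambda>\<omega>. indicator A \<omega> * N (Suc i) \<omega>) \<le> expectation (\<lambda>\<omega>. indicator A \<omega> * N i \<omega>)"
  shows "integrable M (\<lambda>\<omega>. N (\<iota> \<omega>) \<omega>)" "expectation (\<lambda>\<omega>. N (\<iota> \<omega>) \<omega>) \<le> expectation (N 0)"
proof -
  let ?A = "\<lambda>i. {\<omega> \<in> space M. i < \<iota> \<omega>}"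
  have A[measurable]: "?A i \<in> events" if "i < m" for i using \<iota>(2)[OF that] by (rule sets_F_M)
  have Ni: "integrable M (N i)" if "i \<le> m" for i
    using bound[OF that] N[OF that] by (intro integrable_const_bound[of _ C]) auto
  have AN: "integrable M (\<lambda>\<omega>. indicator (?A i) \<omega> * N j \<omega>)" if "i < m" "j \<le> m" for i j
  proof (rule integrable_const_bound[of _ "\<bar>C\<bar>"])
    show "AE \<omega> in M. norm (indicator (?A i) \<omega> * N j \<omega>) \<le> \<bar>C\<bar>"
      using bound[OF that(2)] by eventually_elim (auto split: split_indicator)
  qed (use that A N in auto)
  have eq: "N (\<iota> \<omega>) \<omega> = N 0 \<omega> + (\<Sum>i<m. indicator (?A i) \<omega> * N (Suc i) \<omega> - indicator (?A i) \<omega> * N i \<omega>)"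
    if \<omega>: "\<omega> \<in> space M" for \<omega>
    unfolding stopped_sum[OF \<iota>(1), of "\<lambda>i. N i \<omega>"] using \<omega> by (intro arg_cong2[where f = "(+)"] sum.cong) auto
  have i: "integrable M (\<lambda>\<omega>. N 0 \<omega> + (\<Sum>i<m. indicator (?A i) \<omega> * N (Suc i) \<omega> - indicator (?A i) \<omega> * N i \<omega>))"
    by (intro Bochner_Integration.integrable_add Bochner_Integration.integrable_sum Bochner_Integration.integrable_diff AN Ni) auto
  then show "integrable M (\<lambda>\<omega>. N (\<iota> \<omega>) \<omega>)"
    by (rule Bochner_Integration.integrable_cong[THEN iffD2, rotated 2]) (auto simp: eq)
  have "expectation (\<lambda>\<omega>. N (\<iota> \<omega>) \<omega>)
    = expectation (\<lambda>\<omega>. N 0 \<omega> + (\<Sum>i<m. indicator (?A i) \<omega> * N (Suc i) \<omega> - indicator (?A i) \<omega> * N i \<omega>))"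
    by (rule Bochner_Integration.integral_cong) (auto simp: eq)
  also have "\<dots> = expectation (N 0) + (\<Sum>i<m. expectation (\<lambda>\<omega>. indicator (?A i) \<omega> * N (Suc i) \<omega>) - expectation (\<lambda>\<omega>. indicator (?A i) \<omega> * N i \<omega>))"
  proof -
    have "integrable M (\<lambda>\<omega>. \<Sum>i<m. indicator (?A i) \<omega> * N (Suc i) \<omega> - indicator (?A i) \<omega> * N i \<omega>)"
      by (intro Bochner_Integration.integrable_sum Bochner_Integration.integrable_diff AN) auto
    moreover have "expectation (\<lambda>\<omega>. \<Sum>i<m. indicator (?A i) \<omega> * N (Suc i) \<omega> - indicator (?A i) \<omega> * N i \<omega>)
      = (\<Sum>i<m. expectation (\<lambda>\<omega>. indicator (?A i) \<omega> * N (Suc i) \<omega> - indicator (?A i) \<omega> * N i \<omega>))"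
      by (rule Bochner_Integration.integral_sum) (auto intro!: Bochner_Integration.integrable_diff AN)
    moreover have "(\<Sum>i<m. expectation (\<lambda>\<omega>. indicator (?A i) \<omega> * N (Suc i) \<omega> - indicator (?A i) \<omega> * N i \<omega>))
      = (\<Sum>i<m. expectation (\<lambda>\<omega>. indicator (?A i) \<omega> * N (Suc i) \<omega>) - expectation (\<lambda>\<omega>. indicator (?A i) \<omega> * N i \<omega>))"
      by (intro sum.cong refl Bochner_Integration.integral_diff AN) auto
    ultimately show ?thesis using Ni[of 0] by simp
  qed
  also have "\<dots> \<le> expectation (N 0)"
    using super \<iota>(2) by (auto intro!: sum_nonpos)
  finally show "expectation (\<lambda>\<omega>. N (\<iota> \<omega>) \<omega>) \<le> expectation (N 0)" .
qed

text \<open>The grids contain both times: \<open>s\<close> sits at index \<open>Suc n\<close> and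
  \<open>u\<close> at \<open>2 * Suc n\<close>, with even spacing on either side of
  \<open>s\<close>. The condition \<open>u < T\<close> makes the volatility continuous on
  \<open>[t, u]\<close>.\<close>

lemma sde_transition:
  assumes r0: "0 < r" and x0: "0 < x" and t0: "0 \<le> t" and ts: "t \<le> s" "s \<le> u" "u < T"
    and sde: "sde_solution M F W (\<lambda>s y. r * y) (\<lambda>s y. vol r T s * y) T t x X"
  shows "AE \<omega> in M. 0 < X s \<omega>"
    and "A \<in> sets (F s) \<Longrightarrow> continuous_on UNIV k \<Longrightarrow> (\<And>z. \<bar>k z\<bar> \<le> C) \<Longrightarrow>
      expectation (\<lambda>\<omega>. indicator A \<omega> * k (ln (X u \<omega>)))
      = expectation (\<lambda>\<omega>. indicator A \<omega> * gauss (tvar r T s - tvar r T u) k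
        (ln (X s \<omega>) + (r * (u - s) - (tvar r T s - tvar r T u) / 2)))"
proof -
  define m :: "nat \<Rightarrow> nat" where "m n = 2 * Suc n" for n
  define g where "g n i = (if i \<le> Suc n then t + (s - t) * (real i / real (Suc n))
    else s + (u - s) * (real (i - Suc n) / real (Suc n)))" for n i
  define \<delta> where "\<delta> n = (u - t) / real (Suc n)" for n
  have step: "g n (Suc i) - g n i = (if i < Suc n then s - t else u - s) / real (Suc n)" if "i < m n" for n i
  proof -
    have q: "a * (real (Suc k) / c) - a * (real k / c) = a / c" for a c :: real and k
      by (simp add: diff_divide_distrib[symmetric] algebra_simps)
    show ?thesis
    proof (cases i "Suc n" rule: linorder_cases)
      case less
      then show ?thesis using q[of "s - t" i "real (Suc n)"] by (simp add: g_def)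
    next
      case equal
      then show ?thesis by (simp add: g_def)
    next
      case greater
      then have "Suc i - Suc n = Suc (i - Suc n)" by simp
      then show ?thesis using greater q[of "u - s" "i - Suc n" "real (Suc n)"]
        by (simp add: g_def del: of_nat_Suc)
    qed
  qed
  have vol_cont: "continuous_on {t..u} (vol r T)"
    using ts by (intro continuous_at_imp_continuous_on ballI isCont_vol[OF r0]) auto
  have vol_nonneg: "0 \<le> vol r T v" if "v \<in> {t..u}" for v
    using vol_eq[OF r0, of v T] vol_power2[OF r0, of v T] that ts by (auto simp flip: vol_power2[OF r0])
  have sde': "v \<in> {t..T} \<Longrightarrow> X v \<in> borel_measurable (F v)" "\<omega> \<in> space M \<Longrightarrow> continuous_on {t..T} (\<lambda>u. X u \<omega>)"
    "v \<in> {t..T} \<Longrightarrow> \<exists>I. has_ito_integral M F W t v (\<lambda>s \<omega>. vol r T s * X s \<omega>) I \<and>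
        (AE \<omega> in M. set_integrable lborel {t..v} (\<lambda>s. r * X s \<omega>) \<and>
           X v \<omega> = x + (LINT s:{t..v}|lborel. r * X s \<omega>) + I \<omega>)" for v \<omega>
    using sde unfolding sde_solution_def by blast+
  interpret gbm_grid M F W r x t u "vol r T" X m g \<delta>
  proof
    show "t \<le> u" using ts by simp
    show "X v \<in> borel_measurable (F v)" if "v \<in> {t..u}" for v using that ts by (intro sde') auto
    show "continuous_on {t..u} (\<lambda>s. X s \<omega>)" if "\<omega> \<in> space M" for \<omega>
      using ts by (intro continuous_on_subset[OF sde'(2)[OF that]]) auto
    show "\<exists>I. has_ito_integral M F W t v (\<lambda>s \<omega>. vol r T s * X s \<omega>) I \<and>
        (AE \<omega> in M. set_integrable lborel {t..v} (\<lambda>s. r * X s \<omega>) \<and>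
           X v \<omega> = x + (LINT s:{t..v}|lborel. r * X s \<omega>) + I \<omega>)" if "v \<in> {t..u}" for v
      using that ts by (intro sde'(3)) auto
    show "g n 0 = t" "g n (m n) = u" for n by (auto simp: g_def m_def field_simps)
    show "g n i \<le> g n (Suc i)" if "i < m n" for n i
    proof -
      have "0 \<le> g n (Suc i) - g n i" unfolding step[OF that] using ts by auto
      then show ?thesis by simp
    qed
    show "g n (Suc i) - g n i \<le> \<delta> n" if "i < m n" for n i
      unfolding step[OF that] \<delta>_def using ts by (intro divide_right_mono) auto
    have "(\<lambda>n. (u - t) * (1 / real (Suc n))) \<longlonglongrightarrow> (u - t) * 0"
      using LIMSEQ_inverse_real_of_nat by (intro tendsto_intros) (simp add: inverse_eq_divide)
    then show "\<delta> \<longlonglongrightarrow> 0" by (simp add: \<delta>_def[abs_def])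
  qed (use r0 x0 t0 vol_cont in auto)
  have gs: "g n (Suc n) = s" "g n (m n) = u" "Suc n \<le> m n" for n
    by (simp_all add: g_m) (auto simp: g_def m_def)
  show "AE \<omega> in M. 0 < X s \<omega>"
    by (rule X_pos_AE[where j = Suc]) (use gs vol_nonneg in auto)
  have I: "integral {s..u} (\<lambda>v. (vol r T v)\<^sup>2) = tvar r T s - tvar r T u"
    using has_integral_vol[OF r0, of s u T] ts by (simp add: integral_unique)
  show "expectation (\<lambda>\<omega>. indicator A \<omega> * k (ln (X u \<omega>)))
      = expectation (\<lambda>\<omega>. indicator A \<omega> * gauss (tvar r T s - tvar r T u) k
        (ln (X s \<omega>) + (r * (u - s) - (tvar r T s - tvar r T u) / 2)))"
    if "A \<in> sets (F s)" "continuous_on UNIV k" "\<And>z. \<bar>k z\<bar> \<le> C" for A k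
    using X_transition[where j = Suc and j' = m and s = s and s' = u and A = A and k = k and C = C] gs vol_nonneg that
    by (simp add: I)
qed

end

lemma stopped_measurable:
  fixes N :: "nat \<Rightarrow> 'a \<Rightarrow> real"
  assumes N[measurable]: "\<And>i. i \<le> m \<Longrightarrow> N i \<in> borel_measurable M"
    and \<iota>: "\<And>\<omega>. \<iota> \<omega> \<le> m" and [measurable]: "\<And>i. i < m \<Longrightarrow> {\<omega> \<in> space M. i < \<iota> \<omega>} \<in> sets M"
  shows "(\<lambda>\<omega>. N (\<iota> \<omega>) \<omega>) \<in> borel_measurable M"
proof -
  have "(\<lambda>\<omega>. N 0 \<omega> + (\<Sum>i<m. if i < \<iota> \<omega> then N (Suc i) \<omega> - N i \<omega> else 0)) \<in> borel_measurable M"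
    by (intro borel_measurable_add borel_measurable_sum measurable_If borel_measurable_diff N) auto
  then show ?thesis using stopped_sum[OF \<iota>, of "\<lambda>i. N i _"] by simp
qed

lemma natural_filtration_space[simp]: "space (natural_filtration \<Omega> J X u) = \<Omega>"
  by (simp add: natural_filtration_def space_measure_of_conv)

lemma natural_filtration_measurable:
  assumes "s \<in> J" "s \<le> u"
  shows "X s \<in> borel_measurable (natural_filtration \<Omega> J X u)"
proof (rule measurableI)
  fix B :: "real set" assume "B \<in> sets borel"
  then have "X s -` B \<inter> \<Omega> \<in> {X s -` B \<inter> \<Omega> | s B. s \<in> J \<and> s \<le> u \<and> B \<in> sets borel}" using assms by blast
  then show "X s -` B \<inter> space (natural_filtration \<Omega> J X u) \<in> sets (natural_filtration \<Omega> J X u)"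
    unfolding natural_filtration_space unfolding natural_filtration_def by (rule in_measure_of[rotated]) auto
qed simp

section \<open>The put relative to its boundary\<close>

locale put_problem = bm M F W
  for M :: "'a measure" and F :: "real \<Rightarrow> 'a measure" and W :: "real \<Rightarrow> 'a \<Rightarrow> real" +
  fixes r K T t x :: real and X :: "real \<Rightarrow> 'a \<Rightarrow> real"
  assumes r0: "0 < r" and K0: "0 < K" and t: "0 \<le> t" "t < T" and x0: "0 < x"
    and sde: "sde_solution M F W (\<lambda>s y. r * y) (\<lambda>s y. vol r T s * y) T t x X"
begin

abbreviation v :: "real \<Rightarrow> real" where "v \<equiv> tvar r T"

text \<open>The claimed boundary with the remaining variance in place of the integral;
  \<open>LINT_vol\<close> identifies the two.\<close>

definition bdry :: "real \<Rightarrow> real" where "bdry u = K * exp (- r * (T - u)) * exp (v u / 2)"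

definition Z :: "real \<Rightarrow> 'a \<Rightarrow> real" where "Z u \<omega> = ln (X u \<omega>) - ln (bdry u)"

definition pay :: "real \<Rightarrow> 'a \<Rightarrow> real" where "pay u \<omega> = exp (- r * (u - t)) * max 0 (K - X u \<omega>)"

text \<open>The unit of value: by \<open>expabs_tvar\<close>, the strike discounted from
  \<open>u\<close> to \<open>t\<close> is \<open>kap * expabs (v u) 0\<close>.\<close>

definition kap :: real where "kap = K * exp (- r * (T - t))"

definition z0 :: real where "z0 = ln x - ln (bdry t)"

text \<open>The spacing is that of \<open>Suc n\<close> cells, but stopping uses only the indices up
  to \<open>n\<close>: these times lie before \<open>T\<close>, where the law of the price is
  known.\<close>

definition gr :: "nat \<Rightarrow> nat \<Rightarrow> real" where "gr n i = t + (T - t) * real i / real (Suc n)"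

lemma kap_pos: "0 < kap" using K0 by (simp add: kap_def)

lemma bdry_pos: "0 < bdry u" using K0 by (simp add: bdry_def)

lemma gr_0: "gr n 0 = t" by (simp add: gr_def)

lemma gr_mono: "i \<le> j \<Longrightarrow> gr n i \<le> gr n j"
  using t by (auto simp: gr_def intro!: divide_right_mono mult_left_mono)

lemma gr_in: "i \<le> n \<Longrightarrow> gr n i \<in> {t..<T}"
proof -
  assume "i \<le> n"
  then have "(T - t) * (real i / real (Suc n)) < (T - t) * 1" using t by (intro mult_strict_left_mono) auto
  then show ?thesis using t by (auto simp: gr_def)
qed

lemma gr_in': "i \<le> n \<Longrightarrow> gr n i \<in> {t..T}" using gr_in[of i n] by auto

lemma gr_Suc: "gr n (Suc i) = gr n i + (T - t) / real (Suc n)"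
proof -
  have "(T - t) * real (Suc i) = (T - t) * real i + (T - t)" by (simp add: algebra_simps)
  then show ?thesis by (simp only: gr_def add_divide_distrib add.assoc)
qed

lemma gr_last: "T - gr n n = (T - t) / real (Suc n)"
proof -
  have "gr n (Suc n) = T" by (simp add: gr_def del: of_nat_Suc)
  then show ?thesis using gr_Suc[of n n] by simp
qed

lemma mesh_lim: "(\<lambda>n. (T - t) / real (Suc n)) \<longlonglongrightarrow> 0"
proof -
  have "(\<lambda>n. (T - t) * (1 / real (Suc n))) \<longlonglongrightarrow> (T - t) * 0"
    using LIMSEQ_inverse_real_of_nat by (intro tendsto_intros) (simp add: inverse_eq_divide)
  then show ?thesis by simp
qed

lemma X_F: "u \<in> {t..T} \<Longrightarrow> X u \<in> borel_measurable (F u)"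
  using sde by (auto simp: sde_solution_def)

lemma X_M: "u \<in> {t..T} \<Longrightarrow> X u \<in> borel_measurable M"
  using X_F measurable_F_M by blast

lemma X_cont: "\<omega> \<in> space M \<Longrightarrow> continuous_on {t..T} (\<lambda>u. X u \<omega>)"
  using sde by (auto simp: sde_solution_def)

lemma X_start: "AE \<omega> in M. X t \<omega> = x"
  using sde by (auto simp: sde_solution_def)

lemma X_pos: "u \<in> {t..<T} \<Longrightarrow> AE \<omega> in M. 0 < X u \<omega>"
  by (rule sde_transition(1)[OF r0 x0 t(1) _ _ _ sde]) auto

lemma X_pos_grid: "AE \<omega> in M. \<forall>n. \<forall>i\<in>{..n}. 0 < X (gr n i) \<omega>"
  by (intro AE_all_countable[THEN iffD2] allI AE_finite_allI X_pos gr_in) auto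

text \<open>Positivity is almost sure at each single time before \<open>T\<close>. Rational times
  and continuity make nonnegativity simultaneous and extend it to \<open>T\<close>, so the payoff is
  bounded along every stopping time.\<close>

lemma X_nonneg: "AE \<omega> in M. \<forall>u\<in>{t..T}. 0 \<le> X u \<omega>"
proof -
  have "AE \<omega> in M. \<forall>q\<in>\<rat> \<inter> {t..<T}. 0 < X q \<omega>"
    by (intro AE_ball_countable[THEN iffD2] ballI X_pos) (auto intro: countable_Int1 countable_rat)
  then show ?thesis
    using AE_space
  proof eventually_elim
    case (elim \<omega>)
    show ?case
    proof (intro ballI, rule ccontr)
      fix u assume u: "u \<in> {t..T}" and "\<not> 0 \<le> X u \<omega>"
      then obtain d where d: "0 < d" "\<And>s. s \<in> {t..T} \<Longrightarrow> dist s u < d \<Longrightarrow> dist (X s \<omega>) (X u \<omega>) < - X u \<omega>"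
        using X_cont[OF elim(2)] unfolding continuous_on_iff by (metis neg_0_less_iff_less not_le)
      have "max t (u - d) < min T (u + d)" using u d(1) t by auto
      then obtain q where q: "q \<in> \<rat>" "max t (u - d) < q" "q < min T (u + d)" using Rats_dense_in_real by blast
      then have "dist (X q \<omega>) (X u \<omega>) < - X u \<omega>" by (intro d) (auto simp: dist_real_def)
      moreover have "0 < X q \<omega>" using elim(1) q by auto
      ultimately show False by (auto simp: dist_real_def)
    qed
  qed
qed

lemma Z_F: "u \<in> {t..T} \<Longrightarrow> Z u \<in> borel_measurable (F u)"
  unfolding Z_def[abs_def] using X_F[of u] by simp

lemma Z_M: "u \<in> {t..T} \<Longrightarrow> Z u \<in> borel_measurable M"
  using Z_F measurable_F_M by blast

lemma Z_start: "AE \<omega> in M. Z t \<omega> = z0"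
  using X_start by eventually_elim (simp add: Z_def z0_def)

text \<open>The drifts of \<open>ln X\<close> and \<open>ln bdry\<close> coincide.\<close>

lemma Z_transition:
  assumes "t \<le> s" "s \<le> u" "u < T" "A \<in> sets (F s)" "continuous_on UNIV k" "\<And>z. \<bar>k z\<bar> \<le> C"
  shows "expectation (\<lambda>\<omega>. indicator A \<omega> * k (Z u \<omega>)) = expectation (\<lambda>\<omega>. indicator A \<omega> * gauss (v s - v u) k (Z s \<omega>))"
proof -
  have "continuous_on UNIV (\<lambda>y. k (y - ln (bdry u)))"
    by (rule continuous_on_compose2[OF assms(5)]) (auto intro!: continuous_intros)
  note tr = sde_transition(2)[OF r0 x0 t(1) assms(1-3) sde assms(4) this assms(6)]
  have eq: "gauss (v s - v u) (\<lambda>y. k (y - ln (bdry u))) (ln (X s \<omega>) + (r * (u - s) - (v s - v u) / 2)) = gauss (v s - v u) k (Z s \<omega>)" for \<omega>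
  proof -
    have "ln (bdry u) - ln (bdry s) = r * (u - s) - (v s - v u) / 2"
      using K0 by (simp add: bdry_def ln_mult algebra_simps diff_divide_distrib)
    then have "ln (X s \<omega>) + (r * (u - s) - (v s - v u) / 2) = Z s \<omega> + ln (bdry u)" by (simp add: Z_def)
    then show ?thesis by (simp add: gauss_def algebra_simps)
  qed
  show ?thesis using tr unfolding eq by (simp add: Z_def)
qed

text \<open>The factor \<open>exp (v u / 2)\<close> cancels against the one in \<open>bdry\<close>,
  leaving the stock as \<open>y * exp (r * (T - u)) / K\<close>; the strike becomes
  \<open>expabs (v u) 0\<close> by \<open>expabs_tvar\<close>.\<close>

lemma value_identity:
  assumes "t \<le> u" "u \<le> T" "0 < y"
  shows "exp (- r * (u - t)) * (K - y) = kap * (expabs (v u) 0 - exp (v u / 2 + (ln y - ln (bdry u))))"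
proof -
  have "exp (v u / 2 + (ln y - ln (bdry u))) = exp (v u / 2) * y / bdry u"
    using assms bdry_pos[of u] by (simp add: exp_add exp_diff)
  also have "\<dots> = y * exp (r * (T - u)) / K"
  proof -
    have "exp (- r * (T - u)) = 1 / exp (r * (T - u))" by (simp add: exp_minus inverse_eq_divide)
    then show ?thesis by (simp add: bdry_def)
  qed
  finally have "kap * (expabs (v u) 0 - exp (v u / 2 + (ln y - ln (bdry u)))) = exp (- r * (T - t)) * exp (r * (T - u)) * (K - y)"
    using K0 by (simp add: kap_def expabs_tvar[OF r0 assms(2)] field_simps)
  also have "exp (- r * (T - t)) * exp (r * (T - u)) = exp (- r * (u - t))"
    by (simp add: exp_add[symmetric] algebra_simps)
  finally show ?thesis by simp
qed

lemma pay_eq: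
  assumes "u \<in> {t..T}" "0 < X u \<omega>"
  shows "pay u \<omega> = kap * max 0 (expabs (v u) 0 - exp (v u / 2 + Z u \<omega>))"
proof -
  have "pay u \<omega> = max 0 (exp (- r * (u - t)) * (K - X u \<omega>))"
    by (simp add: pay_def max_mult_distrib_left)
  also have "\<dots> = kap * max 0 (expabs (v u) 0 - exp (v u / 2 + Z u \<omega>))"
    using assms kap_pos by (subst value_identity) (auto simp: Z_def max_mult_distrib_left)
  finally show ?thesis .
qed

lemma immediate_value: "kap * (expabs (v t) 0 - exp (v t / 2 + z0)) = K - x"
  using value_identity[of t x] t x0 by (simp add: z0_def)

lemma pay_bounds: "AE \<omega> in M. \<forall>u\<in>{t..T}. 0 \<le> pay u \<omega> \<and> pay u \<omega> \<le> K"
  using X_nonneg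
proof eventually_elim
  case (elim \<omega>)
  show ?case
  proof
    fix u assume u: "u \<in> {t..T}"
    have "exp (- r * (u - t)) * max 0 (K - X u \<omega>) \<le> 1 * K"
      using elim u K0 r0 by (intro mult_mono) (auto simp: mult_nonneg_nonneg)
    then show "0 \<le> pay u \<omega> \<and> pay u \<omega> \<le> K" by (simp add: pay_def)
  qed
qed

lemma pay_M: "u \<in> {t..T} \<Longrightarrow> pay u \<in> borel_measurable M"
  unfolding pay_def[abs_def] using X_M[of u] by simp

lemma pay_cont: "\<omega> \<in> space M \<Longrightarrow> continuous_on {t..T} (\<lambda>u. pay u \<omega>)"
  unfolding pay_def by (intro continuous_intros X_cont)

lemma gr_diff_tvar: "i < n \<Longrightarrow> 0 \<le> v (gr n i) - v (gr n (Suc i))"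
  using tvar_antimono[OF r0, of "gr n i" "gr n (Suc i)" T] gr_mono[of i "Suc i" n] gr_in[of "Suc i" n] by simp

lemma stopped_pay_M:
  assumes "\<And>\<omega>. \<iota> \<omega> \<le> n" "\<And>i. i < n \<Longrightarrow> {\<omega> \<in> space M. i < \<iota> \<omega>} \<in> sets (F (gr n i))"
  shows "(\<lambda>\<omega>. pay (gr n (\<iota> \<omega>)) \<omega>) \<in> borel_measurable M"
proof (rule stopped_measurable[where m=n and N="\<lambda>i. pay (gr n i)"])
  show "pay (gr n i) \<in> borel_measurable M" if "i \<le> n" for i using that by (intro pay_M gr_in')
  show "{\<omega> \<in> space M. i < \<iota> \<omega>} \<in> events" if "i < n" for i using assms(2)[OF that] by (rule sets_F_M)
qed (rule assms)

lemma stopped_pay_integrable: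
  assumes "\<And>\<omega>. \<iota> \<omega> \<le> n" "\<And>i. i < n \<Longrightarrow> {\<omega> \<in> space M. i < \<iota> \<omega>} \<in> sets (F (gr n i))"
  shows "integrable M (\<lambda>\<omega>. pay (gr n (\<iota> \<omega>)) \<omega>)"
proof (rule integrable_const_bound[of _ K])
  show "AE \<omega> in M. norm (pay (gr n (\<iota> \<omega>)) \<omega>) \<le> K"
    using pay_bounds by eventually_elim (use gr_in'[OF assms(1)] in auto)
qed (rule stopped_pay_M[OF assms])

text \<open>The envelope dominates the payoff and is a supermartingale along the grid. The stopping
  index may use all information in \<open>F\<close>, which contains the natural filtration.\<close>

lemma discrete_upper_bound:
  assumes \<iota>: "\<And>\<omega>. \<iota> \<omega> \<le> n" "\<And>i. i < n \<Longrightarrow> {\<omega> \<in> space M. i < \<iota> \<omega>} \<in> sets (F (gr n i))"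
  shows "expectation (\<lambda>\<omega>. pay (gr n (\<iota> \<omega>)) \<omega>) \<le> kap * snell (v t) z0"
proof -
  let ?N = "\<lambda>i \<omega>. snell (v (gr n i)) (Z (gr n i) \<omega>)"
  have [measurable]: "snell w \<in> borel_measurable borel" for w
    by (rule borel_measurable_continuous_onI[OF continuous_snell])
  have NM[measurable]: "?N i \<in> borel_measurable M" if "i \<le> n" for i
    using Z_M[OF gr_in'[OF that]] by simp
  have NB: "\<bar>?N i \<omega>\<bar> \<le> expabs (v t) 0" if "i \<le> n" for i \<omega>
  proof -
    have "\<bar>?N i \<omega>\<bar> \<le> expabs (v (gr n i)) 0" by (intro snell_bound tvar_nonneg[OF r0])
    also have "\<dots> \<le> expabs (v t) 0"
      using gr_in[OF that] t r0 by (simp add: expabs_tvar[OF r0])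
    finally show ?thesis .
  qed
  have super: "expectation (\<lambda>\<omega>. indicator A \<omega> * ?N (Suc i) \<omega>) \<le> expectation (\<lambda>\<omega>. indicator A \<omega> * ?N i \<omega>)"
    if i: "i < n" and A: "A \<in> sets (F (gr n i))" for i A
  proof -
    let ?h = "v (gr n i) - v (gr n (Suc i))"
    have [measurable]: "A \<in> events" using A by (rule sets_F_M)
    have [measurable]: "Z (gr n i) \<in> borel_measurable M" using i by (intro Z_M gr_in') auto
    have b: "\<bar>snell (v (gr n (Suc i))) z\<bar> \<le> expabs (v (gr n (Suc i))) 0" for z by (intro snell_bound tvar_nonneg[OF r0])
    have "expectation (\<lambda>\<omega>. indicator A \<omega> * ?N (Suc i) \<omega>) = expectation (\<lambda>\<omega>. indicator A \<omega> * gauss ?h (snell (v (gr n (Suc i)))) (Z (gr n i) \<omega>))"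
      using i gr_in[of i n] gr_in[of "Suc i" n] gr_mono[of i "Suc i" n] A
      by (intro Z_transition[where C = "expabs (v (gr n (Suc i))) 0"] continuous_snell b) auto
    also have "\<dots> \<le> expectation (\<lambda>\<omega>. indicator A \<omega> * ?N i \<omega>)"
    proof (intro integral_mono)
      show "integrable M (\<lambda>\<omega>. indicator A \<omega> * gauss ?h (snell (v (gr n (Suc i)))) (Z (gr n i) \<omega>))"
        using gauss_bound[OF _ b] expabs_pos[of "v (gr n (Suc i))" 0]
        by (intro integrable_const_bound[of _ "expabs (v (gr n (Suc i))) 0"] AE_I2) (auto split: split_indicator)
      show "integrable M (\<lambda>\<omega>. indicator A \<omega> * ?N i \<omega>)"
        using NB[of i] i expabs_pos[of "v t" 0] NM[of i]
        by (intro integrable_const_bound[of _ "expabs (v t) 0"] AE_I2) (auto split: split_indicator)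
      show "indicator A \<omega> * gauss ?h (snell (v (gr n (Suc i)))) (Z (gr n i) \<omega>) \<le> indicator A \<omega> * ?N i \<omega>" for \<omega>
        using gauss_snell_le[OF gr_diff_tvar[OF i] tvar_nonneg[OF r0, of T "gr n (Suc i)"], of "Z (gr n i) \<omega>"]
        by (auto split: split_indicator)
    qed
    finally show ?thesis .
  qed
  have NB': "AE \<omega> in M. \<bar>?N i \<omega>\<bar> \<le> expabs (v t) 0" if "i \<le> n" for i by (intro AE_I2 NB[OF that])
  note st = discrete_stopping[where N = ?N and p = "gr n" and m = n and C = "expabs (v t) 0" and \<iota> = \<iota>, OF NM NB' \<iota> super]
  have "expectation (\<lambda>\<omega>. pay (gr n (\<iota> \<omega>)) \<omega>) \<le> expectation (\<lambda>\<omega>. kap * ?N (\<iota> \<omega>) \<omega>)"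
  proof (rule integral_mono_AE)
    show "integrable M (\<lambda>\<omega>. pay (gr n (\<iota> \<omega>)) \<omega>)" by (rule stopped_pay_integrable[OF \<iota>])
    show "AE \<omega> in M. pay (gr n (\<iota> \<omega>)) \<omega> \<le> kap * ?N (\<iota> \<omega>) \<omega>"
      using X_pos_grid
    proof eventually_elim
      case (elim \<omega>)
      then have "pay (gr n (\<iota> \<omega>)) \<omega> = kap * max 0 (expabs (v (gr n (\<iota> \<omega>))) 0 - exp (v (gr n (\<iota> \<omega>)) / 2 + Z (gr n (\<iota> \<omega>)) \<omega>))"
        using \<iota>(1)[of \<omega>] gr_in'[OF \<iota>(1)] by (intro pay_eq) auto
      also have "\<dots> \<le> kap * ?N (\<iota> \<omega>) \<omega>"
        using kap_pos by (intro mult_left_mono snell_ge tvar_nonneg[OF r0]) auto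
      finally show ?case .
    qed
    show "integrable M (\<lambda>\<omega>. kap * ?N (\<iota> \<omega>) \<omega>)" by (rule integrable_mult_right[OF st(1)])
  qed
  also have "\<dots> = kap * expectation (\<lambda>\<omega>. ?N (\<iota> \<omega>) \<omega>)" by simp
  also have "\<dots> \<le> kap * expectation (?N 0)" by (rule mult_left_mono[OF st(2) less_imp_le[OF kap_pos]])
  also have "expectation (?N 0) = snell (v t) z0"
  proof -
    have "expectation (?N 0) = expectation (\<lambda>_. snell (v t) z0)"
      using Z_start NM[of 0] by (intro integral_cong_AE) (auto simp: gr_0)
    then show ?thesis by (simp add: prob_space)
  qed
  finally show ?thesis .
qed

section \<open>Upper bound for all stopping times\<close>

abbreviation FX :: "real \<Rightarrow> 'a measure" where "FX \<equiv> natural_filtration (space M) {t..T} X"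

lemma FX_F: "A \<in> sets (FX u) \<Longrightarrow> u \<le> T \<Longrightarrow> A \<in> sets (F u)"
proof -
  have "{X s -` B \<inter> space M | s B. s \<in> {t..T} \<and> s \<le> u \<and> B \<in> sets borel} \<subseteq> sets (F u)"
    using measurable_sets[OF measurable_F_mono[OF X_F]] by auto
  then have "sigma_sets (space M) {X s -` B \<inter> space M | s B. s \<in> {t..T} \<and> s \<le> u \<and> B \<in> sets borel} \<subseteq> sets (F u)"
    using sets.sigma_sets_subset[of _ "F u"] by simp
  then show "A \<in> sets (FX u) \<Longrightarrow> u \<le> T \<Longrightarrow> A \<in> sets (F u)"
    unfolding natural_filtration_def by (subst (asm) sets_measure_of) auto
qed

text \<open>The stopping time is approximated by grid times; path continuity of the payoff and its
  bound \<open>K\<close> give the limit.\<close>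

lemma upper_bound:
  assumes \<tau>: "stopping_time FX \<tau>" "\<And>\<omega>. \<omega> \<in> space M \<Longrightarrow> \<tau> \<omega> \<in> {t..T}"
  shows "expectation (\<lambda>\<omega>. pay (\<tau> \<omega>) \<omega>) \<le> kap * snell (v t) z0"
proof -
  \<comment> \<open>Rounding up to the grid, except that times after \<open>gr n n\<close> are moved
    back to it; either way the shift is at most one mesh.\<close>
  define \<iota> where "\<iota> n \<omega> = (LEAST i. i = n \<or> \<tau> \<omega> \<le> gr n i)" for n \<omega>
  have \<iota>n: "\<iota> n \<omega> \<le> n" for n \<omega> unfolding \<iota>_def by (rule Least_le) simp
  have \<iota>_prop: "\<iota> n \<omega> = n \<or> \<tau> \<omega> \<le> gr n (\<iota> n \<omega>)" for n \<omega>
    unfolding \<iota>_def by (rule LeastI[where P = "\<lambda>i. i = n \<or> \<tau> \<omega> \<le> gr n i" and k = n]) simp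
  have \<iota>_less: "i < \<iota> n \<omega> \<longleftrightarrow> gr n i < \<tau> \<omega>" if "i < n" for i n \<omega>
  proof
    assume "i < \<iota> n \<omega>"
    then show "gr n i < \<tau> \<omega>" unfolding \<iota>_def using not_less_Least by fastforce
  next
    assume "gr n i < \<tau> \<omega>"
    show "i < \<iota> n \<omega>"
    proof (rule ccontr)
      assume "\<not> i < \<iota> n \<omega>"
      then have "\<tau> \<omega> \<le> gr n i" using \<iota>_prop[of n \<omega>] that gr_mono[of "\<iota> n \<omega>" i n] by auto
      then show False using \<open>gr n i < \<tau> \<omega>\<close> by simp
    qed
  qed
  have \<iota>F: "{\<omega> \<in> space M. i < \<iota> n \<omega>} \<in> sets (F (gr n i))" if "i < n" for i n
  proof -
    have "{\<omega> \<in> space (FX (gr n i)). gr n i < \<tau> \<omega>} \<in> sets (FX (gr n i))"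
      using stopping_timeD2[OF \<tau>(1), of "gr n i"] by (simp add: Measurable.pred_def)
    then have "{\<omega> \<in> space M. gr n i < \<tau> \<omega>} \<in> sets (F (gr n i))"
      using gr_in'[of i n] that by (intro FX_F) auto
    then show ?thesis by (simp only: \<iota>_less[OF that])
  qed
  have lim: "(\<lambda>n. pay (gr n (\<iota> n \<omega>)) \<omega>) \<longlonglongrightarrow> pay (\<tau> \<omega>) \<omega>" if \<omega>: "\<omega> \<in> space M" for \<omega>
  proof -
    have "\<bar>gr n (\<iota> n \<omega>) - \<tau> \<omega>\<bar> \<le> (T - t) / real (Suc n)" for n
    proof (cases "\<tau> \<omega> \<le> gr n (\<iota> n \<omega>)")
      case True
      show ?thesis
      proof (cases "\<iota> n \<omega>")
        case 0
        have "\<tau> \<omega> = t" using True \<tau>(2)[OF \<omega>] unfolding 0 gr_0 by simp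
        then show ?thesis unfolding 0 gr_0 using t by simp
      next
        case (Suc i)
        then have "gr n i < \<tau> \<omega>" using \<iota>_less[of i n \<omega>] \<iota>n[of n \<omega>] by simp
        then show ?thesis using True Suc gr_Suc[of n i] by simp
      qed
    next
      case False
      then have "\<iota> n \<omega> = n" using \<iota>_prop[of n \<omega>] by simp
      then show ?thesis using False gr_last[of n] \<tau>(2)[OF \<omega>] by auto
    qed
    then have "(\<lambda>n. gr n (\<iota> n \<omega>) - \<tau> \<omega>) \<longlonglongrightarrow> 0"
      by (intro Lim_null_comparison[OF _ mesh_lim]) auto
    then have "(\<lambda>n. gr n (\<iota> n \<omega>)) \<longlonglongrightarrow> \<tau> \<omega>" by (simp add: LIM_zero_iff)
    then show ?thesis
      using gr_in'[OF \<iota>n] \<tau>(2)[OF \<omega>] by (intro continuous_on_tendsto_compose[OF pay_cont[OF \<omega>]]) auto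
  qed
  have M: "(\<lambda>\<omega>. pay (gr n (\<iota> n \<omega>)) \<omega>) \<in> borel_measurable M" for n
    by (rule stopped_pay_M[OF \<iota>n \<iota>F])
  have "(\<lambda>n. expectation (\<lambda>\<omega>. pay (gr n (\<iota> n \<omega>)) \<omega>)) \<longlonglongrightarrow> expectation (\<lambda>\<omega>. pay (\<tau> \<omega>) \<omega>)"
  proof (rule integral_dominated_convergence[where w="\<lambda>_. K"])
    show "(\<lambda>\<omega>. pay (\<tau> \<omega>) \<omega>) \<in> borel_measurable M" by (rule borel_measurable_LIMSEQ_real[OF lim M])
    show "AE \<omega> in M. norm (pay (gr n (\<iota> n \<omega>)) \<omega>) \<le> K" for n
      using pay_bounds by eventually_elim (use gr_in'[OF \<iota>n] in auto)
  qed (use M lim in auto)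
  then show ?thesis
    by (rule LIMSEQ_le_const2) (use discrete_upper_bound[OF \<iota>n \<iota>F] in auto)
qed

section \<open>Lower bound by stopping at the boundary\<close>

lemma bdry_cont: "continuous_on {t..T} bdry"
  unfolding bdry_def[abs_def]
  by (intro continuous_intros continuous_at_imp_continuous_on ballI isCont_tvar[OF r0]) auto

text \<open>If no earlier grid price lies at or below the boundary, the default is the last index
  \<open>n\<close>, the stand-in for maturity.\<close>

definition hit :: "nat \<Rightarrow> 'a \<Rightarrow> nat" where
  "hit n \<omega> = (LEAST i. i = n \<or> X (gr n i) \<omega> \<le> bdry (gr n i))"

lemma hit_le: "hit n \<omega> \<le> n" unfolding hit_def by (rule Least_le) simp

lemma hit_prop: "hit n \<omega> = n \<or> X (gr n (hit n \<omega>)) \<omega> \<le> bdry (gr n (hit n \<omega>))"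
  unfolding hit_def by (rule LeastI[where P = "\<lambda>i. i = n \<or> X (gr n i) \<omega> \<le> bdry (gr n i)" and k = n]) simp

lemma before_hit: "i < hit n \<omega> \<Longrightarrow> bdry (gr n i) < X (gr n i) \<omega>"
  unfolding hit_def using not_less_Least by fastforce

lemma hit_less_eq: "i < n \<Longrightarrow> i < hit n \<omega> \<longleftrightarrow> (\<forall>j\<in>{..i}. bdry (gr n j) < X (gr n j) \<omega>)"
  using before_hit[of _ n \<omega>] hit_prop[of n \<omega>]
  by (intro iffI ballI ccontr[of "i < hit n \<omega>"]) (auto simp: not_less dest!: bspec[of _ _ "hit n \<omega>"])

lemma hit_F: "i < n \<Longrightarrow> {\<omega> \<in> space M. i < hit n \<omega>} \<in> sets (F (gr n i))"
proof -
  assume i: "i < n"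
  have [measurable]: "X (gr n j) \<in> borel_measurable (F (gr n i))" if "j \<in> {..i}" for j
    using that i by (intro measurable_F_mono[OF X_F] gr_in' gr_mono) auto
  have "{\<omega> \<in> space (F (gr n i)). \<forall>j\<in>{..i}. bdry (gr n j) < X (gr n j) \<omega>} \<in> sets (F (gr n i))" by measurable
  then show ?thesis using hit_less_eq[OF i] by simp
qed

text \<open>Whether the stop has occurred by time \<open>w\<close> is decided by the finitely many
  grid prices observed up to \<open>w\<close>.\<close>

lemma hit_stopping_time: "stopping_time FX (\<lambda>\<omega>. gr n (hit n \<omega>))"
proof (rule stopping_timeI)
  fix w
  let ?I = "{i. i \<le> n \<and> gr n i \<le> w}"
  have [measurable]: "X (gr n i) \<in> borel_measurable (FX w)" if "i \<in> ?I" for i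
    using that gr_in' by (intro natural_filtration_measurable) auto
  have "gr n (hit n \<omega>) \<le> w \<longleftrightarrow> (\<exists>i\<in>?I. i = n \<or> X (gr n i) \<omega> \<le> bdry (gr n i))" for \<omega>
  proof
    assume "gr n (hit n \<omega>) \<le> w"
    then show "\<exists>i\<in>?I. i = n \<or> X (gr n i) \<omega> \<le> bdry (gr n i)" using hit_le[of n \<omega>] hit_prop[of n \<omega>] by blast
  next
    assume "\<exists>i\<in>?I. i = n \<or> X (gr n i) \<omega> \<le> bdry (gr n i)"
    then obtain i where i: "i \<in> ?I" "i = n \<or> X (gr n i) \<omega> \<le> bdry (gr n i)" by blast
    then have "hit n \<omega> \<le> i" unfolding hit_def by (intro Least_le)
    then show "gr n (hit n \<omega>) \<le> w" using gr_mono[of "hit n \<omega>" i n] i by auto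
  qed
  moreover have "Measurable.pred (FX w) (\<lambda>\<omega>. \<exists>i\<in>?I. i = n \<or> X (gr n i) \<omega> \<le> bdry (gr n i))"
    by measurable
  ultimately show "Measurable.pred (FX w) (\<lambda>\<omega>. gr n (hit n \<omega>) \<le> w)" by simp
qed

lemma Z_le_0_iff: "0 < X u \<omega> \<Longrightarrow> Z u \<omega> \<le> 0 \<longleftrightarrow> X u \<omega> \<le> bdry u"
  using bdry_pos[of u] by (simp add: Z_def)

text \<open>For positive prices this is the relative overshoot \<open>bdry / X - 1\<close> at the
  stopping index, and 0 if the price stops above the boundary.\<close>

definition over :: "nat \<Rightarrow> 'a \<Rightarrow> real" where
  "over n \<omega> = exp (max 0 (- Z (gr n (hit n \<omega>)) \<omega>)) - 1"

text \<open>At the index before the stop the price was still above the boundary, and one mesh later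
  it can be only a little below. The start above the boundary ensures that there is such an
  index.\<close>

lemma over_tendsto_0:
  assumes xb: "bdry t < x"
  shows "AE \<omega> in M. (\<lambda>n. over n \<omega>) \<longlonglongrightarrow> 0"
  using X_pos_grid X_start AE_space
proof eventually_elim
  case (elim \<omega>)
  \<comment> \<open>A lower bound for the boundary; it keeps the denominator of the relative
    overshoot away from 0.\<close>
  define bm where "bm = K * exp (- r * (T - t))"
  have bm: "0 < bm" "\<And>u. t \<le> u \<Longrightarrow> bm \<le> bdry u"
  proof -
    show "0 < bm" using K0 by (simp add: bm_def)
    fix u assume u: "t \<le> u"
    have "K * exp (- r * (T - t)) * 1 \<le> K * exp (- r * (T - u)) * exp (v u / 2)"
      using K0 r0 u tvar_nonneg[OF r0, of T u] by (intro mult_mono mult_left_mono) auto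
    then show "bm \<le> bdry u" by (simp add: bm_def bdry_def)
  qed
  show ?case
  proof (rule LIMSEQ_I)
    fix e :: real assume e: "0 < e"
    \<comment> \<open>The first term keeps the price at the stop above \<open>bm / 2\<close>, the
      second makes \<open>2 * \<theta> / (bm / 2)\<close> at most \<open>e / 2\<close>.\<close>
    define \<theta> where "\<theta> = min (bm / 4) (e * bm / 8)"
    have \<theta>: "0 < \<theta>" "4 * \<theta> \<le> bm" "8 * \<theta> \<le> e * bm" using e bm by (auto simp: \<theta>_def)
    have "uniformly_continuous_on {t..T} (\<lambda>u. X u \<omega>)" "uniformly_continuous_on {t..T} bdry"
      using X_cont[OF elim(3)] bdry_cont by (auto intro!: compact_uniformly_continuous)
    then obtain d1 d2 where d: "0 < d1" "0 < d2"
      "\<And>a c. a \<in> {t..T} \<Longrightarrow> c \<in> {t..T} \<Longrightarrow> dist c a < d1 \<Longrightarrow> dist (X c \<omega>) (X a \<omega>) < \<theta>"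
      "\<And>a c. a \<in> {t..T} \<Longrightarrow> c \<in> {t..T} \<Longrightarrow> dist c a < d2 \<Longrightarrow> dist (bdry c) (bdry a) < \<theta>"
      using \<theta>(1) unfolding uniformly_continuous_on_def by metis
    have "\<forall>\<^sub>F n in sequentially. (T - t) / real (Suc n) < min d1 d2"
      using mesh_lim d by (intro order_tendstoD) auto
    then obtain n0 where n0: "\<And>n. n \<ge> n0 \<Longrightarrow> (T - t) / real (Suc n) < min d1 d2"
      by (auto simp: eventually_sequentially)
    have "norm (over n \<omega> - 0) < e" if n: "n \<ge> n0" for n
    proof -
      define u where "u = gr n (hit n \<omega>)"
      have Xu: "0 < X u \<omega>" using elim(1) hit_le[of n \<omega>] by (simp add: u_def)
      have u: "t \<le> u" using gr_in[OF hit_le] by (simp add: u_def)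
      show ?thesis
      proof (cases "Z u \<omega> \<le> 0")
        case False
        then show ?thesis using e by (simp add: over_def u_def)
      next
        case True
        then have Xb: "X u \<omega> \<le> bdry u" using Z_le_0_iff[OF Xu] by simp
        obtain i where i: "hit n \<omega> = Suc i"
          using Xb elim(2) xb by (cases "hit n \<omega>") (auto simp: u_def gr_0)
        have near: "bdry u - X u \<omega> \<le> 2 * \<theta>"
        proof -
          have "Suc i \<le> n" using hit_le[of n \<omega>] i by simp
          then have in': "gr n i \<in> {t..T}" "u \<in> {t..T}" using gr_in'[of i n] gr_in'[OF hit_le[of n \<omega>]] by (auto simp: u_def)
          have "dist u (gr n i) < min d1 d2" using n0[OF n] t by (simp add: u_def i gr_Suc dist_real_def)
          then have "dist (X u \<omega>) (X (gr n i) \<omega>) < \<theta>" "dist (bdry u) (bdry (gr n i)) < \<theta>"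
            using d(3)[OF in'] d(4)[OF in'] by auto
          moreover have "bdry (gr n i) < X (gr n i) \<omega>" by (rule before_hit) (simp add: i)
          ultimately show ?thesis by (auto simp: dist_real_def)
        qed
        then have Xl: "bm / 2 \<le> X u \<omega>" using bm(2)[OF u] \<theta> by linarith
        have "exp (- Z u \<omega>) = bdry u / X u \<omega>" using Xu bdry_pos[of u] by (simp add: Z_def exp_diff)
        then have "over n \<omega> = (bdry u - X u \<omega>) / X u \<omega>"
          using True Xu by (simp add: over_def u_def[symmetric] max_absorb2 diff_divide_distrib)
        also have "\<dots> \<le> (2 * \<theta>) / (bm / 2)"
          using near Xl bm Xb \<theta> by (intro frac_le) auto
        also have "\<dots> \<le> e / 2" using \<theta> bm by (simp add: field_simps)
        finally have "over n \<omega> \<le> e / 2" .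
        moreover have "0 \<le> over n \<omega>" by (simp add: over_def)
        ultimately show ?thesis using e by simp
      qed
    qed
    then show "\<exists>no. \<forall>n\<ge>no. norm (over n \<omega> - 0) < e" by blast
  qed
qed

text \<open>Above the boundary \<open>martpart\<close> starts strictly above the immediate payoff by
  \<open>expabs_gt_0\<close>, and a high truncation level keeps the gap. Stopping on a fine grid
  collects the truncated martingale up to two vanishing losses.\<close>

lemma lower_bound:
  assumes xb: "bdry t < x"
  shows "\<exists>n. K - x < expectation (\<lambda>\<omega>. pay (gr n (hit n \<omega>)) \<omega>)"
proof -
  have "z0 \<noteq> 0" using xb bdry_pos[of t] x0 by (auto simp: z0_def)
  then have "expabs (v t) 0 - exp (v t / 2 + z0) < martpart (v t) z0"
    using expabs_gt_0[of z0 "v t"] by (simp add: martpart_def)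
  then have "\<forall>\<^sub>F n in sequentially. expabs (v t) 0 - exp (v t / 2 + z0) < trunc_mart (real n) (v t) z0"
    by (intro order_tendstoD(1)[OF trunc_mart_tendsto]) (auto simp: tvar_nonneg[OF r0])
  then obtain n1 where n1: "expabs (v t) 0 - exp (v t / 2 + z0) < trunc_mart (real n1) (v t) z0"
    using eventually_happens'[OF sequentially_bot] by blast
  define L where "L = real n1"
  have L: "0 \<le> L" "expabs (v t) 0 - exp (v t / 2 + z0) < trunc_mart L (v t) z0" using n1 by (auto simp: L_def)
  define a where "a = expabs (v t) 0"
  \<comment> \<open>\<open>c n\<close> bounds the loss if the boundary is not met: above the
    boundary the martingale is at most its value on it, and at time \<open>gr n n\<close> that value
    is at most \<open>exp (r * (T - gr n n)) - 1\<close>.\<close>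
  define c where "c n = exp (r * (T - gr n n)) - 1" for n
  \<comment> \<open>\<open>e n\<close> is the loss by overshoot. The cap is legitimate, as the
    truncated martingale never exceeds \<open>L\<close> and the payoff is nonnegative; it makes
    dominated convergence applicable.\<close>
  define e where "e n \<omega> = min L (a * over n \<omega>)" for n \<omega>
  have [measurable]: "trunc_mart L w \<in> borel_measurable borel" for w
    by (rule borel_measurable_continuous_onI[OF continuous_trunc_mart[OF L(1)]])
  have overM[measurable]: "over n \<in> borel_measurable M" for n
  proof -
    have "(\<lambda>\<omega>. Z (gr n (hit n \<omega>)) \<omega>) \<in> borel_measurable M"
    proof (rule stopped_measurable[where m=n and N="\<lambda>i. Z (gr n i)"])
      show "Z (gr n i) \<in> borel_measurable M" if "i \<le> n" for i using that by (intro Z_M gr_in')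
      show "{\<omega> \<in> space M. i < hit n \<omega>} \<in> events" if "i < n" for i using hit_F[OF that] by (rule sets_F_M)
    qed (rule hit_le)
    then show ?thesis unfolding over_def[abs_def] by simp
  qed
  have a0: "0 < a" by (simp add: a_def expabs_pos)
  have over0: "0 \<le> over n \<omega>" for n \<omega> by (simp add: over_def)
  have eM[measurable]: "e n \<in> borel_measurable M" for n unfolding e_def[abs_def] by measurable
  have eB: "0 \<le> e n \<omega>" "e n \<omega> \<le> L" for n \<omega> using L(1) a0 over0[of n \<omega>] by (auto simp: e_def)
  have elim: "(\<lambda>n. expectation (e n)) \<longlonglongrightarrow> expectation (\<lambda>_. 0 :: real)"
  proof (rule integral_dominated_convergence[where w = "\<lambda>_. L"])
    show "AE \<omega> in M. (\<lambda>n. e n \<omega>) \<longlonglongrightarrow> 0"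
      using over_tendsto_0[OF xb]
    proof eventually_elim
      case (elim \<omega>)
      then have "(\<lambda>n. e n \<omega>) \<longlonglongrightarrow> min L (a * 0)" unfolding e_def by (intro tendsto_intros)
      then show ?case using L(1) by simp
    qed
  qed (use eB in auto)
  have clim: "c \<longlonglongrightarrow> 0"
  proof -
    have "(\<lambda>n. exp (r * ((T - t) / real (Suc n))) - 1) \<longlonglongrightarrow> exp (r * 0) - 1"
      by (intro tendsto_intros mesh_lim)
    then show ?thesis by (simp add: c_def[abs_def] gr_last)
  qed
  have c0: "0 \<le> c n" for n using gr_in[of n n] r0 by (simp add: c_def)
  have lower: "kap * (trunc_mart L (v t) z0 - expectation (e n) - c n) \<le> expectation (\<lambda>\<omega>. pay (gr n (hit n \<omega>)) \<omega>)" for n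
  proof -
    \<comment> \<open>The sign turns the upper bound of \<open>discrete_stopping\<close> into a
      lower bound for the stopped martingale.\<close>
    let ?N = "\<lambda>i \<omega>. - trunc_mart L (v (gr n i)) (Z (gr n i) \<omega>)"
    have NM: "?N i \<in> borel_measurable M" if "i \<le> n" for i
      using Z_M[OF gr_in'[OF that]] by simp
    have NB: "AE \<omega> in M. \<bar>?N i \<omega>\<bar> \<le> L" for i using trunc_mart_bound[OF L(1)] by simp
    have super: "expectation (\<lambda>\<omega>. indicator A \<omega> * ?N (Suc i) \<omega>) \<le> expectation (\<lambda>\<omega>. indicator A \<omega> * ?N i \<omega>)"
      if i: "i < n" and A: "A \<in> sets (F (gr n i))" for i A
    proof -
      let ?h = "v (gr n i) - v (gr n (Suc i))"
      have "expectation (\<lambda>\<omega>. indicator A \<omega> * trunc_mart L (v (gr n (Suc i))) (Z (gr n (Suc i)) \<omega>))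
        = expectation (\<lambda>\<omega>. indicator A \<omega> * gauss ?h (trunc_mart L (v (gr n (Suc i)))) (Z (gr n i) \<omega>))"
        using i gr_in[of i n] gr_in[of "Suc i" n] gr_mono[of i "Suc i" n] A
        by (intro Z_transition[where C = L] continuous_trunc_mart trunc_mart_bound L) auto
      also have "\<dots> = expectation (\<lambda>\<omega>. indicator A \<omega> * trunc_mart L (v (gr n i)) (Z (gr n i) \<omega>))"
        using gr_diff_tvar[OF i] tvar_nonneg[OF r0] by (simp add: gauss_trunc_mart[OF L(1)])
      finally show ?thesis by simp
    qed
    note st = discrete_stopping[where N = ?N and p = "gr n" and m = n and C = L and \<iota> = "hit n", OF NM NB hit_le hit_F super]
    have N0: "expectation (?N 0) = - trunc_mart L (v t) z0"
    proof -
      have "expectation (?N 0) = expectation (\<lambda>_. - trunc_mart L (v t) z0)"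
        using Z_start NM[of 0] by (intro integral_cong_AE) (auto simp: gr_0)
      then show ?thesis by (simp add: prob_space)
    qed
    have ei: "integrable M (e n)" using eB by (intro integrable_const_bound[of _ L]) auto
    have pi: "integrable M (\<lambda>\<omega>. pay (gr n (hit n \<omega>)) \<omega>)" by (rule stopped_pay_integrable[OF hit_le hit_F])
    have "expectation (\<lambda>\<omega>. - ?N (hit n \<omega>) \<omega> - e n \<omega> - c n) \<le> expectation (\<lambda>\<omega>. pay (gr n (hit n \<omega>)) \<omega> / kap)"
    proof (rule integral_mono_AE)
      show "integrable M (\<lambda>\<omega>. - ?N (hit n \<omega>) \<omega> - e n \<omega> - c n)"
        by (intro Bochner_Integration.integrable_diff Bochner_Integration.integrable_minus st(1) ei integrable_const)
      show "integrable M (\<lambda>\<omega>. pay (gr n (hit n \<omega>)) \<omega> / kap)" using pi by simp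
      show "AE \<omega> in M. - ?N (hit n \<omega>) \<omega> - e n \<omega> - c n \<le> pay (gr n (hit n \<omega>)) \<omega> / kap"
        using X_pos_grid
      proof eventually_elim
        case (elim \<omega>)
        define u where "u = gr n (hit n \<omega>)"
        have u: "u \<in> {t..<T}" using gr_in[OF hit_le] by (simp add: u_def)
        have Xu: "0 < X u \<omega>" using elim hit_le[of n \<omega>] by (simp add: u_def)
        have p: "pay u \<omega> / kap = max 0 (expabs (v u) 0 - exp (v u / 2 + Z u \<omega>))"
          using pay_eq[of u \<omega>] u Xu kap_pos by simp
        have tm: "trunc_mart L (v u) (Z u \<omega>) \<le> martpart (v u) (Z u \<omega>)"
          using L(1) by (intro trunc_mart_le_martpart tvar_nonneg[OF r0])
        have "trunc_mart L (v u) (Z u \<omega>) - e n \<omega> - c n \<le> pay u \<omega> / kap"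
        proof (cases "Z u \<omega> \<le> 0")
          case True
          have o: "over n \<omega> = exp (- Z u \<omega>) - 1" using True by (simp add: over_def u_def)
          have "expabs (v u) 0 \<le> a"
            using u t r0 by (simp add: a_def expabs_tvar[OF r0])
          then have "over n \<omega> * expabs (v u) 0 \<le> over n \<omega> * a" using over0 by (intro mult_left_mono)
          then have "trunc_mart L (v u) (Z u \<omega>) - a * over n \<omega> \<le> pay u \<omega> / kap"
            using tm martpart_overshoot[OF tvar_nonneg[OF r0] True, of T u] unfolding p o by (simp add: mult.commute)
          moreover have "trunc_mart L (v u) (Z u \<omega>) - L \<le> pay u \<omega> / kap"
            using trunc_mart_bound[OF L(1), of "v u" "Z u \<omega>"] unfolding p by simp
          ultimately show ?thesis using c0[of n] unfolding e_def by linarith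
        next
          case False
          then have "hit n \<omega> = n" using hit_prop[of n \<omega>] Z_le_0_iff[OF Xu] by (auto simp: u_def)
          then have un: "u = gr n n" by (simp add: u_def)
          have "martpart (v u) (Z u \<omega>) \<le> martpart (v u) 0"
            using False by (intro martpart_antimono tvar_nonneg[OF r0]) auto
          also have "\<dots> \<le> c n"
            using u tvar_nonneg[OF r0, of T u] by (simp add: martpart_def expabs_tvar[OF r0] c_def un)
          finally show ?thesis using tm eB(1)[of n \<omega>] unfolding p by simp
        qed
        then show ?case by (simp add: u_def)
      qed
    qed
    moreover have "expectation (\<lambda>\<omega>. - ?N (hit n \<omega>) \<omega> - e n \<omega> - c n) = - expectation (\<lambda>\<omega>. ?N (hit n \<omega>) \<omega>) - expectation (e n) - c n"
    proof -
      have i: "integrable M (\<lambda>\<omega>. - ?N (hit n \<omega>) \<omega>)" by (rule Bochner_Integration.integrable_minus[OF st(1)])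
      have "expectation (\<lambda>\<omega>. - ?N (hit n \<omega>) \<omega> - e n \<omega> - c n) = expectation (\<lambda>\<omega>. - ?N (hit n \<omega>) \<omega> - e n \<omega>) - expectation (\<lambda>_. c n)"
        by (intro Bochner_Integration.integral_diff Bochner_Integration.integrable_diff i ei integrable_const)
      also have "expectation (\<lambda>\<omega>. - ?N (hit n \<omega>) \<omega> - e n \<omega>) = expectation (\<lambda>\<omega>. - ?N (hit n \<omega>) \<omega>) - expectation (e n)"
        by (rule Bochner_Integration.integral_diff[OF i ei])
      also have "expectation (\<lambda>\<omega>. - ?N (hit n \<omega>) \<omega>) = - expectation (\<lambda>\<omega>. ?N (hit n \<omega>) \<omega>)"
        by (rule Bochner_Integration.integral_minus)
      finally show ?thesis by (simp add: prob_space)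
    qed
    moreover have "expectation (\<lambda>\<omega>. ?N (hit n \<omega>) \<omega>) \<le> - trunc_mart L (v t) z0" using st(2) unfolding N0 .
    ultimately have "trunc_mart L (v t) z0 - expectation (e n) - c n \<le> expectation (\<lambda>\<omega>. pay (gr n (hit n \<omega>)) \<omega>) / kap"
      by simp
    then show ?thesis using kap_pos by (simp add: pos_le_divide_eq mult.commute)
  qed
  have "(\<lambda>n. kap * (trunc_mart L (v t) z0 - expectation (e n) - c n)) \<longlonglongrightarrow> kap * (trunc_mart L (v t) z0 - expectation (\<lambda>_. 0 :: real) - 0)"
    by (intro tendsto_intros elim clim)
  moreover have "K - x < kap * (trunc_mart L (v t) z0 - expectation (\<lambda>_. 0 :: real) - 0)"
    unfolding immediate_value[symmetric] using L(2) kap_pos by simp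
  ultimately have "\<forall>\<^sub>F n in sequentially. K - x < kap * (trunc_mart L (v t) z0 - expectation (e n) - c n)"
    by (rule order_tendstoD)
  then obtain n where "K - x < kap * (trunc_mart L (v t) z0 - expectation (e n) - c n)"
    using eventually_happens'[OF sequentially_bot] by blast
  then show ?thesis using lower[of n] by (intro exI[of _ n]) simp
qed

section \<open>The value against immediate exercise\<close>

text \<open>\<open>expabs_ge_exp\<close> at \<open>z = 0\<close> compares
  \<open>exp (v u / 2)\<close> with \<open>exp (r * (T - u))\<close>. Consequently
  \<open>K - x\<close> is nonnegative for \<open>x\<close> up to the boundary and equals its
  positive part.\<close>

lemma bdry_le_K: "u \<le> T \<Longrightarrow> bdry u \<le> K"
proof -
  assume u: "u \<le> T"
  have "exp (v u / 2) \<le> exp (r * (T - u))"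
    using expabs_ge_exp[OF tvar_nonneg[OF r0], of T u 0] by (simp add: expabs_tvar[OF r0 u])
  then have "exp (- r * (T - u)) * exp (v u / 2) \<le> exp (- r * (T - u)) * exp (r * (T - u))"
    by (intro mult_left_mono) auto
  also have "\<dots> = 1" by (simp add: exp_add[symmetric])
  finally have "K * (exp (- r * (T - u)) * exp (v u / 2)) \<le> K * 1" using K0 by (intro mult_left_mono) auto
  then show ?thesis by (simp add: bdry_def mult.assoc)
qed

text \<open>Up to the boundary the envelope equals the immediate payoff, so stopping at once attains
  the upper bound; above it a grid rule does strictly better. The premise makes \<open>X\<close> the
  member for \<open>t\<close> and \<open>x\<close> of the family that
  \<open>american_put_value\<close> takes.\<close>

lemma exercise_iff:
  assumes "Y t x = X"
  shows "american_put_value M r K T Y t x = K - x \<longleftrightarrow> x \<le> bdry t"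
proof -
  let ?S = "{\<tau>. stopping_time FX \<tau> \<and> (\<forall>\<omega>\<in>space M. \<tau> \<omega> \<in> {t..T})}"
  have V: "american_put_value M r K T Y t x = (SUP \<tau>\<in>?S. expectation (\<lambda>\<omega>. pay (\<tau> \<omega>) \<omega>))"
    unfolding american_put_value_def assms pay_def ..
  have ub: "expectation (\<lambda>\<omega>. pay (\<tau> \<omega>) \<omega>) \<le> kap * snell (v t) z0" if "\<tau> \<in> ?S" for \<tau>
    using that by (intro upper_bound) auto
  then have bdd: "bdd_above ((\<lambda>\<tau>. expectation (\<lambda>\<omega>. pay (\<tau> \<omega>) \<omega>)) ` ?S)"
    by (intro bdd_aboveI2)
  have now: "(\<lambda>_. t) \<in> ?S" using t by (auto intro: stopping_time_const)
  show ?thesis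
  proof
    assume xb: "x \<le> bdry t"
    then have z0: "z0 \<le> 0" using x0 bdry_pos[of t] by (simp add: z0_def)
    have "kap * snell (v t) z0 = K - x" using z0 immediate_value by (simp add: snell_eq)
    then have "(SUP \<tau>\<in>?S. expectation (\<lambda>\<omega>. pay (\<tau> \<omega>) \<omega>)) \<le> K - x"
      using ub now by (intro cSUP_least) auto
    moreover have "K - x \<le> (SUP \<tau>\<in>?S. expectation (\<lambda>\<omega>. pay (\<tau> \<omega>) \<omega>))"
    proof -
      have "expectation (pay t) = expectation (\<lambda>_. max 0 (K - x))"
        using X_start pay_M[of t] t by (intro integral_cong_AE) (auto simp: pay_def)
      also have "\<dots> = K - x" using xb bdry_le_K[of t] t by (simp add: prob_space)
      finally have "K - x = expectation (\<lambda>\<omega>. pay t \<omega>)" by simp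
      also have "\<dots> \<le> (SUP \<tau>\<in>?S. expectation (\<lambda>\<omega>. pay (\<tau> \<omega>) \<omega>))"
        by (rule cSUP_upper[OF now bdd])
      finally show ?thesis .
    qed
    ultimately show "american_put_value M r K T Y t x = K - x" unfolding V by simp
  next
    assume eq: "american_put_value M r K T Y t x = K - x"
    show "x \<le> bdry t"
    proof (rule ccontr)
      assume "\<not> x \<le> bdry t"
      then obtain n where n: "K - x < expectation (\<lambda>\<omega>. pay (gr n (hit n \<omega>)) \<omega>)" using lower_bound by auto
      have "(\<lambda>\<omega>. gr n (hit n \<omega>)) \<in> ?S" using hit_stopping_time gr_in'[OF hit_le] by auto
      then have "expectation (\<lambda>\<omega>. pay (gr n (hit n \<omega>)) \<omega>) \<le> american_put_value M r K T Y t x"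
        unfolding V by (rule cSUP_upper[OF _ bdd])
      then show False using n eq by simp
    qed
  qed
qed

end

theorem theorem5p1:
  fixes Q :: "'a measure"
    and F :: "real \<Rightarrow> 'a measure"
    and W :: "real \<Rightarrow> 'a \<Rightarrow> real"
    and X :: "real \<Rightarrow> real \<Rightarrow> real \<Rightarrow> 'a \<Rightarrow> real"
    and K T r :: real
    and V :: "real \<Rightarrow> real \<Rightarrow> real"
    and b :: "real \<Rightarrow> real"
  assumes "K > 0" and "T > 0" and "r > 0"
    and "brownian_motion Q F W"
    and "\<And>t x. t \<in> {0..<T} \<Longrightarrow> x > 0 \<Longrightarrow>
           sde_solution Q F W (\<lambda>s y. r * y) (\<lambda>s y. vol r T s * y) T t x (X t x)"
  defines "V \<equiv> american_put_value Q r K T X"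
    and "b \<equiv> \<lambda>t. K * exp (- r * (T - t)) * exp (LINT s:{t..<T}|lborel. (vol r T s)\<^sup>2 / 2)"
  shows "(\<forall>t\<in>{0..<T}. \<exists>!y. phi_equation r T t y) \<and>
         optimal_exercise_boundary V K T b \<and>
         (\<forall>t\<in>{0..<T}. b t = K / (2 * std_normal_cdf (phi r T t)))"
proof (intro conjI ballI)
  fix t assume t: "t \<in> {0..<T}"
  show "\<exists>!y. phi_equation r T t y" using t assms(3) by (intro phi_equation_ex1) auto
  \<comment> \<open>Solving the equation for the discount factor puts
    \<open>exp ((phi r T t)\<^sup>2 / 2)\<close> into a denominator, where it cancels the variance
    factor of \<open>b t\<close>.\<close>
  have "exp (r * (T - t)) = 2 * (exp ((phi r T t)\<^sup>2 / 2) * std_normal_cdf (phi r T t))"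
    using mills_phi[OF assms(3), of t T] t by (simp add: mills_def)
  then have "exp (- r * (T - t)) = 1 / (2 * (exp ((phi r T t)\<^sup>2 / 2) * std_normal_cdf (phi r T t)))"
    by (simp add: exp_minus inverse_eq_divide)
  moreover have "b t = K * exp (- r * (T - t)) * exp ((phi r T t)\<^sup>2 / 2)"
    using t unfolding b_def by (subst LINT_vol[OF assms(3)]) (auto simp: tvar_def[OF assms(3)])
  ultimately show "b t = K / (2 * std_normal_cdf (phi r T t))" by simp
next
  have "V t x = K - x \<longleftrightarrow> x \<le> b t" if "t \<in> {0..<T}" "0 < x" for t x
  proof -
    interpret bm Q F W by standard fact
    interpret put_problem Q F W r K T t x "X t x"
      using that assms(1,3,5) by unfold_locales auto
    show ?thesis
      using exercise_iff[of X, OF refl] that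
      unfolding V_def b_def bdry_def by (subst LINT_vol[OF assms(3)]) auto
  qed
  then show "optimal_exercise_boundary V K T b"
    using assms(1) by (auto simp: optimal_exercise_boundary_def exercise_region_def b_def)
qed

end
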